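(* For all $w \in W$, the set $\mathscr{M}(w)$ coincides with the set of reduced skew pipe dreams $D \in \mathcal{SPD}_n$ such that $w_D = w$.
   Context: **Weyl group.** Fix an integer $n \ge 2$, put $[n]=\{1,\dots,n\}$, $\tilde I=\{\pm i \mid i\in[n]\}$, $N = n^2$. $W$ is the group of signed permutations, i.e. permutations $\sigma$ of $\tilde I$ with $\sigma(-i)=-\sigma(i)$ for all $i$ (product is composition, right factor applied first; identity $e$). It is generated by $s_1=(1\ \ {-1})$ and $s_k=(k-1\ \ k)(-(k-1)\ \ {-k})$ for $2\le k\le n$. $\ell(w)$ is the minimal length of an expression of $w$ as a product of the $s_i$; $R(w)$ is the set of reduced words $(i_1,\dots,i_r)$ for $w$ (so $w=s_{i_1}\cdots s_{i_r}$, $r=\ell(w)$). $w_0\in W$, $w_0(i)=-i$, is the longest element; $\ell(w_0)=N$. **Skew pipe dreams.** $SY_n=\{(i,j)\in\mathbb{Z}^2\mid 1\le i\le n,\ i\le j\le 2n-i\}$ (boxes; $i$ = row counted from the top, $j$ = column counted from the left). $\mathcal{SPD}_n$ is the power set of $SY_n$; its elements are called skew pipe dreams. The boxes of $SY_n$ are listed as $(p_1,q_1),\dots,(p_N,q_N)$ by going through the rows from row $n$ up to row $1$, each row from right to left: $(n,n),(n-1,n+1),(n-1,n),(n-1,n-1),\dots,(1,2n-1),\dots,(1,2),(1,1)$. Let ${\bm i}_C=(i_1,\dots,i_N)=(1,\,2,1,2,\,3,2,1,2,3,\,\dots,\,n,n-1,\dots,1,\dots,n-1,n)\in R(w_0)$.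 For $w\in W$, let ${\bm k}_w=(k_1<\dots<k_{\ell(w)})$ be the lexicographically smallest sequence in $[N]^{\ell(w)}$, strictly increasing, with $(i_{k_1},\dots,i_{k_{\ell(w)}})\in R(w)$ (empty if $w=e$). **Ladder moves.** Let $D\in\mathcal{SPD}_n$ and $(i,j)=(p_k,q_k)\in SY_n$. The ladder move $L_{i,j}(D)$ is defined if $(i,j)\in D$, $(i,j+1)\notin D$, and there is $k+1\le \ell\le N$ with $q_\ell\in\{j,2n-j\}$ such that $(p_\ell,q_\ell),(p_\ell,q_\ell+1)\in SY_n\setminus D$ and $(p_r,q_r),(p_r,q_r+1)\in D$ for all $k+1\le r\le \ell-1$ with $q_r\in\{j,2n-j\}$. Then $L_{i,j}(D)=D\cup\{(p_\ell,q_\ell+1)\}\setminus\{(i,j)\}$. **The operators $M_i$ and the set $\mathscr{M}(w)$.** For $D\in\mathcal{SPD}_n$, $i\in[n]$, let $r_0=\max\{1\le r\le N\mid q_r\in\{n-i+1,n+i-1\},\ (p_r,q_r+1)\notin D\}$. If $\{(p_r,q_r)\mid q_r\in\{n-i+1,n+i-1\},\ r_0\le r\le N\}\not\subseteq D$, set $M_i(D)=\emptyset$. Otherwise $M_i(D)$ is the set of elements of $\mathcal{SPD}_n$ obtained from $D\setminus\{(p_{r_0},q_{r_0})\}$ by (possibly empty) sequences of ladder moves $L_{p,q}$ with $q\in\{n-i+1,n+i-1\}$. For $\mathcal{A}\subseteq\mathcal{SPD}_n$, $M_i(\mathcal{A})=\bigcup_{D\in\mathcal{A}}M_i(D)$.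 For $w\in W$ with ${\bm k}_w=(k_1,\dots,k_\ell)$, $\mathscr{M}(w)=M_{i_{k_\ell}}\cdots M_{i_{k_1}}(\{SY_n\})$. **Path model, $w_D$, reducedness.** Let $\widetilde{SY}_n=\{(i,j)\mid 1\le j\le n,\ 1\le i\le 2j-1\}$ (row $i$ from the top, column $j$ from the left). For $D\in\mathcal{SPD}_n$ let $\Omega(D)\subseteq\widetilde{SY}_n$ be given by: $(2k-1,j)\in\Omega(D)$ iff $(k,j)\in D$ (for $k\le j\le n$), and $(2k,j)\in\Omega(D)$ iff $(k,2n+1-j)\in D$ (for $k+1\le j\le n$). Let $\widetilde{SY}_n^{\rm (ex)}=\widetilde{SY}_n\sqcup\{(2k,k)\mid 1\le k\le n\}\sqcup\{(k,n+1)\mid 1\le k\le 2n\}$. The diagram $\mathscr{G}(D)$ is obtained by filling each box $(i,j)$ of $\widetilde{SY}_n^{\rm (ex)}$ with a tile: a crossing (joining left edge to right edge and top edge to bottom edge) if $(i,j)\in\Omega(D)$; if $(i,j)\notin\Omega(D)$, an elbow joint (joining left to top and right to bottom) when $j\le n$ with $i$ odd or $j=n+1$ with $i$ even, and a reversed elbow joint (joining left to bottom and top to right) when $j\le n$ with $i$ even or $j=n+1$ with $i$ odd. Pipes are the resulting curves. For $1\le k\le n$, $\ell_k$ is the pipe with an end at the left end of row $2k-1$ of $\widetilde{SY}_n^{\rm (ex)}$. There is a unique permutation $v_D$ of $[n]$ such that the other end of $\ell_k$ is at the top of column $n+1-v_D(k)$; write $L_{v_D(k)}=\ell_k$. Let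 ${\rm sign}(L_j)$ be the number of self-crossings of $L_j$ (crossing tiles both of whose strands belong to $L_j$). Define $w_D\in W$ by $w_D(j)=(-1)^{{\rm sign}(L_j)+1}v_D^{-1}(j)$ and $w_D(-j)=-w_D(j)$ for $j\in[n]$. $D$ is called reduced if $|D|=\ell(w_0)-\ell(w_D)$.
   Formalization: The pipe ℓ_k is taken to start at the left end of row 2(n+1−k)−1 instead of row 2k−1; with the literal numbering D = SY_n has w_D(j) = n+1−j, not e, although M(e) = {SY_n}, so the claim would fail. *)

theory Defs
  imports "HOL-Combinatorics.Permutations"
begin

section \<open>Signed permutations\<close>

definition signed_index :: "nat \<Rightarrow> int set" where
  "signed_index n = {- int n..int n} - {0}"

text \<open>Elements of the Weyl group are functions on all of \<open>int\<close> that fix every integer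
  outside \<open>signed_index n\<close> (this is part of \<open>permutes\<close>).\<close>

definition weyl_group :: "nat \<Rightarrow> (int \<Rightarrow> int) set" where
  "weyl_group n =
     {\<sigma>. \<sigma> permutes signed_index n \<and> (\<forall>i\<in>signed_index n. \<sigma> (- i) = - \<sigma> i)}"

definition simple_refl :: "nat \<Rightarrow> int \<Rightarrow> int" where
  "simple_refl k =
     (if k = 1 then transpose 1 (- 1)
      else transpose (int k - 1) (int k) \<circ> transpose (- (int k - 1)) (- int k))"

definition word_prod :: "nat list \<Rightarrow> int \<Rightarrow> int" where
  "word_prod is = foldr (\<circ>) (map simple_refl is) id"

definition weyl_length :: "nat \<Rightarrow> (int \<Rightarrow> int) \<Rightarrow> nat" where
  "weyl_length n w =
     (LEAST r. \<exists>is. set is \<subseteq> {1..n} \<and> length is = r \<and> word_prod is = w)"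

definition reduced_words :: "nat \<Rightarrow> (int \<Rightarrow> int) \<Rightarrow> nat list set" where
  "reduced_words n w =
     {is. set is \<subseteq> {1..n} \<and> length is = weyl_length n w \<and> word_prod is = w}"

definition longest_elt :: "nat \<Rightarrow> int \<Rightarrow> int" where
  "longest_elt n = (\<lambda>i. if i \<in> signed_index n then - i else i)"


section \<open>Skew pipe dreams\<close>

definition SY :: "nat \<Rightarrow> (nat \<times> nat) set" where
  "SY n = {(i, j). 1 \<le> i \<and> i \<le> n \<and> i \<le> j \<and> j \<le> 2 * n - i}"

definition SPD :: "nat \<Rightarrow> (nat \<times> nat) set set" where
  "SPD n = Pow (SY n)"

definition box_list :: "nat \<Rightarrow> (nat \<times> nat) list" where
  "box_list n = concat (map (\<lambda>i. map (\<lambda>j. (i, j)) (rev [i..<2 * n - i + 1])) (rev [1..<n + 1]))"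

text \<open>\<open>(box_row n k, box_col n k)\<close> is the box \<open>(p\<^sub>k, q\<^sub>k)\<close>, for \<open>1 \<le> k \<le> n\<^sup>2\<close>.\<close>

definition box_row :: "nat \<Rightarrow> nat \<Rightarrow> nat" where
  "box_row n k = fst (box_list n ! (k - 1))"

definition box_col :: "nat \<Rightarrow> nat \<Rightarrow> nat" where
  "box_col n k = snd (box_list n ! (k - 1))"

definition word_C :: "nat \<Rightarrow> nat list" where
  "word_C n = concat (map (\<lambda>k. rev [1..<k + 1] @ [2..<k + 1]) [1..<n + 1])"

text \<open>The letter \<open>i\<^sub>k\<close> of the word above, for \<open>1 \<le> k \<le> n\<^sup>2\<close>.\<close>

definition letter_C :: "nat \<Rightarrow> nat \<Rightarrow> nat" where
  "letter_C n k = word_C n ! (k - 1)"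

definition reduced_subseqs :: "nat \<Rightarrow> (int \<Rightarrow> int) \<Rightarrow> nat list set" where
  "reduced_subseqs n w =
     {ks. set ks \<subseteq> {1..n\<^sup>2} \<and> sorted_wrt (<) ks \<and> map (letter_C n) ks \<in> reduced_words n w}"

definition min_subseq :: "nat \<Rightarrow> (int \<Rightarrow> int) \<Rightarrow> nat list" where
  "min_subseq n w =
     (THE ks. ks \<in> reduced_subseqs n w \<and>
        (\<forall>ks'\<in>reduced_subseqs n w. ks' \<noteq> ks \<longrightarrow> (ks, ks') \<in> lex less_than))"


section \<open>Ladder moves and the operators \<open>M\<^sub>i\<close>\<close>

text \<open>\<open>ladder_move n i j D D'\<close>: the partial map \<open>L\<^sub>i\<^sub>,\<^sub>j\<close> is defined at \<open>D\<close> and takes the value \<open>D'\<close>.\<close>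

definition ladder_move :: "nat \<Rightarrow> nat \<Rightarrow> nat \<Rightarrow> (nat \<times> nat) set \<Rightarrow> (nat \<times> nat) set \<Rightarrow> bool" where
  "ladder_move n i j D D' \<longleftrightarrow>
     (i, j) \<in> D \<and> (i, j + 1) \<notin> D \<and>
     (\<exists>k l. 1 \<le> k \<and> k + 1 \<le> l \<and> l \<le> n\<^sup>2 \<and>
        box_row n k = i \<and> box_col n k = j \<and>
        box_col n l \<in> {j, 2 * n - j} \<and>
        {(box_row n l, box_col n l), (box_row n l, box_col n l + 1)} \<subseteq> SY n - D \<and>
        (\<forall>r. k + 1 \<le> r \<and> r \<le> l - 1 \<and> box_col n r \<in> {j, 2 * n - j} \<longrightarrow>
           {(box_row n r, box_col n r), (box_row n r, box_col n r + 1)} \<subseteq> D) \<and>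
        D' = (D \<union> {(box_row n l, box_col n l + 1)}) - {(i, j)})"

definition mitosis_cols :: "nat \<Rightarrow> nat \<Rightarrow> nat set" where
  "mitosis_cols n i = {n - i + 1, n + i - 1}"

definition mitosis_index :: "nat \<Rightarrow> nat \<Rightarrow> (nat \<times> nat) set \<Rightarrow> nat" where
  "mitosis_index n i D =
     Max {r \<in> {1..n\<^sup>2}. box_col n r \<in> mitosis_cols n i \<and> (box_row n r, box_col n r + 1) \<notin> D}"

definition mitosis :: "nat \<Rightarrow> nat \<Rightarrow> (nat \<times> nat) set \<Rightarrow> (nat \<times> nat) set set" where
  "mitosis n i D =
     (let r0 = mitosis_index n i D in
      if {(box_row n r, box_col n r) | r.
            box_col n r \<in> mitosis_cols n i \<and> r0 \<le> r \<and> r \<le> n\<^sup>2} \<subseteq> D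
      then {D'. (\<lambda>E E'. \<exists>p q. q \<in> mitosis_cols n i \<and> ladder_move n p q E E')\<^sup>*\<^sup>*
                  (D - {(box_row n r0, box_col n r0)}) D'}
      else {})"

definition mitosis_set ::
    "nat \<Rightarrow> nat \<Rightarrow> (nat \<times> nat) set set \<Rightarrow> (nat \<times> nat) set set" where
  "mitosis_set n i A = (\<Union>D\<in>A. mitosis n i D)"

text \<open>\<open>fold\<close> applies the operator of the first letter first, i.e. innermost.\<close>

definition iterated_mitosis :: "nat \<Rightarrow> (int \<Rightarrow> int) \<Rightarrow> (nat \<times> nat) set set" where
  "iterated_mitosis n w = fold (mitosis_set n) (map (letter_C n) (min_subseq n w)) {SY n}"


section \<open>The path model\<close>

definition SYt :: "nat \<Rightarrow> (nat \<times> nat) set" where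
  "SYt n = {(i, j). 1 \<le> j \<and> j \<le> n \<and> 1 \<le> i \<and> i \<le> 2 * j - 1}"

definition SYt_ex :: "nat \<Rightarrow> (nat \<times> nat) set" where
  "SYt_ex n = SYt n \<union> {(2 * k, k) | k. 1 \<le> k \<and> k \<le> n} \<union> {(k, n + 1) | k. 1 \<le> k \<and> k \<le> 2 * n}"

definition Omega :: "nat \<Rightarrow> (nat \<times> nat) set \<Rightarrow> (nat \<times> nat) set" where
  "Omega n D =
     {(2 * k - 1, j) | k j. 1 \<le> k \<and> k \<le> j \<and> j \<le> n \<and> (k, j) \<in> D} \<union>
     {(2 * k, j) | k j. 1 \<le> k \<and> k + 1 \<le> j \<and> j \<le> n \<and> (k, 2 * n + 1 - j) \<in> D}"

datatype side = LeftSide | RightSide | TopSide | BottomSide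

text \<open>Unit edges of the grid: \<open>HEdge i j\<close> is the top edge of box \<open>(i, j)\<close> and \<open>VEdge i j\<close> is its
  left edge, so that adjacent boxes share an edge.\<close>

datatype grid_edge = HEdge nat nat | VEdge nat nat

fun edge_of :: "nat \<times> nat \<Rightarrow> side \<Rightarrow> grid_edge" where
  "edge_of (i, j) LeftSide = VEdge i j"
| "edge_of (i, j) RightSide = VEdge i (j + 1)"
| "edge_of (i, j) TopSide = HEdge i j"
| "edge_of (i, j) BottomSide = HEdge (i + 1) j"

text \<open>A tile is given by its two strands, each an unordered pair of sides: in this order a
  crossing, an elbow joint and a reversed elbow joint.\<close>

fun tile :: "nat \<Rightarrow> (nat \<times> nat) set \<Rightarrow> nat \<times> nat \<Rightarrow> side set set" where
  "tile n D (i, j) =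
     (if (i, j) \<in> Omega n D then {{LeftSide, RightSide}, {TopSide, BottomSide}}
      else if j \<le> n \<and> odd i \<or> j = n + 1 \<and> even i
        then {{LeftSide, TopSide}, {RightSide, BottomSide}}
      else {{LeftSide, BottomSide}, {TopSide, RightSide}})"

definition joined :: "nat \<Rightarrow> (nat \<times> nat) set \<Rightarrow> grid_edge \<Rightarrow> grid_edge \<Rightarrow> bool" where
  "joined n D x y \<longleftrightarrow>
     (\<exists>b\<in>SYt_ex n. \<exists>s t. {s, t} \<in> tile n D b \<and> x = edge_of b s \<and> y = edge_of b t)"

text \<open>A pipe is represented by the set of edges it passes through.

  The leftmost box of row \<open>2 * m - 1\<close> is \<open>(2 * m - 1, m)\<close>. The pipe \<open>\<ell>\<^sub>k\<close> starts at the left end of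
  the \<open>k\<close>-th odd row counted \<^emph>\<open>from the bottom\<close> (\<open>m = n + 1 - k\<close>), which fits the numbering
  of the columns \<open>n + 1 - v\<^sub>D k\<close> from the right in \<open>pipe_perm\<close>. Counting the odd rows from the top
  here would make \<open>w\<^sub>D\<close> for \<open>D = SY n\<close> the order-reversing permutation of \<open>{1..n}\<close> instead of
  the identity.\<close>

definition pipe :: "nat \<Rightarrow> (nat \<times> nat) set \<Rightarrow> nat \<Rightarrow> grid_edge set" where
  "pipe n D k =
     {x. (joined n D)\<^sup>*\<^sup>* (edge_of (2 * (n + 1 - k) - 1, n + 1 - k) LeftSide) x}"

definition pipe_perm :: "nat \<Rightarrow> (nat \<times> nat) set \<Rightarrow> nat \<Rightarrow> nat" where
  "pipe_perm n D =
     (THE v. v permutes {1..n} \<and>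
        (\<forall>k\<in>{1..n}. edge_of (1, n + 1 - v k) TopSide \<in> pipe n D k))"

text \<open>The pipe \<open>L\<^sub>j\<close>, determined by \<open>L\<^sub>j = \<ell>\<^sub>k\<close> for \<open>j = v\<^sub>D k\<close>.\<close>

definition end_pipe :: "nat \<Rightarrow> (nat \<times> nat) set \<Rightarrow> nat \<Rightarrow> grid_edge set" where
  "end_pipe n D j = pipe n D (inv (pipe_perm n D) j)"

text \<open>Both strands of a crossing belong to a pipe iff all four sides of its box do.\<close>

definition pipe_sign :: "nat \<Rightarrow> (nat \<times> nat) set \<Rightarrow> nat \<Rightarrow> nat" where
  "pipe_sign n D j = card {b \<in> Omega n D. \<forall>s. edge_of b s \<in> end_pipe n D j}"

definition pd_elt :: "nat \<Rightarrow> (nat \<times> nat) set \<Rightarrow> int \<Rightarrow> int" where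
  "pd_elt n D =
     (\<lambda>i. if i \<in> signed_index n
          then sgn i * ((- 1) ^ (pipe_sign n D (nat \<bar>i\<bar>) + 1) * int (inv (pipe_perm n D) (nat \<bar>i\<bar>)))
          else i)"

definition reduced_pd :: "nat \<Rightarrow> (nat \<times> nat) set \<Rightarrow> bool" where
  "reduced_pd n D \<longleftrightarrow>
     int (card D) = int (weyl_length n (longest_elt n)) - int (weyl_length n (pd_elt n D))"

end

theory Submission
  imports Defs
begin

text \<open>The key fact is that \<open>M\<^sub>i\<close> maps the reduced dreams of \<open>w\<close> onto those of \<open>w s\<^sub>i\<close> whenever
  \<open>\<ell>(w s\<^sub>i) = \<ell>(w) + 1\<close>; the theorem follows along any reduced word of \<open>w\<close>.

  In the path model, \<open>M\<^sub>i\<close> only touches a strip of two adjacent columns (of the last column alone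
  for \<open>i = 1\<close>) whose rows have two boxes each. Suppose that the lower of two rows loses the crossing
  in its first box (in the direction of flow), that its second box is an elbow, and that all rows in
  between consist of crossings. Then the two vertical strands above the lower row are exchanged. If
  the second box of the upper row, whose first box is an elbow, is changed as well, then the
  strands are exchanged back and \<open>w\<^sub>D\<close> does not change; if there is no upper row, then the strands reach
  the top exchanged and \<open>w\<^sub>D\<close> is multiplied by \<open>s\<^sub>i\<close> on the right. This one switch accounts for
  ladder moves, for the box removed by \<open>M\<^sub>i\<close>, and for the removal of a double crossing.

  By switches every dream descends to the empty one, whose element is \<open>w\<^sub>0\<close>, which shows
  \<open>\<ell>(w\<^sub>D) + |D| \<ge> \<ell>(w\<^sub>0)\<close>. For the surjectivity of \<open>M\<^sub>i\<close>, undo ladder moves as long as possible;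
  the inequality then forbids all patterns at the top of the strip except the one that arises from
  the removal of a box.\<close>

section \<open>Strands and pipes\<close>

text \<open>No pipe is followed from end to end across a switch. Instead, a map of edges sends every
  strand of one diagram to a path of the other, so only the tiles near the two toggled boxes have to
  be inspected; as the hypotheses on a switch are symmetric in the two dreams, every implication can
  be reversed. The signs are the delicate part, since they count self-crossings of whole pipes. They
  survive because the two toggled boxes, when they are crossings, are self-crossings of exactly the
  same pipes, so that parities agree. The last column is different: its two boxes per row lie in
  consecutive rows of the diagram and are linked by a turn in column n + 1. Toggling one of them
  attaches a self-crossing loop to a single pipe or detaches it, instead of exchanging two pipes;
  this is where the sign change of s_1 comes from. The definition of w_D contains a definite
  description of v_D. The arguments therefore run on a relation between dreams and signed
  permutations, and the existence of w_D falls out of the descent to the empty dream.\<close>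

definition strands :: "nat \<Rightarrow> (nat \<times> nat) set \<Rightarrow> nat \<Rightarrow> nat \<Rightarrow> (grid_edge \<times> grid_edge) set" where
  "strands n D r c =
     (if (r, c) \<in> Omega n D then {(VEdge r c, VEdge r (c + 1)), (HEdge r c, HEdge (r + 1) c)}
      else if c \<le> n \<and> odd r \<or> c = n + 1 \<and> even r
        then {(VEdge r c, HEdge r c), (VEdge r (c + 1), HEdge (r + 1) c)}
      else {(VEdge r c, HEdge (r + 1) c), (HEdge r c, VEdge r (c + 1))})"

abbreviation reach :: "nat \<Rightarrow> (nat \<times> nat) set \<Rightarrow> grid_edge \<Rightarrow> grid_edge \<Rightarrow> bool" where
  "reach n D \<equiv> (joined n D)\<^sup>*\<^sup>*"

text \<open>\<open>strands\<close> lists each tile as two ordered pairs of edges, one orientation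
  per strand, in place of the sets of sides in \<open>tile\<close>. \<open>joined\<close> is the
  symmetric closure, so a property of pipes needs only two checks per tile.\<close>

lemma joined_iff:
  "joined n D x y \<longleftrightarrow>
     (\<exists>r c. (r, c) \<in> SYt_ex n \<and> ((x, y) \<in> strands n D r c \<or> (y, x) \<in> strands n D r c))"
  (is "?L \<longleftrightarrow> ?R")
proof -
  have *: "(\<exists>s t. {s, t} \<in> {{a, b}, {c, d}} \<and> P s t) \<longleftrightarrow> P a b \<or> P b a \<or> P c d \<or> P d c"
    for a b c d :: side and P
  proof -
    have "{s, t} \<in> {{a, b}, {c, d}} \<longleftrightarrow>
        s = a \<and> t = b \<or> s = b \<and> t = a \<or> s = c \<and> t = d \<or> s = d \<and> t = c" for s t
      by (simp only: insert_iff empty_iff doubleton_eq_iff) argo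
    then show ?thesis by metis
  qed
  have "(\<exists>s t. {s, t} \<in> tile n D (r, c) \<and> x = edge_of (r, c) s \<and> y = edge_of (r, c) t) \<longleftrightarrow>
    ((x, y) \<in> strands n D r c \<or> (y, x) \<in> strands n D r c)" for r c
    unfolding strands_def tile.simps if_distrib[of "\<lambda>S. {s, t} \<in> S" for s t]
    by (cases "(r, c) \<in> Omega n D"; cases "c \<le> n \<and> odd r \<or> c = n + 1 \<and> even r";
        simp only: if_True if_False *; auto)
  then show ?thesis
    unfolding joined_def by (auto simp: Bex_def)
qed

lemma joined_sym: "joined n D x y \<Longrightarrow> joined n D y x"
  unfolding joined_iff by blast

lemma reach_sym: "reach n D x y \<Longrightarrow> reach n D y x"
proof (induction rule: rtranclp_induct)
  case (step y z)
  then show ?case by (meson joined_sym converse_rtranclp_into_rtranclp)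
qed simp

lemma reach_strand: "(r, c) \<in> SYt_ex n \<Longrightarrow> (x, y) \<in> strands n D r c \<Longrightarrow> reach n D x y"
  using joined_iff by blast

text \<open>Labels that are constant along strands tell pipes apart. This is how unwanted
  connections are excluded in the empty and in the full dream.\<close>

lemma reach_invariant:
  assumes "reach n D x y"
    and "\<And>r c u v. (r, c) \<in> SYt_ex n \<Longrightarrow> (u, v) \<in> strands n D r c \<Longrightarrow> f u = f v"
  shows "f x = f y"
  using assms(1) by (induction) (auto simp: joined_iff dest: assms(2))

text \<open>The device behind both kinds of switch: the image of a strand need not be a strand, a
  path with the corresponding ends is enough.\<close>

lemma reach_hom:
  assumes "reach n D x y"
    and "\<And>r c u v. (r, c) \<in> SYt_ex n \<Longrightarrow> (u, v) \<in> strands n D r c \<Longrightarrow> reach n E (\<psi> u) (\<psi> v)"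
  shows "reach n E (\<psi> x) (\<psi> y)"
  using assms(1)
proof induction
  case (step y z)
  then have "reach n E (\<psi> y) (\<psi> z)"
    using assms(2) reach_sym by (metis joined_iff)
  with step.IH show ?case by simp
qed simp

lemma reach_cross:
  assumes "(r, c) \<in> Omega n D" "(r, c) \<in> SYt_ex n"
  shows "reach n D (VEdge r c) (VEdge r (Suc c))" "reach n D (HEdge r c) (HEdge (Suc r) c)"
  using assms by (auto intro!: reach_strand simp: strands_def)

lemma reach_elbow:
  assumes "(r, c) \<notin> Omega n D" "(r, c) \<in> SYt_ex n" "c \<le> n \<and> odd r \<or> c = n + 1 \<and> even r"
  shows "reach n D (VEdge r c) (HEdge r c)" "reach n D (VEdge r (Suc c)) (HEdge (Suc r) c)"
  using assms by (auto intro!: reach_strand[of r c] simp: strands_def)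

lemma reach_rev_elbow:
  assumes "(r, c) \<notin> Omega n D" "(r, c) \<in> SYt_ex n" "\<not> (c \<le> n \<and> odd r \<or> c = n + 1 \<and> even r)"
  shows "reach n D (VEdge r c) (HEdge (Suc r) c)" "reach n D (HEdge r c) (VEdge r (Suc c))"
  using assms by (auto intro!: reach_strand[of r c] simp: strands_def)

definition pipe_start :: "nat \<Rightarrow> nat \<Rightarrow> grid_edge" where
  "pipe_start n k = VEdge (2 * (n + 1 - k) - 1) (n + 1 - k)"

lemma pipe_iff: "x \<in> pipe n D k \<longleftrightarrow> reach n D (pipe_start n k) x"
  unfolding pipe_def pipe_start_def by simp

lemma pipe_cong: "reach n D x y \<Longrightarrow> x \<in> pipe n D k \<longleftrightarrow> y \<in> pipe n D k"
  unfolding pipe_iff by (meson reach_sym rtranclp_trans)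

text \<open>The crossings counted by \<open>pipe_sign\<close>, but indexed by the start of the pipe,
  so that no inverse of \<open>pipe_perm\<close> intervenes.\<close>

definition self_crossings :: "nat \<Rightarrow> (nat \<times> nat) set \<Rightarrow> nat \<Rightarrow> (nat \<times> nat) set" where
  "self_crossings n D k = {b \<in> Omega n D. \<forall>s. edge_of b s \<in> pipe n D k}"

text \<open>Row 2k - 1 of the diagram is the left part of row k of the dream, and row 2k is its
  right part read backwards.\<close>

lemma Omega_iff:
  "(r, c) \<in> Omega n D \<longleftrightarrow> r \<ge> 1 \<and>
     (if odd r then (r + 1) div 2 \<le> c \<and> c \<le> n \<and> ((r + 1) div 2, c) \<in> D
      else r div 2 + 1 \<le> c \<and> c \<le> n \<and> (r div 2, 2 * n + 1 - c) \<in> D)"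
proof (cases "odd r")
  case True
  then obtain k where "r = 2 * k + 1" by (elim oddE)
  moreover have "2 * k + 1 = 2 * l - Suc 0 \<longleftrightarrow> l = Suc k" for l
    by auto
  moreover have "2 * k + 1 \<noteq> 2 * l" for l
    by presburger
  ultimately show ?thesis
    unfolding Omega_def by auto
next
  case False
  then obtain k where "r = 2 * k" by blast
  moreover have "2 * k \<noteq> 2 * l - Suc 0" if "1 \<le> l" for l
    using that by presburger
  ultimately show ?thesis
    unfolding Omega_def by (auto simp: Suc_le_eq)
qed

lemma Omega_subset_SYt: "Omega n D \<subseteq> SYt n"
  unfolding SYt_def by (auto simp: Omega_iff split: if_splits)

lemma SYt_subset_ex: "SYt n \<subseteq> SYt_ex n"
  unfolding SYt_ex_def by auto

lemma Omega_in_ex: "b \<in> Omega n D \<Longrightarrow> b \<in> SYt_ex n"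
  using Omega_subset_SYt SYt_subset_ex by blast

lemma finite_Omega: "finite (Omega n D)"
proof (rule finite_subset[OF Omega_subset_SYt])
  have "SYt n \<subseteq> {..2 * n} \<times> {..n}" by (auto simp: SYt_def)
  then show "finite (SYt n)" by (rule finite_subset) simp
qed

text \<open>A crossing joins opposite sides, so the left and the top edge decide for all
  four.\<close>

lemma self_crossings_iff:
  "(r, c) \<in> self_crossings n D k \<longleftrightarrow>
     (r, c) \<in> Omega n D \<and> VEdge r c \<in> pipe n D k \<and> HEdge r c \<in> pipe n D k"
proof -
  have "(\<forall>s. edge_of (r, c) s \<in> pipe n D k) \<longleftrightarrow> VEdge r c \<in> pipe n D k \<and> HEdge r c \<in> pipe n D k"
    if b: "(r, c) \<in> Omega n D"
  proof -
    have *: "(\<forall>s. P s) \<longleftrightarrow> P LeftSide \<and> P RightSide \<and> P TopSide \<and> P BottomSide" for P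
      by (metis side.exhaust)
    show ?thesis
      using pipe_cong[OF reach_cross(1)[OF b Omega_in_ex[OF b]], of k]
        pipe_cong[OF reach_cross(2)[OF b Omega_in_ex[OF b]], of k]
      by (auto simp: * )
  qed
  then show ?thesis unfolding self_crossings_def by auto
qed

section \<open>Signed permutations and their length\<close>

lemma mem_signed_index: "i \<in> signed_index n \<longleftrightarrow> i \<noteq> 0 \<and> \<bar>i\<bar> \<le> int n"
  unfolding signed_index_def by auto

lemma weylI:
  "bij w \<Longrightarrow> (\<And>i. i \<notin> signed_index n \<Longrightarrow> w i = i) \<Longrightarrow>
    (\<And>i. i \<in> signed_index n \<Longrightarrow> w (- i) = - w i) \<Longrightarrow> w \<in> weyl_group n"
  unfolding weyl_group_def permutes_def by (simp add: bij_iff)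

lemma weyl_bij: "w \<in> weyl_group n \<Longrightarrow> bij w"
  unfolding weyl_group_def using permutes_bij by blast

lemma weyl_fixed: "w \<in> weyl_group n \<Longrightarrow> i \<notin> signed_index n \<Longrightarrow> w i = i"
  unfolding weyl_group_def permutes_def by blast

lemma weyl_minus: "w \<in> weyl_group n \<Longrightarrow> w (- i) = - w i"
proof (cases "i \<in> signed_index n")
  case False
  then have "- i \<notin> signed_index n" by (simp add: mem_signed_index)
  moreover assume "w \<in> weyl_group n"
  ultimately show ?thesis using False weyl_fixed by metis
qed (simp add: weyl_group_def)

lemma weyl_in: "w \<in> weyl_group n \<Longrightarrow> w i \<in> signed_index n \<longleftrightarrow> i \<in> signed_index n"
  by (simp add: weyl_group_def permutes_in_image)

lemma weyl_inj: "w \<in> weyl_group n \<Longrightarrow> w i = w j \<longleftrightarrow> i = j"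
  using weyl_bij[of w n] bij_is_inj inj_eq by metis

lemma weyl_abs_inj: "w \<in> weyl_group n \<Longrightarrow> \<bar>w i\<bar> = \<bar>w j\<bar> \<longleftrightarrow> \<bar>i\<bar> = \<bar>j\<bar>"
  using weyl_inj[of w n i j] weyl_inj[of w n i "- j"] weyl_minus[of w n j]
  by (simp add: abs_eq_iff)

lemma weyl_surj: "w \<in> weyl_group n \<Longrightarrow> \<exists>i. w i = j"
  using weyl_bij[of w n] by (metis bij_pointE)

lemma weyl_comp: "v \<in> weyl_group n \<Longrightarrow> w \<in> weyl_group n \<Longrightarrow> v \<circ> w \<in> weyl_group n"
  by (rule weylI) (auto simp: weyl_minus weyl_fixed weyl_bij bij_comp)

lemma weyl_id: "id \<in> weyl_group n"
  by (rule weylI) auto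

lemma weyl_longest: "longest_elt n \<in> weyl_group n"
proof (rule weylI)
  show "bij (longest_elt n)"
    by (rule o_bij[of "longest_elt n"]) (auto simp: longest_elt_def mem_signed_index fun_eq_iff)
qed (auto simp: longest_elt_def mem_signed_index)

lemma simple_refl_1: "simple_refl 1 x = (if \<bar>x\<bar> = 1 then - x else x)"
  by (auto simp: simple_refl_def transpose_def)

lemma simple_refl_ge_2:
  "2 \<le> k \<Longrightarrow> simple_refl k x =
    (if \<bar>x\<bar> = int k then sgn x * (int k - 1) else if \<bar>x\<bar> = int k - 1 then sgn x * int k else x)"
  by (auto simp: simple_refl_def transpose_def abs_if sgn_if)

lemma simple_refl_cases:
  assumes "1 \<le> k"
  obtains "k = 1" "simple_refl k = (\<lambda>x. if \<bar>x\<bar> = 1 then - x else x)"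
  | "2 \<le> k" "simple_refl k = (\<lambda>x. if \<bar>x\<bar> = int k then sgn x * (int k - 1)
        else if \<bar>x\<bar> = int k - 1 then sgn x * int k else x)"
  using assms simple_refl_1 simple_refl_ge_2[of k] by (cases "k = 1") (auto simp: fun_eq_iff)

lemma simple_refl_involution: "1 \<le> k \<Longrightarrow> simple_refl k (simple_refl k x) = x"
  by (erule simple_refl_cases) (auto simp: abs_mult sgn_mult abs_if sgn_if split: if_splits)

lemma weyl_simple_refl:
  assumes "k \<in> {1..n}"
  shows "simple_refl k \<in> weyl_group n"
proof (rule weylI)
  have k: "1 \<le> k" using assms by simp
  show "bij (simple_refl k)"
    by (rule o_bij[of "simple_refl k"]) (use k in \<open>auto simp: fun_eq_iff simple_refl_involution\<close>)
  show "simple_refl k i = i" if "i \<notin> signed_index n" for i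
    using k by (rule simple_refl_cases) (use that assms in \<open>auto simp: mem_signed_index\<close>)
  show "simple_refl k (- i) = - simple_refl k i" for i
    using k by (rule simple_refl_cases) (auto simp: sgn_if)
qed

lemma word_prod_snoc: "word_prod (is @ [i]) = word_prod is \<circ> simple_refl i"
proof -
  have "foldr (\<circ>) fs f = foldr (\<circ>) fs id \<circ> f" for fs :: "(int \<Rightarrow> int) list" and f
    by (induction fs) (auto simp: comp_assoc)
  from this[of "map simple_refl is" "simple_refl i"] show ?thesis
    by (simp add: word_prod_def)
qed

lemma word_prod_Nil: "word_prod [] = id"
  by (simp add: word_prod_def)

lemma weyl_word_prod: "set is \<subseteq> {1..n} \<Longrightarrow> word_prod is \<in> weyl_group n"
proof (induction "is" rule: rev_induct)
  case (snoc i "is")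
  then show ?case unfolding word_prod_snoc by (intro weyl_comp weyl_simple_refl) auto
qed (use weyl_id word_prod_Nil in metis)

section \<open>Length as a count of signed inversions\<close>

definition signed_inversions :: "nat \<Rightarrow> (int \<Rightarrow> int) \<Rightarrow> (int \<times> int) set" where
  "signed_inversions n w =
     {(i, j). i \<in> signed_index n \<and> j \<in> signed_index n \<and> i < j \<and> w j < w i}"

definition negatives :: "nat \<Rightarrow> (int \<Rightarrow> int) \<Rightarrow> int set" where
  "negatives n w = {i \<in> {1..int n}. w i < 0}"

text \<open>Every inversion \<open>i < j\<close> with \<open>i \<noteq> - j\<close> occurs a second time as \<open>- j < - i\<close>. Adding the
  negative values, i.e. counting the pairs \<open>- i < i\<close> twice as well, gives twice the length.\<close>

definition double_length :: "nat \<Rightarrow> (int \<Rightarrow> int) \<Rightarrow> nat" where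
  "double_length n w = card (signed_inversions n w) + card (negatives n w)"

lemma finite_signed_index: "finite (signed_index n)"
  unfolding signed_index_def by simp

lemma finite_signed_inversions: "finite (signed_inversions n w)"
  by (rule finite_subset[of _ "signed_index n \<times> signed_index n"])
    (auto simp: signed_inversions_def finite_signed_index)

text \<open>\<open>S\<close> consists of the pairs whose order \<open>simple_refl k\<close>
  reverses. Away from \<open>S\<close>, applying the reflection to both entries preserves order and
  matches the inversions of the product with those of \<open>w\<close>; the pairs in
  \<open>S\<close> are new inversions because \<open>w\<close> is increasing on them.\<close>

lemma card_signed_inversions_simple_refl:
  assumes k: "k \<in> {1..n}"
    and S: "\<And>i j. i \<in> signed_index n \<Longrightarrow> j \<in> signed_index n \<Longrightarrow> i < j \<Longrightarrow> (i, j) \<notin> S \<Longrightarrow>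
      simple_refl k i < simple_refl k j"
    and desc: "\<And>i j. (i, j) \<in> S \<Longrightarrow> i \<in> signed_index n \<and> j \<in> signed_index n \<and> i < j \<and>
      simple_refl k i = j \<and> w i < w j"
  shows "card (signed_inversions n (w \<circ> simple_refl k)) = card (signed_inversions n w) + card S"
proof -
  let ?s = "simple_refl k"
  let ?A = "signed_inversions n w" and ?B = "signed_inversions n (w \<circ> ?s)"
  have inv: "?s (?s x) = x" for x using k by (simp add: simple_refl_involution)
  have s_in: "?s x \<in> signed_index n \<longleftrightarrow> x \<in> signed_index n" for x
    using k weyl_in weyl_simple_refl by blast
  have desc': "?s j = i" if "(i, j) \<in> S" for i j using desc[OF that] inv by metis
  have AS: "?A \<inter> S = {}" using desc by (fastforce simp: signed_inversions_def)
  have BS: "S \<subseteq> ?B" using desc desc' by (fastforce simp: signed_inversions_def)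
  have notS: "(?s i, ?s j) \<notin> S" if "i < j" for i j
    using desc[of "?s i" "?s j"] desc'[of "?s i" "?s j"] that inv by (metis less_asym)
  have "bij_betw (\<lambda>(i, j). (?s i, ?s j)) (?B - S) ?A"
  proof (rule bij_betw_byWitness[where f' = "\<lambda>(i, j). (?s i, ?s j)"])
    show "(\<lambda>(i, j). (?s i, ?s j)) ` (?B - S) \<subseteq> ?A"
      using S by (auto simp: signed_inversions_def s_in)
    show "(\<lambda>(i, j). (?s i, ?s j)) ` ?A \<subseteq> ?B - S"
      using S AS notS by (fastforce simp: signed_inversions_def s_in inv)
  qed (auto simp: inv)
  then have "card (?B - S) = card ?A" by (rule bij_betw_same_card)
  moreover have "card ?B = card (?B - S) + card S"
    using BS finite_signed_inversions card_Diff_subset[of S ?B] card_mono[of ?B S]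
    by (simp add: finite_subset)
  ultimately show ?thesis by simp
qed

text \<open>For k = 1 the pair (-1, 1) becomes an inversion and 1 becomes a member of
  \<open>negatives\<close>. For k \<ge> 2 the pair (k - 1, k) and its mirror image (-k, 1 - k)
  become inversions, while the number of negatives stays because the reflection permutes the
  positive positions.\<close>

lemma double_length_ascent:
  assumes w: "w \<in> weyl_group n" and k: "k \<in> {1..n}"
    and asc: "if k = 1 then w 1 > 0 else w (int k - 1) < w (int k)"
  shows "double_length n (w \<circ> simple_refl k) = double_length n w + 2"
proof (cases "k = 1")
  case True
  have "card (signed_inversions n (w \<circ> simple_refl k)) = card (signed_inversions n w) + card {(- 1 :: int, 1 :: int)}"
  proof (rule card_signed_inversions_simple_refl[OF k])
    show "simple_refl k i < simple_refl k j"
      if "i \<in> signed_index n" "j \<in> signed_index n" "i < j" "(i, j) \<notin> {(- 1, 1)}" for i j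
      using that unfolding True simple_refl_1 by (auto simp: mem_signed_index)
    show "i \<in> signed_index n \<and> j \<in> signed_index n \<and> i < j \<and> simple_refl k i = j \<and> w i < w j"
      if "(i, j) \<in> {(- 1, 1)}" for i j
      using that asc True k weyl_minus[OF w, of 1] simple_refl_1 by (auto simp: mem_signed_index)
  qed
  moreover have "negatives n (w \<circ> simple_refl k) = insert 1 (negatives n w)"
    using asc True k weyl_minus[OF w, of 1] simple_refl_1 by (auto simp: negatives_def)
  moreover have "1 \<notin> negatives n w" using asc True by (simp add: negatives_def)
  moreover have "finite (negatives n w)"
    by (rule finite_subset[of _ "{1..int n}"]) (auto simp: negatives_def)
  ultimately show ?thesis by (simp add: double_length_def)
next
  case False
  then have k2: "2 \<le> k" using k by auto
  define S where "S = {(int k - 1, int k), (- int k, 1 - int k)}"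
  note s = simple_refl_ge_2[OF k2]
  have "card (signed_inversions n (w \<circ> simple_refl k)) = card (signed_inversions n w) + card S"
  proof (rule card_signed_inversions_simple_refl[OF k])
    show "simple_refl k i < simple_refl k j"
      if "i \<in> signed_index n" "j \<in> signed_index n" "i < j" "(i, j) \<notin> S" for i j
      using that k2 unfolding s S_def mem_signed_index by (auto simp: abs_if sgn_if split: if_splits)
    show "i \<in> signed_index n \<and> j \<in> signed_index n \<and> i < j \<and> simple_refl k i = j \<and> w i < w j"
      if "(i, j) \<in> S" for i j
      using that asc False k k2 weyl_minus[OF w, of "int k"] weyl_minus[OF w, of "int k - 1"]
      unfolding s S_def mem_signed_index by auto
  qed
  moreover have "card S = 2" using k2 unfolding S_def by (auto simp: card_insert_if)
  moreover have "card (negatives n (w \<circ> simple_refl k)) = card (negatives n w)"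
  proof (rule bij_betw_same_card)
    have inv: "simple_refl k (simple_refl k x) = x" for x using k by (simp add: simple_refl_involution)
    have pos: "simple_refl k x \<in> {1..int n}" if "x \<in> {1..int n}" for x
      using that k k2 unfolding s by (auto simp: sgn_if)
    show "bij_betw (simple_refl k) (negatives n (w \<circ> simple_refl k)) (negatives n w)"
      by (rule bij_betw_byWitness[where f' = "simple_refl k"])
        (use pos in \<open>auto simp: negatives_def inv simp del: atLeastAtMost_iff\<close>)
  qed
  ultimately show ?thesis by (simp add: double_length_def)
qed

text \<open>If \<open>w\<close> has no ascent at k, the product has one there, so the count for
  ascents runs backwards and the value drops by 2.\<close>

lemma double_length_simple_refl_le:
  assumes w: "w \<in> weyl_group n" and k: "k \<in> {1..n}"
  shows "double_length n (w \<circ> simple_refl k) \<le> double_length n w + 2"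
proof (cases "if k = 1 then w 1 > 0 else w (int k - 1) < w (int k)")
  case True
  then show ?thesis using double_length_ascent[OF w k] by simp
next
  case False
  let ?v = "w \<circ> simple_refl k"
  have v: "?v \<in> weyl_group n" using w k by (simp add: weyl_comp weyl_simple_refl)
  have "1 \<in> signed_index n" using k by (auto simp: mem_signed_index)
  then have "w 1 \<noteq> 0" using weyl_in[OF w, of 1] by (auto simp: mem_signed_index)
  have "w (int k - 1) \<noteq> w (int k)" using weyl_inj[OF w] by simp
  have "if k = 1 then ?v 1 > 0 else ?v (int k - 1) < ?v (int k)"
  proof (cases "k = 1")
    case True
    then show ?thesis using False \<open>w 1 \<noteq> 0\<close> weyl_minus[OF w, of 1] simple_refl_1 by auto
  next
    case k1: False
    then have "2 \<le> k" using k by auto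
    then show ?thesis using k1 False \<open>w (int k - 1) \<noteq> w (int k)\<close> by (auto simp: simple_refl_ge_2)
  qed
  from double_length_ascent[OF v k this] show ?thesis
    using k by (simp add: comp_def simple_refl_involution)
qed

text \<open>One half of the length formula; the matching bound comes from subwords of
  \<open>word_C\<close>.\<close>

lemma double_length_word_prod:
  "set is \<subseteq> {1..n} \<Longrightarrow> double_length n (word_prod is) \<le> 2 * length is"
proof (induction "is" rule: rev_induct)
  case Nil
  have "signed_inversions n id = {}" "negatives n id = {}"
    by (auto simp: signed_inversions_def negatives_def)
  then show ?case unfolding word_prod_Nil double_length_def by (simp only: card.empty)
next
  case (snoc i "is")
  then show ?case
    using double_length_simple_refl_le[of "word_prod is" n i] weyl_word_prod[of "is" n]
    by (simp add: word_prod_snoc comp_def)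
qed

section \<open>Reduced subwords\<close>

lemma word_C_Suc: "word_C (Suc n) = word_C n @ rev [1..<Suc n + 1] @ [2..<Suc n + 1]"
  by (simp add: word_C_def)

lemma length_word_C: "length (word_C n) = n\<^sup>2"
proof (induction n)
  case (Suc n)
  then show ?case unfolding word_C_Suc by (simp add: power2_eq_square del: upt_Suc)
qed (simp add: word_C_def)

lemma set_word_C: "set (word_C n) \<subseteq> {1..n}"
  unfolding word_C_def by auto

lemma letter_C_in:
  assumes "k \<in> {1..n\<^sup>2}"
  shows "letter_C n k \<in> {1..n}"
proof -
  have "k - 1 < length (word_C n)" using assms by (auto simp: length_word_C)
  then show ?thesis unfolding letter_C_def using set_word_C[of n] nth_mem by blast
qed

text \<open>Letters m^2 + 1 to (m + 1)^2 form the block m + 1, ..., 2, 1, 2, ..., m + 1 of the word;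
  t is the place within the block, and t = m + 1 is the letter 1.\<close>

lemma letter_C_eq:
  assumes "m < n" "1 \<le> t" "t \<le> 2 * m + 1"
  shows "letter_C n (m\<^sup>2 + t) = (if t \<le> Suc m then m + 2 - t else t - m)"
  using assms
proof (induction n)
  case (Suc n)
  show ?case
  proof (cases "m < n")
    case True
    then have "(Suc m)\<^sup>2 \<le> n\<^sup>2" by (intro power_mono) auto
    then have "m\<^sup>2 + t - 1 < n\<^sup>2" using Suc.prems by (simp add: power2_eq_square)
    then show ?thesis using Suc True
      unfolding letter_C_def word_C_Suc nth_append length_word_C by simp
  next
    case False
    then have m: "m = n" using Suc.prems by simp
    have "m\<^sup>2 + t - 1 = n\<^sup>2 + (t - 1)" using m Suc.prems by simp
    then have "letter_C (Suc n) (m\<^sup>2 + t) = (rev [1..<Suc n + 1] @ [2..<Suc n + 1]) ! (t - 1)"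
      unfolding letter_C_def word_C_Suc by (simp only: nth_append_length_plus length_word_C[symmetric])
    also have "\<dots> = (if t \<le> Suc m then m + 2 - t else t - m)"
      using m Suc.prems by (auto simp: nth_append rev_nth nth_Cons' simp del: upt_Suc)
    finally show ?thesis .
  qed
qed simp

text \<open>Length is expressed by \<open>double_length\<close> because its agreement with
  \<open>weyl_length\<close> is itself deduced from the existence of such subwords. The bound K on
  the places allows a subword to be extended letter by letter.\<close>

definition length_additive_subword :: "nat \<Rightarrow> nat \<Rightarrow> (int \<Rightarrow> int) \<Rightarrow> nat list \<Rightarrow> bool" where
  "length_additive_subword n K w ks \<longleftrightarrow>
     set ks \<subseteq> {1..K} \<and> sorted_wrt (<) ks \<and> word_prod (map (letter_C n) ks) = w \<and>
     double_length n w = 2 * length ks"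

text \<open>The positions that the value \<open>m\<close> runs through when the letters
  \<open>m, m - 1, \<dots>, 1, \<dots>, m - 1, m\<close> are applied one after the other.\<close>

definition position :: "nat \<Rightarrow> nat \<Rightarrow> int" where
  "position m t = (if t \<le> m then int m + 1 - int t else int m - int t)"

text \<open>Letters of the block are split off from the right of \<open>w\<close> until the value m
  + 1 sits in its own place; t measures how far away it is. Every letter is an ascent of the
  remaining factor because no relevant value exceeds m + 1 in absolute value, so lengths add
  up.\<close>

lemma subword_of_row:
  assumes m: "m < n"
    and IH: "\<And>w. w \<in> weyl_group n \<Longrightarrow> (\<And>i. i > int m \<Longrightarrow> w i = i) \<Longrightarrow>
      \<exists>ks. length_additive_subword n (m\<^sup>2) w ks"
    and "1 \<le> t" "t \<le> 2 * Suc m" "w \<in> weyl_group n" "\<And>i. i > int (Suc m) \<Longrightarrow> w i = i"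
    and "w (position (Suc m) t) = int (Suc m)"
  shows "\<exists>ks. length_additive_subword n (m\<^sup>2 + t - 1) w ks"
  using assms(3-)
proof (induction t arbitrary: w rule: nat_induct_at_least)
  case base
  have "w i = i" if "i > int m" for i
    using that base by (cases "i = int (Suc m)") (auto simp: position_def)
  then show ?case using IH[of w] base by simp
next
  case (Suc t w)
  define k where "k = letter_C n (m\<^sup>2 + t)"
  let ?s = "simple_refl k"
  let ?v = "w \<circ> ?s"
  have k_eq: "k = (if t \<le> Suc m then m + 2 - t else t - m)"
    unfolding k_def using letter_C_eq[OF m, of t] Suc by simp
  have k_in: "k \<in> {1..n}" and k_le: "k \<le> Suc m" using k_eq m Suc.hyps Suc.prems(1) by auto
  have inv: "?s (?s x) = x" for x using k_in by (simp add: simple_refl_involution)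
  \<comment> \<open>Letter t of the block exchanges the positions numbered t and t + 1; the passage
    between 1 and -1 is the letter 1.\<close>
  have swap: "?s (position (Suc m) t) = position (Suc m) (Suc t)"
  proof (cases "k = 1")
    case True
    then have "t = Suc m" using k_eq Suc.hyps by (auto split: if_splits)
    then show ?thesis using True by (simp add: simple_refl_1[unfolded One_nat_def] position_def)
  next
    case False
    then have "2 \<le> k" using k_in by auto
    then show ?thesis using False k_eq Suc.hyps Suc.prems(1)
      by (auto simp: simple_refl_ge_2 position_def sgn_if split: if_splits)
  qed
  have v: "?v \<in> weyl_group n" using Suc.prems k_in by (intro weyl_comp weyl_simple_refl)
  have v_fix: "?v i = i" if "i > int (Suc m)" for i
  proof -
    have "?s i = i"
      using k_in[THEN atLeastAtMost_iff[THEN iffD1], THEN conjunct1]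
      by (rule simple_refl_cases) (use that k_le in auto)
    then show ?thesis using Suc.prems(3)[OF that] by simp
  qed
  have v_pos: "?v (position (Suc m) t) = int (Suc m)" using swap Suc.prems(4) by simp
  have "t \<le> 2 * Suc m" using Suc.prems(1) by simp
  from Suc.IH[OF this v v_fix v_pos]
  obtain ks where ks: "length_additive_subword n (m\<^sup>2 + t - 1) ?v ks" by blast
  \<comment> \<open>Everything beyond m + 1 is fixed, so injectivity on absolute values keeps small
    arguments from being sent there.\<close>
  have v_le: "\<bar>?v i\<bar> \<le> int (Suc m)" if "\<bar>i\<bar> \<le> int (Suc m)" for i
  proof (rule ccontr)
    assume big: "\<not> ?thesis"
    then have "?v \<bar>?v i\<bar> = \<bar>?v i\<bar>" using v_fix by simp
    then have "\<bar>?v \<bar>?v i\<bar>\<bar> = \<bar>?v i\<bar>" by simp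
    then have "\<bar>\<bar>?v i\<bar>\<bar> = \<bar>i\<bar>" using weyl_abs_inj[OF v] by blast
    then show False using that big by simp
  qed
  \<comment> \<open>In the falling half of the block the value m + 1 sits at k, in the rising half
    its negative sits at k - 1; both values are extreme.\<close>
  have "if k = 1 then ?v 1 > 0 else ?v (int k - 1) < ?v (int k)"
  proof (cases "k = 1")
    case True
    then have "t = Suc m" using k_eq Suc.hyps by (auto split: if_splits)
    then show ?thesis using True v_pos by (simp add: position_def)
  next
    case k1: False
    then have neq: "?v (int k - 1) \<noteq> ?v (int k)" using weyl_inj[OF v] by simp
    show ?thesis
    proof (cases "t \<le> Suc m")
      case True
      then have "position (Suc m) t = int k" using k_eq k1 by (auto simp: position_def)
      then show ?thesis using k1 k_in v_pos v_le[of "int k - 1"] k_le neq by auto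
    next
      case False
      then have "position (Suc m) t = - (int k - 1)" using k_eq k1 by (auto simp: position_def)
      then have "?v (int k - 1) = - int (Suc m)"
        using v_pos weyl_minus[OF v, of "int k - 1"] by (metis minus_minus)
      then show ?thesis using k1 k_in v_le[of "int k"] k_le neq by auto
    qed
  qed
  from double_length_ascent[OF v k_in this]
  have "double_length n w = double_length n ?v + 2" using inv by (simp add: comp_def)
  moreover have "word_prod (map (letter_C n) (ks @ [m\<^sup>2 + t])) = w"
    using ks inv unfolding length_additive_subword_def k_def
    by (simp add: word_prod_snoc fun_eq_iff)
  ultimately have "length_additive_subword n (m\<^sup>2 + Suc t - 1) w (ks @ [m\<^sup>2 + t])"
    using ks Suc.hyps unfolding length_additive_subword_def by (fastforce simp: sorted_wrt_append)
  then show ?case by blast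
qed

text \<open>Induction on the number m of blocks, for elements that move nothing beyond m. The
  preimage of m + 1 determines how much of the next block is used.\<close>

lemma length_additive_subword_exists:
  assumes "w \<in> weyl_group n"
  shows "\<exists>ks. length_additive_subword n (n\<^sup>2) w ks"
proof -
  have "\<exists>ks. length_additive_subword n (m\<^sup>2) w ks"
    if "m \<le> n" "w \<in> weyl_group n" "\<And>i. i > int m \<Longrightarrow> w i = i" for m w
    using that
  proof (induction m arbitrary: w)
    case 0
    have "w i = i" for i
      using 0(3)[of i] 0(3)[of "- i"] weyl_minus[OF 0(2), of i] weyl_minus[OF 0(2), of 0]
      by (cases "i > 0"; cases "i < 0") auto
    then have "w = id" by auto
    moreover have "double_length n id = 0" using double_length_word_prod[of "[]" n] word_prod_Nil by simp
    ultimately have "length_additive_subword n (0\<^sup>2) w []"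
      unfolding length_additive_subword_def by (simp add: word_prod_Nil)
    then show ?case by blast
  next
    case (Suc m)
    then have m: "m < n" by simp
    obtain i where i: "w i = int (Suc m)" using weyl_surj[OF Suc.prems(2)] by blast
    have "\<bar>i\<bar> \<le> int (Suc m)"
    proof (rule ccontr)
      assume big: "\<not> ?thesis"
      then have "\<bar>w \<bar>i\<bar>\<bar> = \<bar>i\<bar>" using Suc.prems(3)[of "\<bar>i\<bar>"] by simp
      then show False
        using i weyl_abs_inj[OF Suc.prems(2), of i "\<bar>i\<bar>"] big by simp
    qed
    moreover have "i \<noteq> 0" using i weyl_minus[OF Suc.prems(2), of 0] by auto
    ultimately have "\<exists>t. 1 \<le> t \<and> t \<le> 2 * Suc m \<and> position (Suc m) t = i"
    proof (cases "i > 0")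
      case True
      then show ?thesis using \<open>\<bar>i\<bar> \<le> int (Suc m)\<close>
        by (intro exI[of _ "nat (int (Suc m) + 1 - i)"]) (auto simp: position_def)
    next
      case False
      then show ?thesis using \<open>\<bar>i\<bar> \<le> int (Suc m)\<close> \<open>i \<noteq> 0\<close>
        by (intro exI[of _ "nat (int (Suc m) - i)"]) (auto simp: position_def)
    qed
    then obtain t where t: "1 \<le> t" "t \<le> 2 * Suc m" "position (Suc m) t = i" by blast
    have "\<exists>ks. length_additive_subword n (m\<^sup>2 + t - 1) w ks"
      by (rule subword_of_row[OF m Suc.IH t(1,2) Suc.prems(2)]) (use m Suc.prems i t in auto)
    then obtain ks where "length_additive_subword n (m\<^sup>2 + t - 1) w ks" by blast
    moreover have "m\<^sup>2 + t - 1 \<le> (Suc m)\<^sup>2" using t by (simp add: power2_eq_square)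
    ultimately have "length_additive_subword n ((Suc m)\<^sup>2) w ks"
      unfolding length_additive_subword_def by fastforce
    then show ?case by blast
  qed
  from this[of n w] assms show ?thesis by (simp add: weyl_fixed mem_signed_index)
qed

text \<open>The subword found above has the length predicted by inversions, and a word of minimal
  length cannot fall below the bound in \<open>double_length_word_prod\<close>; together they
  squeeze \<open>weyl_length\<close>.\<close>

lemma double_length_eq:
  assumes "w \<in> weyl_group n"
  shows "double_length n w = 2 * weyl_length n w"
    and "\<exists>is. set is \<subseteq> {1..n} \<and> length is = weyl_length n w \<and> word_prod is = w"
proof -
  let ?P = "\<lambda>r. \<exists>is. set is \<subseteq> {1..n} \<and> length is = r \<and> word_prod is = w"
  obtain ks where ks: "length_additive_subword n (n\<^sup>2) w ks"
    using length_additive_subword_exists[OF assms] by blast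
  then have P: "?P (length ks)"
    unfolding length_additive_subword_def
    by (intro exI[of _ "map (letter_C n) ks"]) (use letter_C_in in fastforce)
  then have le: "weyl_length n w \<le> length ks"
    unfolding weyl_length_def by (rule Least_le)
  have "?P (weyl_length n w)" unfolding weyl_length_def by (rule LeastI[of ?P]) (rule P)
  then obtain "is" where "is": "set is \<subseteq> {1..n}" "length is = weyl_length n w" "word_prod is = w" by blast
  then show "\<exists>is. set is \<subseteq> {1..n} \<and> length is = weyl_length n w \<and> word_prod is = w" by blast
  have "double_length n w \<le> 2 * weyl_length n w" using double_length_word_prod[of "is" n] "is" by simp
  then show "double_length n w = 2 * weyl_length n w"
    using le ks unfolding length_additive_subword_def by simp
qed

lemma weyl_length_simple_refl_le:
  "w \<in> weyl_group n \<Longrightarrow> k \<in> {1..n} \<Longrightarrow> weyl_length n (w \<circ> simple_refl k) \<le> weyl_length n w + 1"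
  using double_length_simple_refl_le[of w n k] double_length_eq(1)[of w n]
    double_length_eq(1)[of "w \<circ> simple_refl k" n] weyl_comp weyl_simple_refl by fastforce

lemma weyl_length_id: "weyl_length n id = 0"
  using double_length_eq(1)[OF weyl_id, of n] double_length_word_prod[of "[]" n]
  by (simp add: word_prod_Nil)

text \<open>Every ordered pair is an inversion. The square of the set of 2n indices splits into
  inversions, transposed inversions and the diagonal, which gives 2n^2 - n inversions; the n
  negatives complete this to 2n^2.\<close>

lemma weyl_length_longest: "weyl_length n (longest_elt n) = n\<^sup>2"
proof -
  let ?A = "signed_index n" and ?J = "signed_inversions n (longest_elt n)"
  have J: "?J = {(i, j). i \<in> ?A \<and> j \<in> ?A \<and> i < j}"
    by (auto simp: signed_inversions_def longest_elt_def)
  have "?A \<times> ?A = ?J \<union> (prod.swap ` ?J \<union> (\<lambda>i. (i, i)) ` ?A)" unfolding J by force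
  moreover have "?J \<inter> (prod.swap ` ?J \<union> (\<lambda>i. (i, i)) ` ?A) = {}" "prod.swap ` ?J \<inter> (\<lambda>i. (i, i)) ` ?A = {}"
    unfolding J by auto
  moreover have "card (prod.swap ` ?J) = card ?J" "card ((\<lambda>i. (i, i)) ` ?A) = card ?A"
    by (auto intro!: card_image inj_onI)
  ultimately have "card (?A \<times> ?A) = card ?J + (card ?J + card ?A)"
    using finite_signed_inversions[of n "longest_elt n"] finite_signed_index[of n]
    by (simp add: card_Un_disjoint)
  moreover have "card ?A = 2 * n" unfolding signed_index_def by simp
  moreover have "negatives n (longest_elt n) = {1..int n}"
    by (auto simp: negatives_def longest_elt_def mem_signed_index)
  ultimately have "2 * double_length n (longest_elt n) = 4 * n\<^sup>2"
    by (simp add: double_length_def card_cartesian_product power2_eq_square)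
  then show ?thesis using double_length_eq(1)[OF weyl_longest, of n] by simp
qed

section \<open>The lexicographically smallest reduced subword\<close>

lemma lex_min_exists:
  fixes S :: "nat list set"
  assumes "x \<in> S" and len: "\<And>x y. x \<in> S \<Longrightarrow> y \<in> S \<Longrightarrow> length x = length y"
  shows "\<exists>!m. m \<in> S \<and> (\<forall>y\<in>S. y \<noteq> m \<longrightarrow> (m, y) \<in> lex less_than)"
proof -
  have wf: "wf (lex less_than)" by (rule wf_lex) simp
  obtain m where m: "m \<in> S" "\<And>y. (y, m) \<in> lex less_than \<Longrightarrow> y \<notin> S"
    using wfE_min[OF wf assms(1)] by blast
  have tot: "x = y \<or> (x, y) \<in> lex less_than \<or> (y, x) \<in> lex less_than" if "length x = length y" for x y :: "nat list"
    using that by (induction x y rule: list_induct2) (auto simp: less_than_iff)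
  have min: "(m, y) \<in> lex less_than" if "y \<in> S" "y \<noteq> m" for y
    using tot[OF len[OF m(1) that(1)]] m(2) that by blast
  show ?thesis
  proof (rule ex1I[of _ m])
    show "m \<in> S \<and> (\<forall>y\<in>S. y \<noteq> m \<longrightarrow> (m, y) \<in> lex less_than)" using m(1) min by simp
    show "m' = m" if "m' \<in> S \<and> (\<forall>y\<in>S. y \<noteq> m' \<longrightarrow> (m', y) \<in> lex less_than)" for m'
      using that m by metis
  qed
qed

text \<open>A reduced subword exists, and all of them have length \<open>weyl_length n w\<close>; on
  lists of equal length \<open>lex\<close> is total and well-founded. This makes the definite
  description in \<open>min_subseq\<close> meaningful.\<close>

lemma min_subseq_word:
  assumes w: "w \<in> weyl_group n"
  shows "map (letter_C n) (min_subseq n w) \<in> reduced_words n w"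
proof -
  obtain ks where "length_additive_subword n (n\<^sup>2) w ks"
    using length_additive_subword_exists[OF w] by blast
  then have ks: "set ks \<subseteq> {1..n\<^sup>2}" "sorted_wrt (<) ks" "word_prod (map (letter_C n) ks) = w"
      "length ks = weyl_length n w"
    using double_length_eq(1)[OF w] unfolding length_additive_subword_def by simp_all
  moreover have "set (map (letter_C n) ks) \<subseteq> {1..n}"
    unfolding set_map using ks(1) letter_C_in by blast
  ultimately have "ks \<in> reduced_subseqs n w"
    unfolding reduced_subseqs_def reduced_words_def by simp
  moreover have "length x = length y" if "x \<in> reduced_subseqs n w" "y \<in> reduced_subseqs n w" for x y
    using that unfolding reduced_subseqs_def reduced_words_def by simp
  ultimately have "\<exists>!m. m \<in> reduced_subseqs n w \<and> (\<forall>y\<in>reduced_subseqs n w. y \<noteq> m \<longrightarrow> (m, y) \<in> lex less_than)"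
    by (rule lex_min_exists)
  from theI'[OF this] have "min_subseq n w \<in> reduced_subseqs n w"
    unfolding min_subseq_def by blast
  then show ?thesis unfolding reduced_subseqs_def by blast
qed

section \<open>Switching two rows of a strip of two columns\<close>

text \<open>Odd rows are traversed from left to right and even rows from right to left. In the skew
  dream the second box is in both cases the right neighbour of the first.\<close>

definition first_col :: "nat \<Rightarrow> nat \<Rightarrow> nat" where
  "first_col j r = (if odd r then j else Suc j)"

definition second_col :: "nat \<Rightarrow> nat \<Rightarrow> nat" where
  "second_col j r = (if odd r then Suc j else j)"

text \<open>U = 0 encodes the absence of an upper row: row 0 contains no crossing, so the condition
  on its first box holds trivially, and the condition on the second box is guarded. Row 2 * j is the
  last one with a tile in column j, namely the diagonal tile. Both boxes may be toggled in either
  direction, which makes the hypotheses symmetric in \<open>D\<close> and \<open>E\<close>.\<close>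

locale two_column_switch =
  fixes n j U L :: nat and D E :: "(nat \<times> nat) set"
  assumes j_pos: "1 \<le> j" and j_less: "j < n" and U_less_L: "U < L" and L_le: "L \<le> 2 * j"
    and same: "\<And>r c. (r, c) \<noteq> (L, first_col j L) \<Longrightarrow> (r, c) \<noteq> (U, second_col j U) \<Longrightarrow>
      (r, c) \<in> Omega n D \<longleftrightarrow> (r, c) \<in> Omega n E"
    and between: "\<And>r. U < r \<Longrightarrow> r < L \<Longrightarrow> (r, j) \<in> Omega n D \<and> (r, Suc j) \<in> Omega n D"
    and L_second: "(L, second_col j L) \<notin> Omega n D"
    and L_first: "(L, first_col j L) \<in> Omega n D \<longleftrightarrow> (L, first_col j L) \<notin> Omega n E"
    and U_first: "(U, first_col j U) \<notin> Omega n D"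
    and U_second: "1 \<le> U \<Longrightarrow> (U, second_col j U) \<in> Omega n D \<longleftrightarrow> (U, second_col j U) \<notin> Omega n E"
begin

lemma first_neq_second: "first_col j r \<noteq> second_col j r"
  by (simp add: first_col_def second_col_def)

lemma switch_sym: "two_column_switch n j U L E D"
proof
  show "(r, j) \<in> Omega n E \<and> (r, Suc j) \<in> Omega n E" if "U < r" "r < L" for r
    using between[OF that] same[of r] that by auto
  show "(L, second_col j L) \<notin> Omega n E"
    using L_second same[of L "second_col j L"] U_less_L first_neq_second[of L] by auto
  show "(U, first_col j U) \<notin> Omega n E"
    using U_first same[of U "first_col j U"] U_less_L first_neq_second[of U] by auto
qed (use j_pos j_less U_less_L L_le same L_first U_second in auto)

lemma in_ex: "1 \<le> r \<Longrightarrow> r \<le> L \<Longrightarrow> (r, j) \<in> SYt_ex n" "1 \<le> r \<Longrightarrow> r \<le> L \<Longrightarrow> (r, Suc j) \<in> SYt_ex n"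
  using j_pos j_less L_le unfolding SYt_ex_def SYt_def by auto

text \<open>Between the two rows the vertical strands trade columns. The middle edge of row
  \<open>L\<close> is sent to an outer edge to which the first box of that row joins it in
  \<open>D\<close>, and the middle edge of row \<open>U\<close> likewise through the second box.
  These are the toggled boxes, and the chosen outer edges are themselves fixed.\<close>

definition swap_edge :: "grid_edge \<Rightarrow> grid_edge" where
  "swap_edge e = (case e of
     HEdge r c \<Rightarrow> HEdge r (if U < r \<and> r \<le> L then transpose j (Suc j) c else c)
   | VEdge r c \<Rightarrow>
       if r = L \<and> c = Suc j then
         (if (L, first_col j L) \<in> Omega n D then VEdge L (if odd L then j else Suc (Suc j))
          else HEdge (Suc L) (first_col j L))
       else if r = U \<and> c = Suc j then
         (if (U, second_col j U) \<in> Omega n D then VEdge U (if odd U then Suc (Suc j) else j)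
          else HEdge U (second_col j U))
       else VEdge r c)"

lemma swap_edge_HEdge:
  "swap_edge (HEdge r c) = HEdge r (if U < r \<and> r \<le> L then transpose j (Suc j) c else c)"
  by (simp add: swap_edge_def)

lemma swap_edge_VEdge: "(r \<noteq> L \<and> r \<noteq> U \<or> c \<noteq> Suc j) \<Longrightarrow> swap_edge (VEdge r c) = VEdge r c"
  by (auto simp: swap_edge_def)

lemma swap_edge_L:
  "swap_edge (VEdge L (Suc j)) =
     (if (L, first_col j L) \<in> Omega n D then VEdge L (if odd L then j else Suc (Suc j))
          else HEdge (Suc L) (first_col j L))"
  by (simp add: swap_edge_def)

lemma swap_edge_U:
  "swap_edge (VEdge U (Suc j)) =
     (if (U, second_col j U) \<in> Omega n D then VEdge U (if odd U then Suc (Suc j) else j)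
          else HEdge U (second_col j U))"
  using U_less_L by (simp add: swap_edge_def)

text \<open>Four cases, by the parity of the row and the state of the toggled box. Single strands of
  \<open>D\<close> go to paths of at most two strands of \<open>E\<close> through the middle edge:
  \<open>R\<close> collects strands of \<open>E\<close>, and \<open>R'\<close> their
  compositions.\<close>

lemma reach_L:
  assumes "u \<in> {(x, y) | x y. \<exists>c\<in>{j, Suc j}. (x, y) \<in> strands n D L c}"
  shows "reach n E (swap_edge (fst u)) (swap_edge (snd u))"
proof -
  interpret E: two_column_switch n j U L E D by (rule switch_sym)
  have ex: "(L, j) \<in> SYt_ex n" "(L, Suc j) \<in> SYt_ex n" using in_ex[of L] U_less_L by auto
  have n: "j \<le> n" "Suc j \<le> n" "j \<noteq> Suc n" "j \<noteq> n" using j_less by auto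
  note [simp] = swap_edge_HEdge swap_edge_L swap_edge_VEdge first_col_def second_col_def strands_def n
  note T = rtranclp_trans[of "joined n E"]
  have U: "U < L" "U \<noteq> L" "U < Suc L" using U_less_L by auto
  note [simp] = U
  show ?thesis
  proof (cases "odd L"; cases "(L, first_col j L) \<in> Omega n D")
    assume o: "odd L" and f: "(L, first_col j L) \<in> Omega n D"
    have X: "(L, j) \<in> Omega n D" "(L, Suc j) \<notin> Omega n D" "(L, j) \<notin> Omega n E" "(L, Suc j) \<notin> Omega n E"
      using o f L_first L_second E.L_second by auto
    have R: "reach n E (VEdge L j) (HEdge L j)" "reach n E (VEdge L (Suc j)) (HEdge (Suc L) j)"
      "reach n E (VEdge L (Suc j)) (HEdge L (Suc j))" "reach n E (VEdge L (Suc (Suc j))) (HEdge (Suc L) (Suc j))"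
      using reach_elbow[OF X(3) ex(1)] reach_elbow[OF X(4) ex(2)] o n by auto
    have R': "reach n E (HEdge L (Suc j)) (HEdge (Suc L) j)"
      using R(2,3) reach_sym T by blast
    show ?thesis using assms o X R R' by (auto dest: reach_sym)
  next
    assume o: "odd L" and f: "(L, first_col j L) \<notin> Omega n D"
    have X: "(L, j) \<notin> Omega n D" "(L, Suc j) \<notin> Omega n D" "(L, j) \<in> Omega n E" "(L, Suc j) \<notin> Omega n E"
      using o f L_first L_second E.L_second by auto
    have R: "reach n E (VEdge L j) (VEdge L (Suc j))" "reach n E (HEdge L j) (HEdge (Suc L) j)"
      "reach n E (VEdge L (Suc j)) (HEdge L (Suc j))" "reach n E (VEdge L (Suc (Suc j))) (HEdge (Suc L) (Suc j))"
      using reach_cross[OF X(3) ex(1)] reach_elbow[OF X(4) ex(2)] o n by auto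
    have R': "reach n E (VEdge L j) (HEdge L (Suc j))" "reach n E (HEdge (Suc L) j) (HEdge L j)"
      using R reach_sym T by blast+
    show ?thesis using assms o X R R' by auto
  next
    assume o: "\<not> odd L" and f: "(L, first_col j L) \<in> Omega n D"
    have X: "(L, Suc j) \<in> Omega n D" "(L, j) \<notin> Omega n D" "(L, Suc j) \<notin> Omega n E" "(L, j) \<notin> Omega n E"
      using o f L_first L_second E.L_second by auto
    have R: "reach n E (VEdge L j) (HEdge (Suc L) j)" "reach n E (HEdge L j) (VEdge L (Suc j))"
      "reach n E (VEdge L (Suc j)) (HEdge (Suc L) (Suc j))" "reach n E (HEdge L (Suc j)) (VEdge L (Suc (Suc j)))"
      using reach_rev_elbow[OF X(4) ex(1)] reach_rev_elbow[OF X(3) ex(2)] o n by auto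
    have R': "reach n E (HEdge L j) (HEdge (Suc L) (Suc j))" "reach n E (VEdge L (Suc (Suc j))) (HEdge L (Suc j))"
      using R reach_sym T by blast+
    show ?thesis using assms o X R R' by auto
  next
    assume o: "\<not> odd L" and f: "(L, first_col j L) \<notin> Omega n D"
    have X: "(L, Suc j) \<notin> Omega n D" "(L, j) \<notin> Omega n D" "(L, Suc j) \<in> Omega n E" "(L, j) \<notin> Omega n E"
      using o f L_first L_second E.L_second by auto
    have R: "reach n E (VEdge L j) (HEdge (Suc L) j)" "reach n E (HEdge L j) (VEdge L (Suc j))"
      "reach n E (VEdge L (Suc j)) (VEdge L (Suc (Suc j)))" "reach n E (HEdge L (Suc j)) (HEdge (Suc L) (Suc j))"
      using reach_rev_elbow[OF X(4) ex(1)] reach_cross[OF X(3) ex(2)] o n by auto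
    have R': "reach n E (HEdge L j) (VEdge L (Suc (Suc j)))" "reach n E (HEdge (Suc L) (Suc j)) (HEdge L (Suc j))"
      using R reach_sym T by blast+
    show ?thesis using assms o X R R' by (auto dest: reach_sym)
  qed
qed

lemma reach_U:
  assumes "u \<in> {(x, y) | x y. \<exists>c\<in>{j, Suc j}. (x, y) \<in> strands n D U c}" and "1 \<le> U"
  shows "reach n E (swap_edge (fst u)) (swap_edge (snd u))"
proof -
  interpret E: two_column_switch n j U L E D by (rule switch_sym)
  have ex: "(U, j) \<in> SYt_ex n" "(U, Suc j) \<in> SYt_ex n" using in_ex[of U] U_less_L assms(2) by auto
  have n: "j \<le> n" "Suc j \<le> n" "j \<noteq> Suc n" "j \<noteq> n" using j_less by auto
  note [simp] = swap_edge_HEdge swap_edge_U swap_edge_VEdge first_col_def second_col_def strands_def n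
  note T = rtranclp_trans[of "joined n E"]
  have U: "U < L" "U \<noteq> L" "Suc U \<le> L" using U_less_L by auto
  note [simp] = U
  show ?thesis
  proof (cases "odd U"; cases "(U, second_col j U) \<in> Omega n D")
    assume o: "odd U" and f: "(U, second_col j U) \<in> Omega n D"
    have X: "(U, Suc j) \<in> Omega n D" "(U, j) \<notin> Omega n D" "(U, j) \<notin> Omega n E" "(U, Suc j) \<notin> Omega n E"
      using o f U_first U_second E.U_first assms(2) by auto
    have R: "reach n E (VEdge U j) (HEdge U j)" "reach n E (VEdge U (Suc j)) (HEdge (Suc U) j)"
      "reach n E (VEdge U (Suc j)) (HEdge U (Suc j))" "reach n E (VEdge U (Suc (Suc j))) (HEdge (Suc U) (Suc j))"
      using reach_elbow[OF X(3) ex(1)] reach_elbow[OF X(4) ex(2)] o n by auto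
    have R': "reach n E (HEdge U (Suc j)) (HEdge (Suc U) j)"
      using R(2,3) reach_sym T by blast
    show ?thesis using assms o X R R' by (auto dest: reach_sym)
  next
    assume o: "odd U" and f: "(U, second_col j U) \<notin> Omega n D"
    have X: "(U, Suc j) \<notin> Omega n D" "(U, j) \<notin> Omega n D" "(U, j) \<notin> Omega n E" "(U, Suc j) \<in> Omega n E"
      using o f U_first U_second E.U_first assms(2) by auto
    have R: "reach n E (VEdge U j) (HEdge U j)" "reach n E (VEdge U (Suc j)) (HEdge (Suc U) j)"
      "reach n E (VEdge U (Suc j)) (VEdge U (Suc (Suc j)))" "reach n E (HEdge U (Suc j)) (HEdge (Suc U) (Suc j))"
      using reach_elbow[OF X(3) ex(1)] reach_cross[OF X(4) ex(2)] o n by auto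
    have R': "reach n E (VEdge U (Suc (Suc j))) (HEdge (Suc U) j)" "reach n E (HEdge (Suc U) (Suc j)) (HEdge U (Suc j))"
      using R reach_sym T by blast+
    show ?thesis using assms o X R R' by (auto dest: reach_sym)
  next
    assume o: "\<not> odd U" and f: "(U, second_col j U) \<in> Omega n D"
    have X: "(U, j) \<in> Omega n D" "(U, Suc j) \<notin> Omega n D" "(U, Suc j) \<notin> Omega n E" "(U, j) \<notin> Omega n E"
      using o f U_first U_second E.U_first assms(2) by auto
    have R: "reach n E (VEdge U j) (HEdge (Suc U) j)" "reach n E (HEdge U j) (VEdge U (Suc j))"
      "reach n E (VEdge U (Suc j)) (HEdge (Suc U) (Suc j))" "reach n E (HEdge U (Suc j)) (VEdge U (Suc (Suc j)))"
      using reach_rev_elbow[OF X(4) ex(1)] reach_rev_elbow[OF X(3) ex(2)] o n by auto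
    have R': "reach n E (HEdge U j) (HEdge (Suc U) (Suc j))"
      using R reach_sym T by blast+
    show ?thesis using assms o X R R' by (auto dest: reach_sym)
  next
    assume o: "\<not> odd U" and f: "(U, second_col j U) \<notin> Omega n D"
    have X: "(U, Suc j) \<notin> Omega n D" "(U, j) \<notin> Omega n D" "(U, Suc j) \<notin> Omega n E" "(U, j) \<in> Omega n E"
      using o f U_first U_second E.U_first assms(2) by auto
    have R: "reach n E (VEdge U j) (VEdge U (Suc j))" "reach n E (HEdge U j) (HEdge (Suc U) j)"
      "reach n E (VEdge U (Suc j)) (HEdge (Suc U) (Suc j))" "reach n E (HEdge U (Suc j)) (VEdge U (Suc (Suc j)))"
      using reach_rev_elbow[OF X(3) ex(2)] reach_cross[OF X(4) ex(1)] o n by auto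
    have R': "reach n E (VEdge U j) (HEdge (Suc U) (Suc j))" "reach n E (HEdge (Suc U) j) (HEdge U j)"
      using R reach_sym T by blast+
    show ?thesis using assms o X R R' by (auto dest: reach_sym)
  qed
qed

text \<open>Only rows \<open>U\<close> and \<open>L\<close> require the explicit analysis of tiles.
  Strictly between them both columns consist of crossings and are exchanged as a whole; elsewhere
  tiles and edges stay.\<close>

lemma reach_swap_strand:
  assumes ex: "(r, c) \<in> SYt_ex n" and st: "(u, v) \<in> strands n D r c"
  shows "reach n E (swap_edge u) (swap_edge v)"
proof -
  have r1: "1 \<le> r" using ex unfolding SYt_ex_def SYt_def by auto
  consider "r = L" "c \<in> {j, Suc j}" | "r = U" "c \<in> {j, Suc j}" | "U < r" "r < L" "c \<in> {j, Suc j}"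
    | "c \<notin> {j, Suc j} \<or> \<not> (U \<le> r \<and> r \<le> L)"
    by fastforce
  then show ?thesis
  proof cases
    case 1
    then show ?thesis using reach_L[of "(u, v)"] st by auto
  next
    case 2
    then show ?thesis using reach_U[of "(u, v)"] st r1 by auto
  next
    case 3
    have Y: "(r, j) \<in> Omega n E" "(r, Suc j) \<in> Omega n E"
      using between[OF 3(1,2)] same[of r] 3 by auto
    have R: "reach n E (VEdge r j) (VEdge r (Suc j))" "reach n E (HEdge r j) (HEdge (Suc r) j)"
      "reach n E (VEdge r (Suc j)) (VEdge r (Suc (Suc j)))" "reach n E (HEdge r (Suc j)) (HEdge (Suc r) (Suc j))"
      using reach_cross[OF Y(1)] reach_cross[OF Y(2)] Y Omega_in_ex by auto
    then show ?thesis
      using st 3 between[OF 3(1,2)] by (auto simp: strands_def swap_edge_HEdge swap_edge_VEdge)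
  next
    case 4
    have "(r, c) \<in> Omega n D \<longleftrightarrow> (r, c) \<in> Omega n E"
    proof (rule same)
      show "(r, c) \<noteq> (L, first_col j L)" "(r, c) \<noteq> (U, second_col j U)"
        using 4 U_less_L by (auto simp: first_col_def second_col_def)
    qed
    then have *: "strands n E r c = strands n D r c"
      by (simp add: strands_def)
    \<comment> \<open>The exchange ranges from the bottom of row \<open>U\<close> to the top of row
      \<open>L\<close>, so a box above or below these rows has both horizontal edges outside of
      it.\<close>
    have "transpose j (Suc j) c = c \<or> \<not> (U < r \<and> r \<le> L) \<and> \<not> (U < Suc r \<and> Suc r \<le> L)"
    proof (cases "c \<in> {j, Suc j}")
      case True
      then show ?thesis using 4 by linarith
    next
      case False
      then show ?thesis by (metis insert_iff transpose_apply_other)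
    qed
    then have "swap_edge (HEdge r c) = HEdge r c" "swap_edge (HEdge (Suc r) c) = HEdge (Suc r) c"
      unfolding swap_edge_HEdge by metis+
    moreover have "swap_edge (VEdge r c) = VEdge r c" "swap_edge (VEdge r (Suc c)) = VEdge r (Suc c)"
      using 4 U_less_L by (auto intro!: swap_edge_VEdge)
    moreover have "{u, v} \<subseteq> {HEdge r c, HEdge (Suc r) c, VEdge r c, VEdge r (Suc c)}"
      using st unfolding strands_def by (simp split: if_splits) blast+
    ultimately have "swap_edge u = u \<and> swap_edge v = v" by auto
    then show ?thesis using reach_strand[OF ex, of u v E] st * by simp
  qed
qed

lemma reach_swap: "reach n D x y \<Longrightarrow> reach n E (swap_edge x) (swap_edge y)"
  by (rule reach_hom) (use reach_swap_strand in auto)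

end

section \<open>Self-crossings under a two-column switch\<close>

definition meets_both :: "nat \<Rightarrow> (nat \<times> nat) set \<Rightarrow> nat \<Rightarrow> nat \<Rightarrow> nat \<Rightarrow> bool" where
  "meets_both n D j U k \<longleftrightarrow> HEdge (Suc U) j \<in> pipe n D k \<and> HEdge (Suc U) (Suc j) \<in> pipe n D k"

text \<open>Since the vertical strands trade places while the horizontal ones stay, a self-crossing
  strictly between the rows reappears in the other column. Row \<open>L\<close> is left out here, in
  contrast to \<open>swap_edge\<close>, as its second box is an elbow.\<close>

definition swap_box :: "nat \<Rightarrow> nat \<Rightarrow> nat \<Rightarrow> nat \<times> nat \<Rightarrow> nat \<times> nat" where
  "swap_box j U L b =
     (fst b, if U < fst b \<and> fst b < L then transpose j (Suc j) (snd b) else snd b)"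

lemma swap_box_involution: "swap_box j U L (swap_box j U L b) = b"
  by (simp add: swap_box_def)

context two_column_switch
begin

lemma pipe_start_fixed:
  assumes "k \<in> {1..n}"
  shows "swap_edge (pipe_start n k) = pipe_start n k"
proof -
  define m where "m = n + 1 - k"
  \<comment> \<open>The pipe that starts in column \<open>Suc j\<close> does so in row 2 * j + 1,
    which lies below row \<open>L\<close>.\<close>
  have "\<not> (m = Suc j \<and> (2 * m - 1 = L \<or> 2 * m - 1 = U))" using L_le U_less_L by auto
  then have "swap_edge (VEdge (2 * m - 1) m) = VEdge (2 * m - 1) m"
    by (intro swap_edge_VEdge) auto
  then show ?thesis unfolding pipe_start_def m_def .
qed

lemma pipe_swap:
  assumes "k \<in> {1..n}" "x \<in> pipe n D k"
  shows "swap_edge x \<in> pipe n E k"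
  using assms reach_swap[of "pipe_start n k" x] unfolding pipe_iff pipe_start_fixed[OF assms(1)] by simp

lemma HEdge_pipe_swap:
  assumes "k \<in> {1..n}" "HEdge r c \<in> pipe n D k"
  shows "HEdge r (if U < r \<and> r \<le> L then transpose j (Suc j) c else c) \<in> pipe n E k"
  using pipe_swap[OF assms] unfolding swap_edge_HEdge .

lemma VEdge_pipe_swap:
  assumes "k \<in> {1..n}" "VEdge r c \<in> pipe n D k" "r \<noteq> L \<and> r \<noteq> U \<or> c \<noteq> Suc j"
  shows "VEdge r c \<in> pipe n E k"
  using pipe_swap[OF assms(1,2)] unfolding swap_edge_VEdge[OF assms(3)] .

lemma vertical_pipe:
  assumes "c \<in> {j, Suc j}" "U < r" "r \<le> L"
  shows "HEdge r c \<in> pipe n D k \<longleftrightarrow> HEdge (Suc U) c \<in> pipe n D k"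
proof -
  have "Suc U \<le> r" using assms by simp
  then show ?thesis using assms(3)
  proof (induction rule: dec_induct)
    case (step r)
    then have b: "(r, c) \<in> Omega n D" using between[of r] assms(1) by auto
    show ?case using step pipe_cong[OF reach_cross(2)[OF b Omega_in_ex[OF b]]] by simp
  qed simp
qed

text \<open>The horizontal strand through the first box is turned upwards by the elbow in the second
  box and becomes the other vertical strand, so the two vertical strands are what crosses
  here.\<close>

lemma L_self_crossing:
  assumes f: "(L, first_col j L) \<in> Omega n D"
  shows "(L, first_col j L) \<in> self_crossings n D k \<longleftrightarrow> meets_both n D j U k"
proof -
  have L1: "1 \<le> L" using U_less_L by simp
  have ex: "(L, j) \<in> SYt_ex n" "(L, Suc j) \<in> SYt_ex n" using in_ex[OF L1] by auto
  have v: "VEdge L (first_col j L) \<in> pipe n D k \<longleftrightarrow> HEdge L (second_col j L) \<in> pipe n D k"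
  proof (cases "odd L")
    case True
    then have X: "(L, j) \<in> Omega n D" "(L, Suc j) \<notin> Omega n D"
      using f L_second by (auto simp: first_col_def second_col_def)
    have "reach n D (VEdge L j) (VEdge L (Suc j))" "reach n D (VEdge L (Suc j)) (HEdge L (Suc j))"
      using reach_cross[OF X(1) ex(1)] reach_elbow[OF X(2) ex(2)] True j_less by auto
    from this[THEN pipe_cong, of k] show ?thesis using True by (simp add: first_col_def second_col_def)
  next
    case False
    then have X: "(L, j) \<notin> Omega n D"
      using L_second by (auto simp: first_col_def second_col_def)
    have "reach n D (HEdge L j) (VEdge L (Suc j))"
      using reach_rev_elbow[OF X ex(1)] False j_less by auto
    from this[THEN pipe_cong, of k] show ?thesis using False by (simp add: first_col_def second_col_def)
  qed
  have "{first_col j L, second_col j L} = {j, Suc j}" by (auto simp: first_col_def second_col_def)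
  then have "HEdge L (first_col j L) \<in> pipe n D k \<and> HEdge L (second_col j L) \<in> pipe n D k \<longleftrightarrow>
      HEdge L j \<in> pipe n D k \<and> HEdge L (Suc j) \<in> pipe n D k"
    by (auto simp: doubleton_eq_iff)
  then show ?thesis
    unfolding self_crossings_iff meets_both_def
    using f v vertical_pipe[of _ L k] U_less_L by auto
qed

text \<open>Coming from below, one vertical strand runs straight into the second box and the other
  is turned into it by the elbow in the first box.\<close>

lemma U_self_crossing:
  assumes s: "(U, second_col j U) \<in> Omega n D"
  shows "(U, second_col j U) \<in> self_crossings n D k \<longleftrightarrow> meets_both n D j U k"
proof -
  have U1: "1 \<le> U" using Omega_subset_SYt[of n D] s unfolding SYt_def by auto
  have ex: "(U, j) \<in> SYt_ex n" "(U, Suc j) \<in> SYt_ex n" using in_ex[OF U1] U_less_L by auto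
  show ?thesis
  proof (cases "odd U")
    case True
    then have X: "(U, Suc j) \<in> Omega n D" "(U, j) \<notin> Omega n D"
      using s U_first by (auto simp: first_col_def second_col_def)
    have "reach n D (VEdge U (Suc j)) (HEdge (Suc U) j)" "reach n D (HEdge U (Suc j)) (HEdge (Suc U) (Suc j))"
      using reach_elbow[OF X(2) ex(1)] reach_cross[OF X(1) ex(2)] True j_less by auto
    from this[THEN pipe_cong, of k] show ?thesis
      using True X by (simp add: self_crossings_iff meets_both_def second_col_def)
  next
    case False
    then have X: "(U, j) \<in> Omega n D" "(U, Suc j) \<notin> Omega n D"
      using s U_first by (auto simp: first_col_def second_col_def)
    have "reach n D (VEdge U j) (VEdge U (Suc j))" "reach n D (VEdge U (Suc j)) (HEdge (Suc U) (Suc j))"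
      "reach n D (HEdge U j) (HEdge (Suc U) j)"
      using reach_rev_elbow[OF X(2) ex(2)] reach_cross[OF X(1) ex(1)] False j_less by auto
    from this[THEN pipe_cong, of k] show ?thesis
      using False X by (auto simp: self_crossings_iff meets_both_def second_col_def)
  qed
qed

text \<open>These boxes are crossings in at most one of the two dreams and are counted
  separately.\<close>

abbreviation "marked \<equiv> {(L, first_col j L), (U, second_col j U)}"

lemma swap_box_self_crossing:
  assumes k: "k \<in> {1..n}" and b: "b \<in> self_crossings n D k - marked"
  shows "swap_box j U L b \<in> self_crossings n E k - marked"
proof -
  interpret E: two_column_switch n j U L E D by (rule switch_sym)
  obtain r c where rc: "b = (r, c)" by (cases b)
  have self: "(r, c) \<in> Omega n D" "VEdge r c \<in> pipe n D k" "HEdge r c \<in> pipe n D k"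
    and unmarked: "(r, c) \<noteq> (L, first_col j L)" "(r, c) \<noteq> (U, second_col j U)"
    using b unfolding rc by (auto simp: self_crossings_iff)
  show ?thesis
  proof (cases "U < r \<and> r < L \<and> c \<in> {j, Suc j}")
    case True
    define c' where "c' = transpose j (Suc j) c"
    have c': "c' \<in> {j, Suc j}" using True unfolding c'_def by auto
    have X: "(r, j) \<in> Omega n D" "(r, Suc j) \<in> Omega n D" using between True by auto
    have "(r, c') \<in> Omega n E" using E.between[of r] True c' by auto
    moreover have "VEdge r c' \<in> pipe n E k"
    proof (rule VEdge_pipe_swap[OF k])
      have "VEdge r j \<in> pipe n D k \<longleftrightarrow> VEdge r (Suc j) \<in> pipe n D k"
        by (rule pipe_cong[OF reach_cross(1)[OF X(1) Omega_in_ex[OF X(1)]]])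
      then show "VEdge r c' \<in> pipe n D k" using self(2) True c' by auto
      show "r \<noteq> L \<and> r \<noteq> U \<or> c' \<noteq> Suc j" using True by auto
    qed
    moreover have "HEdge r c' \<in> pipe n E k"
      using HEdge_pipe_swap[OF k self(3)] True by (auto simp: c'_def)
    ultimately show ?thesis
      using True by (auto simp: rc swap_box_def self_crossings_iff c'_def)
  next
    case False
    have fixed: "(if U < r \<and> r < L then transpose j (Suc j) c else c) = c"
      using False by (metis insert_iff transpose_apply_other)
    have swap_box_fixed: "swap_box j U L (r, c) = (r, c)"
      unfolding swap_box_def fst_conv snd_conv fixed ..
    have cL: "c \<notin> {j, Suc j}" if "r = L"
      using that unmarked self(1) L_second by (auto simp: first_col_def second_col_def split: if_splits)
    have cU: "c \<notin> {j, Suc j}" if "r = U"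
      using that unmarked self(1) U_first by (auto simp: first_col_def second_col_def split: if_splits)
    have "(r, c) \<in> Omega n E" using same[OF unmarked] self(1) by simp
    moreover have "VEdge r c \<in> pipe n E k"
      by (rule VEdge_pipe_swap[OF k self(2)]) (use cL cU in auto)
    moreover have "(if U < r \<and> r \<le> L then transpose j (Suc j) c else c) = c"
      using fixed cL by (cases "r = L") auto
    then have "HEdge r c \<in> pipe n E k"
      using HEdge_pipe_swap[OF k self(3)] by metis
    ultimately show ?thesis
      using unmarked by (simp add: rc swap_box_fixed self_crossings_iff)
  qed
qed

lemma card_unmarked:
  assumes "k \<in> {1..n}"
  shows "card (self_crossings n D k - marked) = card (self_crossings n E k - marked)"
proof (rule bij_betw_same_card)
  interpret E: two_column_switch n j U L E D by (rule switch_sym)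
  show "bij_betw (swap_box j U L) (self_crossings n D k - marked) (self_crossings n E k - marked)"
  proof (rule bij_betw_byWitness[where f' = "swap_box j U L"]; (intro ballI swap_box_involution)?)
    show "swap_box j U L ` (self_crossings n D k - marked) \<subseteq> self_crossings n E k - marked"
      using swap_box_self_crossing[OF assms] by (rule image_subsetI)
    show "swap_box j U L ` (self_crossings n E k - marked) \<subseteq> self_crossings n D k - marked"
      using E.swap_box_self_crossing[OF assms] by (rule image_subsetI)
  qed
qed

lemma finite_self_crossings: "finite (self_crossings n D k)"
  unfolding self_crossings_def using finite_Omega by simp

lemma card_self_crossings:
  "card (self_crossings n D k) = card (self_crossings n D k - marked) +
     of_bool ((L, first_col j L) \<in> Omega n D \<and> meets_both n D j U k) +
     of_bool ((U, second_col j U) \<in> Omega n D \<and> meets_both n D j U k)"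
proof -
  let ?S = "self_crossings n D k"
  have "?S = (?S - marked) \<union> (?S \<inter> {(L, first_col j L)} \<union> ?S \<inter> {(U, second_col j U)})" by auto
  then have "card ?S = card ((?S - marked) \<union> (?S \<inter> {(L, first_col j L)} \<union> ?S \<inter> {(U, second_col j U)}))"
    by (rule arg_cong)
  also have "\<dots> = card (?S - marked) + card (?S \<inter> {(L, first_col j L)} \<union> ?S \<inter> {(U, second_col j U)})"
    by (rule card_Un_disjoint) (use finite_self_crossings in auto)
  also have "card (?S \<inter> {(L, first_col j L)} \<union> ?S \<inter> {(U, second_col j U)}) =
      card (?S \<inter> {(L, first_col j L)}) + card (?S \<inter> {(U, second_col j U)})"
    by (rule card_Un_disjoint) (use U_less_L in auto)
  finally have card: "card ?S = card (?S - marked) +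
      (card (?S \<inter> {(L, first_col j L)}) + card (?S \<inter> {(U, second_col j U)}))" .
  have single: "card (?S \<inter> {x}) = of_bool (x \<in> ?S)" for x by auto
  have sub: "x \<in> ?S \<Longrightarrow> x \<in> Omega n D" for x by (simp add: self_crossings_def)
  have "(L, first_col j L) \<in> ?S \<longleftrightarrow> (L, first_col j L) \<in> Omega n D \<and> meets_both n D j U k"
    "(U, second_col j U) \<in> ?S \<longleftrightarrow> (U, second_col j U) \<in> Omega n D \<and> meets_both n D j U k"
    using L_self_crossing[of k] U_self_crossing[of k] sub by blast+
  then show ?thesis unfolding card single by simp
qed

lemma meets_both_swap: "k \<in> {1..n} \<Longrightarrow> meets_both n D j U k \<Longrightarrow> meets_both n E j U k"
  using HEdge_pipe_swap[of k "Suc U" j] HEdge_pipe_swap[of k "Suc U" "Suc j"] U_less_L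
  unfolding meets_both_def by (simp add: Suc_le_eq)

text \<open>With an upper row, both toggled boxes concern the same pipes and each changes the count
  by one, so the parity stays. Without an upper row a single box is toggled; it concerns only a pipe
  that contains both vertical strands, which the second alternative excludes.\<close>

lemma parity_self_crossings:
  assumes k: "k \<in> {1..n}" and "1 \<le> U \<or> \<not> meets_both n D j U k"
  shows "odd (card (self_crossings n D k)) \<longleftrightarrow> odd (card (self_crossings n E k))"
proof -
  interpret E: two_column_switch n j U L E D by (rule switch_sym)
  have both: "meets_both n E j U k \<longleftrightarrow> meets_both n D j U k"
    using meets_both_swap[OF k] E.meets_both_swap[OF k] unfolding meets_both_def by blast
  show ?thesis
    using assms(2) L_first U_second
    unfolding card_self_crossings[of k] E.card_self_crossings[of k] card_unmarked[OF k] both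
    by auto
qed

text \<open>For U = 0 the exchanged strands reach the upper border, so the ends of the two columns
  are interchanged; otherwise the exchange stops below it.\<close>

lemma reach_top:
  assumes k: "k \<in> {1..n}"
  shows "reach n D (pipe_start n k) (HEdge 1 c) \<longleftrightarrow>
    reach n E (pipe_start n k) (HEdge 1 (if U = 0 then transpose j (Suc j) c else c))"
proof -
  interpret E: two_column_switch n j U L E D by (rule switch_sym)
  have L1: "1 \<le> L" using U_less_L by simp
  show ?thesis
    using HEdge_pipe_swap[OF k, of 1 c] L1
      E.HEdge_pipe_swap[OF k, of 1 "if U = 0 then transpose j (Suc j) c else c"]
    by (auto simp: pipe_iff split: if_splits)
qed

end

section \<open>Switching two rows of the last column\<close>

text \<open>Here \<open>U\<close> and \<open>L\<close> number rows of the skew dream; row p occupies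
  rows 2 * p - 1 and 2 * p of column n, which are linked by two turning tiles in column n + 1. With
  exactly one crossing a pipe passes through this turn and crosses itself; with none the turn closes
  up to a separate loop. For U = 0 the truncated difference 2 * U - 1 is 0, and row 0 has no
  crossing.\<close>

locale one_column_switch =
  fixes n U L :: nat and D E :: "(nat \<times> nat) set"
  assumes U_less_L: "U < L" and L_le: "L \<le> n"
    and same: "\<And>r c. (r, c) \<noteq> (2 * L - 1, n) \<Longrightarrow> (r, c) \<noteq> (2 * U, n) \<Longrightarrow>
      (r, c) \<in> Omega n D \<longleftrightarrow> (r, c) \<in> Omega n E"
    and between: "\<And>p. U < p \<Longrightarrow> p < L \<Longrightarrow> (2 * p - 1, n) \<in> Omega n D \<and> (2 * p, n) \<in> Omega n D"
    and L_second: "(2 * L, n) \<notin> Omega n D"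
    and L_first: "(2 * L - 1, n) \<in> Omega n D \<longleftrightarrow> (2 * L - 1, n) \<notin> Omega n E"
    and U_first: "(2 * U - 1, n) \<notin> Omega n D"
    and U_second: "1 \<le> U \<Longrightarrow> (2 * U, n) \<in> Omega n D \<longleftrightarrow> (2 * U, n) \<notin> Omega n E"
begin

lemma switch_sym: "one_column_switch n U L E D"
proof
  show "(2 * p - 1, n) \<in> Omega n E \<and> (2 * p, n) \<in> Omega n E" if "U < p" "p < L" for p
    using between[OF that] same[of "2 * p - 1" n] same[of "2 * p" n] that by (auto; presburger)
  show "(2 * L, n) \<notin> Omega n E"
    using L_second same[of "2 * L" n] U_less_L by auto
  show "(2 * U - 1, n) \<notin> Omega n E"
  proof (cases "U = 0")
    case True
    then show ?thesis by (simp add: Omega_iff)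
  next
    case False
    then have "2 * U - 1 \<noteq> 2 * L - 1" "2 * U - 1 \<noteq> 2 * U" using U_less_L by auto
    then show ?thesis using U_first same[of "2 * U - 1" n] by simp
  qed
qed (use U_less_L L_le same L_first U_second in auto)

lemma in_ex:
  assumes "1 \<le> p" "p \<le> n"
  shows "(2 * p - 1, n) \<in> SYt_ex n" "(2 * p, n) \<in> SYt_ex n"
    "(2 * p - 1, Suc n) \<in> SYt_ex n" "(2 * p, Suc n) \<in> SYt_ex n"
  using assms unfolding SYt_ex_def SYt_def by auto

text \<open>The edges of the loop: the two right edges of column n, the edge between the turning
  tiles, and the edge between the two boxes of column n.\<close>

definition collapsed :: "nat \<Rightarrow> grid_edge set" where
  "collapsed p = {VEdge (2 * p - 1) (Suc n), HEdge (2 * p) (Suc n), VEdge (2 * p) (Suc n), HEdge (2 * p) n}"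

text \<open>Each loop is contracted to the edge by which its pipe enters from the left, in row 2 * L
  - 1 or row 2 * U. No two pipes trade places, so all other edges are fixed.\<close>

definition collapse_edge :: "grid_edge \<Rightarrow> grid_edge" where
  "collapse_edge e =
     (if e \<in> collapsed L then VEdge (2 * L - 1) n
      else if 1 \<le> U \<and> e \<in> collapsed U then VEdge (2 * U) n else e)"

lemma turn_reach:
  assumes "1 \<le> p" "p \<le> n"
  shows "reach n X (VEdge (2 * p - 1) (Suc n)) (HEdge (2 * p) (Suc n))"
    "reach n X (VEdge (2 * p) (Suc n)) (HEdge (2 * p) (Suc n))"
proof -
  have "(2 * p - 1, Suc n) \<notin> Omega n X" "(2 * p, Suc n) \<notin> Omega n X"
    by (auto simp: Omega_iff)
  moreover have "Suc (2 * p - 1) = 2 * p" "odd (2 * p - 1)" using assms by auto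
  ultimately show "reach n X (VEdge (2 * p - 1) (Suc n)) (HEdge (2 * p) (Suc n))"
    "reach n X (VEdge (2 * p) (Suc n)) (HEdge (2 * p) (Suc n))"
    using reach_rev_elbow(1)[of "2 * p - 1" "Suc n" n X] reach_elbow(1)[of "2 * p" "Suc n" n X] in_ex[OF assms]
    by auto
qed

lemma collapsed_fixed:
  "c \<noteq> Suc n \<Longrightarrow> collapse_edge (VEdge r c) = VEdge r c"
  "c \<noteq> Suc n \<Longrightarrow> (c = n \<Longrightarrow> r \<noteq> 2 * L \<and> (U = 0 \<or> r \<noteq> 2 * U)) \<Longrightarrow> collapse_edge (HEdge r c) = HEdge r c"
  "r \<noteq> 2 * L \<Longrightarrow> r \<noteq> 2 * L - 1 \<Longrightarrow> U = 0 \<or> r \<noteq> 2 * U \<and> r \<noteq> 2 * U - 1 \<Longrightarrow> collapse_edge (VEdge r c) = VEdge r c"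
  "r \<noteq> 2 * L \<Longrightarrow> U = 0 \<or> r \<noteq> 2 * U \<Longrightarrow> collapse_edge (HEdge r c) = HEdge r c"
  "c \<noteq> Suc n \<Longrightarrow> c \<noteq> n \<Longrightarrow> collapse_edge (HEdge r c) = HEdge r c"
  by (auto simp: collapse_edge_def collapsed_def)

lemma collapse_L: "e \<in> collapsed L \<Longrightarrow> collapse_edge e = VEdge (2 * L - 1) n"
  by (simp add: collapse_edge_def)

lemma collapse_U: "1 \<le> U \<Longrightarrow> e \<in> collapsed U \<Longrightarrow> collapse_edge e = VEdge (2 * U) n"
proof -
  assume U: "1 \<le> U" and e: "e \<in> collapsed U"
  have "2 * U \<noteq> 2 * L" "2 * U - 1 \<noteq> 2 * L - 1" "2 * U \<noteq> 2 * L - 1" "2 * U - 1 \<noteq> 2 * L"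
    using U U_less_L by (auto; presburger)+
  then have "e \<notin> collapsed L" using e unfolding collapsed_def by auto
  then show ?thesis using U e by (simp add: collapse_edge_def)
qed

text \<open>The detour through the loop: to the right through the crossing, down by the turn, back
  into row 2 * p, and upwards through the same crossing.\<close>

lemma reach_first:
  assumes p: "1 \<le> p" "p \<le> n" and X: "(2 * p - 1, n) \<in> Omega n X" "(2 * p, n) \<notin> Omega n X"
  shows "reach n X (VEdge (2 * p - 1) n) (HEdge (2 * p - 1) n)"
proof -
  note ex = in_ex[OF p] and T = rtranclp_trans[of "joined n X"]
  have "Suc (2 * p - 1) = 2 * p" using p by simp
  then have R: "reach n X (VEdge (2 * p - 1) n) (VEdge (2 * p - 1) (Suc n))"
    "reach n X (HEdge (2 * p - 1) n) (HEdge (2 * p) n)"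
    "reach n X (HEdge (2 * p) n) (VEdge (2 * p) (Suc n))"
    using reach_cross[OF X(1) ex(1)] reach_rev_elbow[OF X(2) ex(2)] by auto
  show ?thesis
    using R turn_reach[OF p, of X] T reach_sym by meson
qed

text \<open>The reflected detour: to the right through the crossing in row 2 * p, up by the turn,
  and down again by the elbow in row 2 * p - 1.\<close>

lemma reach_second:
  assumes p: "1 \<le> p" "p \<le> n" and X: "(2 * p - 1, n) \<notin> Omega n X" "(2 * p, n) \<in> Omega n X"
  shows "reach n X (VEdge (2 * p) n) (HEdge (2 * p) n)"
proof -
  note ex = in_ex[OF p] and T = rtranclp_trans[of "joined n X"]
  have "Suc (2 * p - 1) = 2 * p" "odd (2 * p - 1)" using p by auto
  then have R: "reach n X (VEdge (2 * p) n) (VEdge (2 * p) (Suc n))"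
    "reach n X (VEdge (2 * p - 1) (Suc n)) (HEdge (2 * p) n)"
    using reach_cross[OF X(2) ex(2)] reach_elbow[OF X(1) ex(1)] by auto
  show ?thesis
    using R turn_reach[OF p, of X] T reach_sym by meson
qed

lemma L_strand:
  assumes st: "(u, v) \<in> strands n D r c" and rc: "r \<in> {2 * L - 1, 2 * L}" "c \<in> {n, Suc n}"
  shows "reach n E (collapse_edge u) (collapse_edge v)"
proof -
  interpret E: one_column_switch n U L E D by (rule switch_sym)
  have p: "1 \<le> L" "L \<le> n" using U_less_L L_le by auto
  note ex = in_ex[OF p]
  have par: "Suc (2 * L - 1) = 2 * L" "odd (2 * L - 1)" "Suc (2 * L) \<noteq> 2 * L" "2 * L - 1 \<noteq> 2 * L"
    "U = 0 \<or> Suc (2 * L) \<noteq> 2 * U" "U = 0 \<or> 2 * L - 1 \<noteq> 2 * U"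
    using p U_less_L by (auto; presburger)+
  have f: "collapse_edge (VEdge (2 * L - 1) n) = VEdge (2 * L - 1) n"
    "collapse_edge (HEdge (2 * L - 1) n) = HEdge (2 * L - 1) n"
    "collapse_edge (VEdge (2 * L) n) = VEdge (2 * L) n"
    "collapse_edge (HEdge (Suc (2 * L)) n) = HEdge (Suc (2 * L)) n"
    "collapse_edge (VEdge r (Suc (Suc n))) = VEdge r (Suc (Suc n))"
    "collapse_edge (HEdge (Suc (2 * L)) (Suc n)) = HEdge (Suc (2 * L)) (Suc n)"
    "collapse_edge (HEdge (2 * L - 1) (Suc n)) = HEdge (2 * L - 1) (Suc n)" for r
    using par by (auto simp: collapse_edge_def collapsed_def)
  have g: "collapse_edge (VEdge (2 * L - 1) (Suc n)) = VEdge (2 * L - 1) n"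
    "collapse_edge (HEdge (2 * L) (Suc n)) = VEdge (2 * L - 1) n"
    "collapse_edge (VEdge (2 * L) (Suc n)) = VEdge (2 * L - 1) n"
    "collapse_edge (HEdge (2 * L) n) = VEdge (2 * L - 1) n"
    by (intro collapse_L; simp add: collapsed_def)+
  have no: "(2 * L - 1, Suc n) \<notin> Omega n X" "(2 * L, Suc n) \<notin> Omega n X" for X
    by (auto simp: Omega_iff)
  have R0: "reach n E (HEdge (2 * L - 1) (Suc n)) (VEdge (2 * L - 1) (Suc (Suc n)))"
    "reach n E (VEdge (2 * L) (Suc (Suc n))) (HEdge (Suc (2 * L)) (Suc n))"
    using reach_rev_elbow(2)[OF no(1) ex(3)] reach_elbow(2)[OF no(2) ex(4)] p by auto
  have R1: "reach n E (VEdge (2 * L) n) (HEdge (Suc (2 * L)) n)"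
    using reach_rev_elbow(1)[OF E.L_second ex(2)] by auto
  \<comment> \<open>With or without the loop, the pipe that enters row 2 * L - 1 from the left
    leaves upwards in column n.\<close>
  have R2: "reach n E (VEdge (2 * L - 1) n) (HEdge (2 * L - 1) n)"
  proof (cases "(2 * L - 1, n) \<in> Omega n E")
    case True
    then show ?thesis using reach_first[OF p] E.L_second by blast
  next
    case False
    then show ?thesis using reach_elbow(1)[OF _ ex(1)] par by auto
  qed
  from rc consider "(r, c) = (2 * L - 1, n)" | "(r, c) = (2 * L, n)" | "(r, c) = (2 * L - 1, Suc n)"
    | "(r, c) = (2 * L, Suc n)" by auto
  then show ?thesis
  proof cases
    case 1
    have "(u, v) \<in> {(VEdge (2 * L - 1) n, VEdge (2 * L - 1) (Suc n)), (HEdge (2 * L - 1) n, HEdge (2 * L) n),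
        (VEdge (2 * L - 1) n, HEdge (2 * L - 1) n), (VEdge (2 * L - 1) (Suc n), HEdge (2 * L) n)}"
      using st 1 par by (auto simp: strands_def split: if_splits)
    then show ?thesis using f g R2 reach_sym[OF R2] by auto
  next
    case 2
    then show ?thesis using st L_second R1 f g by (auto simp: strands_def)
  next
    case 3
    then show ?thesis using st no(1)[of D] R0 f g par by (auto simp: strands_def)
  next
    case 4
    then show ?thesis using st no(2)[of D] R0 f g par by (auto simp: strands_def)
  qed
qed

lemma U_strand:
  assumes st: "(u, v) \<in> strands n D r c" and U: "1 \<le> U" and rc: "r \<in> {2 * U - 1, 2 * U}" "c \<in> {n, Suc n}"
  shows "reach n E (collapse_edge u) (collapse_edge v)"
proof -
  interpret E: one_column_switch n U L E D by (rule switch_sym)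
  have p: "1 \<le> U" "U \<le> n" using U U_less_L L_le by auto
  note ex = in_ex[OF p]
  have par: "Suc (2 * U - 1) = 2 * U" "odd (2 * U - 1)" "Suc (2 * U) \<noteq> 2 * U" "2 * U - 1 \<noteq> 2 * U"
    "Suc (2 * U) \<noteq> 2 * L" "2 * U - 1 \<noteq> 2 * L"
    using p U_less_L by (auto; presburger)+
  have f: "collapse_edge (VEdge (2 * U - 1) n) = VEdge (2 * U - 1) n"
    "collapse_edge (HEdge (2 * U - 1) n) = HEdge (2 * U - 1) n"
    "collapse_edge (VEdge (2 * U) n) = VEdge (2 * U) n"
    "collapse_edge (HEdge (Suc (2 * U)) n) = HEdge (Suc (2 * U)) n"
    "collapse_edge (VEdge r (Suc (Suc n))) = VEdge r (Suc (Suc n))"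
    "collapse_edge (HEdge (Suc (2 * U)) (Suc n)) = HEdge (Suc (2 * U)) (Suc n)"
    "collapse_edge (HEdge (2 * U - 1) (Suc n)) = HEdge (2 * U - 1) (Suc n)" for r
    using par by (auto simp: collapse_edge_def collapsed_def)
  have g: "collapse_edge (VEdge (2 * U - 1) (Suc n)) = VEdge (2 * U) n"
    "collapse_edge (HEdge (2 * U) (Suc n)) = VEdge (2 * U) n"
    "collapse_edge (VEdge (2 * U) (Suc n)) = VEdge (2 * U) n"
    "collapse_edge (HEdge (2 * U) n) = VEdge (2 * U) n"
    using U by (intro collapse_U; simp add: collapsed_def)+
  have no: "(2 * U - 1, Suc n) \<notin> Omega n X" "(2 * U, Suc n) \<notin> Omega n X" for X
    by (auto simp: Omega_iff)
  have R0: "reach n E (HEdge (2 * U - 1) (Suc n)) (VEdge (2 * U - 1) (Suc (Suc n)))"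
    "reach n E (VEdge (2 * U) (Suc (Suc n))) (HEdge (Suc (2 * U)) (Suc n))"
    using reach_rev_elbow(2)[OF no(1) ex(3)] reach_elbow(2)[OF no(2) ex(4)] p by auto
  have R1: "reach n E (VEdge (2 * U - 1) n) (HEdge (2 * U - 1) n)"
    using reach_elbow(1)[OF E.U_first ex(1)] par by auto
  \<comment> \<open>With or without the loop, the strand at the left of row 2 * U leaves downwards
    in column n.\<close>
  have R2: "reach n E (VEdge (2 * U) n) (HEdge (Suc (2 * U)) n)"
  proof (cases "(2 * U, n) \<in> Omega n E")
    case True
    then show ?thesis
      using rtranclp_trans[OF reach_second[OF p E.U_first True] reach_cross(2)[OF True ex(2)]] by simp
  next
    case False
    then show ?thesis using reach_rev_elbow(1)[OF _ ex(2)] par by auto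
  qed
  from rc consider "(r, c) = (2 * U - 1, n)" | "(r, c) = (2 * U, n)" | "(r, c) = (2 * U - 1, Suc n)"
    | "(r, c) = (2 * U, Suc n)" by auto
  then show ?thesis
  proof cases
    case 1
    then show ?thesis using st U_first R1 f g par by (auto simp: strands_def)
  next
    case 2
    have "(u, v) \<in> {(VEdge (2 * U) n, VEdge (2 * U) (Suc n)), (HEdge (2 * U) n, HEdge (Suc (2 * U)) n),
        (VEdge (2 * U) n, HEdge (Suc (2 * U)) n), (HEdge (2 * U) n, VEdge (2 * U) (Suc n))}"
      using st 2 par by (auto simp: strands_def split: if_splits)
    then show ?thesis using f g R2 by auto
  next
    case 3
    then show ?thesis using st no(1)[of D] R0 f g par by (auto simp: strands_def)
  next
    case 4
    then show ?thesis using st no(2)[of D] R0 f g par by (auto simp: strands_def)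
  qed
qed

lemma reach_collapse_strand:
  assumes ex: "(r, c) \<in> SYt_ex n" and st: "(u, v) \<in> strands n D r c"
  shows "reach n E (collapse_edge u) (collapse_edge v)"
proof -
  have r1: "1 \<le> r" "c \<le> Suc n" using ex unfolding SYt_ex_def SYt_def by auto
  consider "r \<in> {2 * L - 1, 2 * L}" "c \<in> {n, Suc n}" | "1 \<le> U" "r \<in> {2 * U - 1, 2 * U}" "c \<in> {n, Suc n}"
    | "c < n \<or> (r \<notin> {2 * L - 1, 2 * L} \<and> (U = 0 \<or> r \<notin> {2 * U - 1, 2 * U}))"
    using r1 by fastforce
  then show ?thesis
  proof cases
    case 1
    then show ?thesis using L_strand st by blast
  next
    case 2
    then show ?thesis using U_strand st by blast
  next
    case 3
    have "(r, c) \<in> Omega n D \<longleftrightarrow> (r, c) \<in> Omega n E"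
    proof (cases "U = 0 \<and> r = 0")
      case False
      show ?thesis
      proof (rule same)
        show "(r, c) \<noteq> (2 * L - 1, n)" "(r, c) \<noteq> (2 * U, n)" using 3 r1 by auto
      qed
    qed (use r1 in simp)
    then have *: "strands n E r c = strands n D r c" by (simp add: strands_def)
    have odd_even: "odd r \<Longrightarrow> r \<noteq> 2 * L - 1 \<Longrightarrow> Suc r \<noteq> 2 * L" "odd r \<Longrightarrow> r \<noteq> 2 * U - 1 \<Longrightarrow> Suc r \<noteq> 2 * U"
      by auto
    have "collapse_edge (VEdge r c) = VEdge r c \<and> collapse_edge (VEdge r (Suc c)) = VEdge r (Suc c)"
      using 3
    proof (elim disjE)
      assume "c < n"
      then show ?thesis by (simp add: collapsed_fixed(1))
    next
      assume "r \<notin> {2 * L - 1, 2 * L} \<and> (U = 0 \<or> r \<notin> {2 * U - 1, 2 * U})"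
      then show ?thesis by (intro conjI collapsed_fixed(3)) auto
    qed
    moreover have "collapse_edge (HEdge r c) = HEdge r c \<and> collapse_edge (HEdge (Suc r) c) = HEdge (Suc r) c"
      using 3
    proof (elim disjE)
      assume "c < n"
      then show ?thesis by (auto intro!: collapsed_fixed(5))
    next
      assume "r \<notin> {2 * L - 1, 2 * L} \<and> (U = 0 \<or> r \<notin> {2 * U - 1, 2 * U})"
      moreover from this have "Suc r \<noteq> 2 * L" "U = 0 \<or> Suc r \<noteq> 2 * U" by auto
      ultimately show ?thesis by (intro conjI collapsed_fixed(4)) auto
    qed
    moreover have "{u, v} \<subseteq> {HEdge r c, HEdge (Suc r) c, VEdge r c, VEdge r (Suc c)}"
      using st unfolding strands_def by (simp split: if_splits) blast+
    ultimately have "collapse_edge u = u \<and> collapse_edge v = v" by auto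
    then show ?thesis using reach_strand[OF ex, of u v E] st * by simp
  qed
qed

lemma reach_collapse: "reach n D x y \<Longrightarrow> reach n E (collapse_edge x) (collapse_edge y)"
  by (rule reach_hom) (use reach_collapse_strand in auto)

lemma pipe_collapse:
  assumes "k \<in> {1..n}" "x \<in> pipe n D k" "collapse_edge x = x"
  shows "x \<in> pipe n E k"
proof -
  have "collapse_edge (pipe_start n k) = pipe_start n k"
    using assms(1) unfolding pipe_start_def by (intro collapsed_fixed(1)) auto
  then show ?thesis using assms reach_collapse[of "pipe_start n k" x] unfolding pipe_iff by simp
qed

section \<open>Self-crossings under a one-column switch\<close>

abbreviation "marked \<equiv> {(2 * L - 1, n), (2 * U, n)}"

lemma unmarked_self_crossing:
  assumes k: "k \<in> {1..n}" and b: "b \<in> self_crossings n D k - marked"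
  shows "b \<in> self_crossings n E k - marked"
proof -
  obtain r c where rc: "b = (r, c)" by (cases b)
  have self: "(r, c) \<in> Omega n D" "VEdge r c \<in> pipe n D k" "HEdge r c \<in> pipe n D k"
    and unmarked: "(r, c) \<noteq> (2 * L - 1, n)" "(r, c) \<noteq> (2 * U, n)"
    using b unfolding rc by (auto simp: self_crossings_iff)
  have "c \<le> n" using self(1) Omega_subset_SYt[of n D] unfolding SYt_def by auto
  then have "collapse_edge (VEdge r c) = VEdge r c" by (intro collapsed_fixed(1)) simp
  moreover have "collapse_edge (HEdge r c) = HEdge r c"
    using \<open>c \<le> n\<close> unmarked self(1) L_second by (intro collapsed_fixed(2)) auto
  moreover have "(r, c) \<in> Omega n E" using same[OF unmarked] self(1) by simp
  ultimately show ?thesis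
    using self unmarked pipe_collapse[OF k] unfolding rc by (simp add: self_crossings_iff)
qed

lemma vertical_pipe:
  assumes "U < p" "p \<le> L"
  shows "HEdge (2 * p - 1) n \<in> pipe n D k \<longleftrightarrow> HEdge (Suc (2 * U)) n \<in> pipe n D k"
proof -
  have "Suc U \<le> p" using assms by simp
  then show ?thesis using assms(2)
  proof (induction rule: dec_induct)
    case (step p)
    then have b: "(2 * p - 1, n) \<in> Omega n D" "(2 * p, n) \<in> Omega n D" using between[of p] by auto
    have "Suc (2 * p - 1) = 2 * p" "2 * Suc p - 1 = Suc (2 * p)" using step by auto
    then show ?case
      using step pipe_cong[OF reach_cross(2)[OF b(1) Omega_in_ex[OF b(1)]]]
        pipe_cong[OF reach_cross(2)[OF b(2) Omega_in_ex[OF b(2)]]] by simp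
  qed simp
qed

text \<open>When a toggled box is a crossing, its loop is attached to the strand that runs along
  column n between the two rows, so both passages through the box belong to that pipe.\<close>

lemma marked_self_crossing:
  "(2 * L - 1, n) \<in> self_crossings n D k \<longleftrightarrow>
     (2 * L - 1, n) \<in> Omega n D \<and> HEdge (Suc (2 * U)) n \<in> pipe n D k"
  "(2 * U, n) \<in> self_crossings n D k \<longleftrightarrow>
     (2 * U, n) \<in> Omega n D \<and> HEdge (Suc (2 * U)) n \<in> pipe n D k"
proof -
  have p: "1 \<le> L" using U_less_L by simp
  show "(2 * L - 1, n) \<in> self_crossings n D k \<longleftrightarrow>
     (2 * L - 1, n) \<in> Omega n D \<and> HEdge (Suc (2 * U)) n \<in> pipe n D k"
    using pipe_cong[OF reach_first[OF p L_le _ L_second], of k] vertical_pipe[OF U_less_L, of k]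
    by (auto simp: self_crossings_iff)
  show "(2 * U, n) \<in> self_crossings n D k \<longleftrightarrow>
     (2 * U, n) \<in> Omega n D \<and> HEdge (Suc (2 * U)) n \<in> pipe n D k"
  proof (cases "(2 * U, n) \<in> Omega n D")
    case True
    then have q: "1 \<le> U" "U \<le> n" using U_less_L L_le by (auto simp: Omega_iff)
    show ?thesis
      using pipe_cong[OF reach_second[OF q U_first True], of k] True
        pipe_cong[OF reach_cross(2)[OF True in_ex(2)[OF q]], of k]
      by (auto simp: self_crossings_iff)
  qed (simp add: self_crossings_iff)
qed

lemma card_self_crossings:
  "card (self_crossings n D k) = card (self_crossings n D k - marked) +
     of_bool ((2 * L - 1, n) \<in> Omega n D \<and> HEdge (Suc (2 * U)) n \<in> pipe n D k) +
     of_bool ((2 * U, n) \<in> Omega n D \<and> HEdge (Suc (2 * U)) n \<in> pipe n D k)"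
proof -
  let ?S = "self_crossings n D k"
  have fin: "finite ?S" unfolding self_crossings_def using finite_Omega by simp
  have "2 * L - 1 \<noteq> 2 * U" using U_less_L by presburger
  then have disj: "?S \<inter> {(2 * L - 1, n)} \<inter> (?S \<inter> {(2 * U, n)}) = {}" by auto
  have "?S = (?S - marked) \<union> (?S \<inter> {(2 * L - 1, n)} \<union> ?S \<inter> {(2 * U, n)})" by auto
  then have "card ?S = card ((?S - marked) \<union> (?S \<inter> {(2 * L - 1, n)} \<union> ?S \<inter> {(2 * U, n)}))"
    by (rule arg_cong)
  also have "\<dots> = card (?S - marked) + card (?S \<inter> {(2 * L - 1, n)} \<union> ?S \<inter> {(2 * U, n)})"
    by (rule card_Un_disjoint) (use fin in auto)
  also have "card (?S \<inter> {(2 * L - 1, n)} \<union> ?S \<inter> {(2 * U, n)}) =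
      card (?S \<inter> {(2 * L - 1, n)}) + card (?S \<inter> {(2 * U, n)})"
    by (rule card_Un_disjoint) (use disj in auto)
  finally have card: "card ?S = card (?S - marked) +
      (card (?S \<inter> {(2 * L - 1, n)}) + card (?S \<inter> {(2 * U, n)}))" .
  have single: "card (?S \<inter> {x}) = of_bool (x \<in> ?S)" for x by auto
  show ?thesis unfolding card single using marked_self_crossing[of k] by simp
qed

lemma column_pipe:
  assumes "k \<in> {1..n}"
  shows "HEdge (Suc (2 * U)) n \<in> pipe n D k \<longleftrightarrow> HEdge (Suc (2 * U)) n \<in> pipe n E k"
proof -
  interpret E: one_column_switch n U L E D by (rule switch_sym)
  have "Suc (2 * U) \<noteq> 2 * L" "Suc (2 * U) \<noteq> 2 * U" by presburger+
  then have "collapse_edge (HEdge (Suc (2 * U)) n) = HEdge (Suc (2 * U)) n"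
    "E.collapse_edge (HEdge (Suc (2 * U)) n) = HEdge (Suc (2 * U)) n"
    by (auto intro!: collapsed_fixed(4) E.collapsed_fixed(4))
  then show ?thesis using pipe_collapse[OF assms] E.pipe_collapse[OF assms] by blast
qed

text \<open>For U \<ge> 1 the pipe along column n changes its count at two boxes. For U = 0 it
  changes at one box only, so exactly the pipe that ends at the top of column n changes
  parity.\<close>

lemma parity_self_crossings:
  assumes k: "k \<in> {1..n}"
  shows "odd (card (self_crossings n D k)) \<longleftrightarrow>
    odd (card (self_crossings n E k)) \<noteq> (U = 0 \<and> HEdge 1 n \<in> pipe n D k)"
proof -
  interpret E: one_column_switch n U L E D by (rule switch_sym)
  have "self_crossings n D k - marked = self_crossings n E k - marked"
    using unmarked_self_crossing[OF k] E.unmarked_self_crossing[OF k] by blast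
  moreover have "(2 * U, n) \<notin> Omega n X" if "U = 0" for X using that by (simp add: Omega_iff)
  ultimately show ?thesis
    unfolding card_self_crossings[of k] E.card_self_crossings[of k] column_pipe[OF k, symmetric]
    using L_first U_second by (cases "U = 0") auto
qed

lemma reach_top:
  assumes k: "k \<in> {1..n}" and "c \<le> n"
  shows "reach n D (pipe_start n k) (HEdge 1 c) \<longleftrightarrow> reach n E (pipe_start n k) (HEdge 1 c)"
proof -
  interpret E: one_column_switch n U L E D by (rule switch_sym)
  have "1 \<noteq> 2 * L" "1 \<noteq> 2 * U" by presburger+
  then have "collapse_edge (HEdge 1 c) = HEdge 1 c" "E.collapse_edge (HEdge 1 c) = HEdge 1 c"
    by (auto intro!: collapsed_fixed(4) E.collapsed_fixed(4))
  then show ?thesis using pipe_collapse[OF k] E.pipe_collapse[OF k] unfolding pipe_iff by blast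
qed

end

section \<open>The signed permutation of a dream under switches\<close>

text \<open>A relational form of \<open>pd_elt\<close>, free of the definite description in
  \<open>pipe_perm\<close> and of inverses: the absolute value of w c names the pipe that ends at
  column n + 1 - c, and the exponent sign + 1 makes w c positive for an odd number of
  self-crossings. That every dream has such an element is shown only in
  \<open>realizes_exists\<close>.\<close>

definition realizes :: "nat \<Rightarrow> (nat \<times> nat) set \<Rightarrow> (int \<Rightarrow> int) \<Rightarrow> bool" where
  "realizes n D w \<longleftrightarrow> w \<in> weyl_group n \<and>
     (\<forall>k\<in>{1..n}. \<forall>c\<in>{1..n}.
        reach n D (pipe_start n k) (HEdge 1 (n + 1 - c)) \<longleftrightarrow> \<bar>w (int c)\<bar> = int k) \<and>
     (\<forall>c\<in>{1..n}. w (int c) > 0 \<longleftrightarrow> odd (card (self_crossings n D (nat \<bar>w (int c)\<bar>))))"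

lemma weyl_abs_in:
  assumes "w \<in> weyl_group n" "c \<in> {1..n}"
  shows "nat \<bar>w (int c)\<bar> \<in> {1..n}" "w (int c) \<noteq> 0"
proof -
  have "int c \<in> signed_index n" using assms(2) by (auto simp: mem_signed_index)
  then have "w (int c) \<in> signed_index n" using weyl_in[OF assms(1)] by blast
  then show "nat \<bar>w (int c)\<bar> \<in> {1..n}" "w (int c) \<noteq> 0" by (auto simp: mem_signed_index)
qed

text \<open>The absolute values of \<open>w\<close> form the inverse of \<open>pipe_perm\<close>:
  the relation determines the pipe that ends at each column, which settles existence and uniqueness
  in the description of v_D.\<close>

lemma realizes_pd_elt:
  assumes "realizes n D w"
  shows "pd_elt n D = w"
proof -
  have w: "w \<in> weyl_group n"
    and top: "\<And>k c. k \<in> {1..n} \<Longrightarrow> c \<in> {1..n} \<Longrightarrow>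
      HEdge 1 (n + 1 - c) \<in> pipe n D k \<longleftrightarrow> \<bar>w (int c)\<bar> = int k"
    and sign: "\<And>c. c \<in> {1..n} \<Longrightarrow> w (int c) > 0 \<longleftrightarrow> odd (card (self_crossings n D (nat \<bar>w (int c)\<bar>)))"
    using assms unfolding realizes_def pipe_iff by blast+
  define u where "u c = (if c \<in> {1..n} then nat \<bar>w (int c)\<bar> else c)" for c
  have u_in: "u c \<in> {1..n}" if "c \<in> {1..n}" for c
    using weyl_abs_in(1)[OF w that] that unfolding u_def by simp
  have "inj_on u {1..n}"
  proof (rule inj_onI)
    fix a b assume ab: "a \<in> {1..n}" "b \<in> {1..n}" "u a = u b"
    then have "\<bar>w (int a)\<bar> = \<bar>w (int b)\<bar>" unfolding u_def by (simp split: if_splits)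
    then show "a = b" using weyl_abs_inj[OF w] by simp
  qed
  then have "bij_betw u {1..n} {1..n}"
    unfolding bij_betw_def using u_in by (metis endo_inj_surj finite_atLeastAtMost image_subsetI)
  then have perm: "u permutes {1..n}"
    by (rule bij_imp_permutes) (auto simp: u_def)
  have top': "HEdge 1 (n + 1 - c) \<in> pipe n D k \<longleftrightarrow> u c = k" if "k \<in> {1..n}" "c \<in> {1..n}" for k c
    using top[OF that] that unfolding u_def by auto
  have v: "pipe_perm n D = inv u"
    unfolding pipe_perm_def
  proof (rule the_equality)
    have "HEdge 1 (n + 1 - inv u k) \<in> pipe n D k" if "k \<in> {1..n}" for k
    proof -
      have "inv u k \<in> {1..n}" using permutes_in_image[OF permutes_inv[OF perm]] that by blast
      from top'[OF that this] show ?thesis using permutes_inverses(1)[OF perm] by blast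
    qed
    then show "inv u permutes {1..n} \<and>
        (\<forall>k\<in>{1..n}. edge_of (1, n + 1 - inv u k) TopSide \<in> pipe n D k)"
      unfolding edge_of.simps by (intro conjI ballI permutes_inv[OF perm])
    fix v assume v: "v permutes {1..n} \<and> (\<forall>k\<in>{1..n}. edge_of (1, n + 1 - v k) TopSide \<in> pipe n D k)"
    have "u (v k) = k" for k
    proof (cases "k \<in> {1..n}")
      case True
      have "v k \<in> {1..n}" using permutes_in_image[OF conjunct1[OF v]] True by blast
      moreover have "HEdge 1 (n + 1 - v k) \<in> pipe n D k"
        using bspec[OF conjunct2[OF v] True] unfolding edge_of.simps .
      ultimately show ?thesis using top'[OF True] by blast
    next
      case False
      then have "v k = k" by (rule permutes_not_in[OF conjunct1[OF v]])
      then show ?thesis using False unfolding u_def by auto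
    qed
    then show "v = inv u"
      using permutes_inverses(2)[OF perm] by (intro ext) metis
  qed
  then have inv_v: "inv (pipe_perm n D) = u" using permutes_inv_inv[OF perm] by simp
  show ?thesis
  proof
    fix x :: int
    show "pd_elt n D x = w x"
    proof (cases "x \<in> signed_index n")
      case False
      then show ?thesis using weyl_fixed[OF w] unfolding pd_elt_def by simp
    next
      case True
      define c where "c = nat \<bar>x\<bar>"
      have c: "c \<in> {1..n}" "x = sgn x * int c"
        using True unfolding c_def mem_signed_index by (auto simp: sgn_if)
      have "pipe_sign n D c = card (self_crossings n D (u c))"
        unfolding pipe_sign_def end_pipe_def inv_v self_crossings_def ..
      then have "pd_elt n D x = sgn x * ((- 1) ^ (card (self_crossings n D (u c)) + 1) * int (u c))"
        using True unfolding pd_elt_def inv_v c_def by simp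
      also have "(- 1) ^ (card (self_crossings n D (u c)) + 1) * int (u c) = w (int c)"
        using sign[OF c(1)] c(1) weyl_abs_in[OF w c(1)] unfolding u_def
        by (cases "odd (card (self_crossings n D (nat \<bar>w (int c)\<bar>)))") auto
      also have "sgn x * w (int c) = w x"
        using c(2) weyl_minus[OF w, of "int c"] True unfolding mem_signed_index
        by (cases "x > 0") (auto simp: sgn_if)
      finally show ?thesis .
    qed
  qed
qed

section \<open>Strips in the coordinates of the skew dream\<close>

definition box_of :: "nat \<Rightarrow> nat \<Rightarrow> nat \<Rightarrow> nat \<times> nat" where
  "box_of n r c = (if odd r then ((r + 1) div 2, c) else (r div 2, 2 * n + 1 - c))"

lemma Omega_box_of:
  assumes "D \<subseteq> SY n" "1 \<le> r" "1 \<le> c" "c \<le> n"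
  shows "(r, c) \<in> Omega n D \<longleftrightarrow> box_of n r c \<in> D"
proof -
  have "box_of n r c \<in> D \<Longrightarrow> box_of n r c \<in> SY n" using assms(1) by blast
  then show ?thesis
    using assms(2-) unfolding Omega_iff box_of_def SY_def by (auto split: if_splits)
qed

lemma box_of_inj:
  assumes "box_of n r c = box_of n r' c'" "1 \<le> r" "1 \<le> r'" "1 \<le> c" "c \<le> n" "1 \<le> c'" "c' \<le> n"
  shows "r = r' \<and> c = c'"
  using assms unfolding box_of_def by (auto split: if_splits elim!: oddE)

text \<open>Columns n - i + 1 and n + i - 1 have n + 1 - i boxes each, and they coincide for i =
  1.\<close>

definition strip_size :: "nat \<Rightarrow> nat \<Rightarrow> nat" where
  "strip_size n i = (if i = 1 then n else 2 * (n + 1 - i))"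

text \<open>The boxes in the columns \<open>mitosis_cols n i\<close>, from the last to the first in the order of
  \<open>box_list n\<close>.\<close>

definition strip_box :: "nat \<Rightarrow> nat \<Rightarrow> nat \<Rightarrow> nat \<times> nat" where
  "strip_box n i r =
     (if i = 1 then (r, n) else if odd r then ((r + 1) div 2, n - i + 1) else (r div 2, n + i - 1))"

definition right_box :: "nat \<times> nat \<Rightarrow> nat \<times> nat" where
  "right_box b = (fst b, Suc (snd b))"

text \<open>The common form of both locales in terms of boxes of the dream: a row of the strip is a
  box in a mitosis column together with its right neighbour.\<close>

definition strip_switch :: "nat \<Rightarrow> nat \<Rightarrow> nat \<Rightarrow> nat \<Rightarrow> (nat \<times> nat) set \<Rightarrow> (nat \<times> nat) set \<Rightarrow> bool" where
  "strip_switch n i U L D E \<longleftrightarrow>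
     U < L \<and> L \<le> strip_size n i \<and>
     (\<forall>b. b \<noteq> strip_box n i L \<and> (1 \<le> U \<longrightarrow> b \<noteq> right_box (strip_box n i U)) \<longrightarrow> (b \<in> D \<longleftrightarrow> b \<in> E)) \<and>
     (\<forall>r. U < r \<and> r < L \<longrightarrow> strip_box n i r \<in> D \<and> right_box (strip_box n i r) \<in> D) \<and>
     right_box (strip_box n i L) \<notin> D \<and>
     (strip_box n i L \<in> D \<longleftrightarrow> strip_box n i L \<notin> E) \<and>
     (1 \<le> U \<longrightarrow> strip_box n i U \<notin> D \<and>
        (right_box (strip_box n i U) \<in> D \<longleftrightarrow> right_box (strip_box n i U) \<notin> E))"

lemma strip_box_ge_2:
  assumes "i \<in> {2..n}"
  shows "strip_box n i r = box_of n r (first_col (n + 1 - i) r)"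
    "right_box (strip_box n i r) = box_of n r (second_col (n + 1 - i) r)"
  using assms by (auto simp: strip_box_def right_box_def box_of_def first_col_def second_col_def)

lemma two_column_switchI:
  assumes D: "D \<subseteq> SY n" and E: "E \<subseteq> SY n" and i: "i \<in> {2..n}" and sw: "strip_switch n i U L D E"
  shows "two_column_switch n (n + 1 - i) U L D E"
proof -
  define j where "j = n + 1 - i"
  have j: "1 \<le> j" "j < n" "Suc j \<le> n" using i unfolding j_def by auto
  note boxes = strip_box_ge_2[OF i, folded j_def]
  note sw = sw[unfolded strip_switch_def, unfolded boxes(2), unfolded boxes(1)]
  have cols: "1 \<le> first_col j r" "first_col j r \<le> n" "1 \<le> second_col j r" "second_col j r \<le> n" for r
    using j by (auto simp: first_col_def second_col_def)
  have Om: "(r, c) \<in> Omega n X \<longleftrightarrow> box_of n r c \<in> X" if "1 \<le> r" "1 \<le> c" "c \<le> n" "X \<in> {D, E}" for r c X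
    using Omega_box_of[of X n r c] that D E by auto
  have L: "1 \<le> L" using sw by simp
  have no0: "(0, c) \<notin> Omega n X" for c X by (simp add: Omega_iff)
  have "two_column_switch n j U L D E"
  proof
    show "1 \<le> j" "j < n" using j by auto
    show "U < L" "L \<le> 2 * j" using sw i unfolding strip_size_def j_def by auto
    show "(r, c) \<in> Omega n D \<longleftrightarrow> (r, c) \<in> Omega n E"
      if ne: "(r, c) \<noteq> (L, first_col j L)" "(r, c) \<noteq> (U, second_col j U)" for r c
    proof (cases "1 \<le> r \<and> 1 \<le> c \<and> c \<le> n")
      case True
      then have "box_of n r c \<noteq> box_of n L (first_col j L)" using ne box_of_inj L cols by blast
      moreover have "1 \<le> U \<longrightarrow> box_of n r c \<noteq> box_of n U (second_col j U)"
        using True ne box_of_inj cols by blast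
      ultimately have "box_of n r c \<in> D \<longleftrightarrow> box_of n r c \<in> E" using sw by blast
      then show ?thesis using True Om[of r c D] Om[of r c E] by simp
    next
      case False
      then show ?thesis using Omega_subset_SYt[of n D] Omega_subset_SYt[of n E] unfolding SYt_def by auto
    qed
    show "(r, j) \<in> Omega n D \<and> (r, Suc j) \<in> Omega n D" if "U < r" "r < L" for r
      using sw that Om[of r j D] Om[of r "Suc j" D] j by (auto simp: first_col_def second_col_def split: if_splits)
    show "(L, second_col j L) \<notin> Omega n D" using sw L Om cols by simp
    show "(L, first_col j L) \<in> Omega n D \<longleftrightarrow> (L, first_col j L) \<notin> Omega n E" using sw L Om cols by simp
    show "(U, first_col j U) \<notin> Omega n D" using sw no0 Om cols by (cases "U = 0") auto
    show "1 \<le> U \<Longrightarrow> (U, second_col j U) \<in> Omega n D \<longleftrightarrow> (U, second_col j U) \<notin> Omega n E"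
      using sw Om cols by simp
  qed
  then show ?thesis unfolding j_def .
qed

lemma strip_box_1:
  assumes "1 \<le> p"
  shows "strip_box n 1 p = box_of n (2 * p - 1) n" "right_box (strip_box n 1 p) = box_of n (2 * p) n"
  using assms by (auto simp: strip_box_def right_box_def box_of_def)

lemma one_column_switchI:
  assumes D: "D \<subseteq> SY n" and E: "E \<subseteq> SY n" and sw: "strip_switch n 1 U L D E"
  shows "one_column_switch n U L D E"
proof -
  have UL: "U < L" "L \<le> n" using sw unfolding strip_switch_def strip_size_def by auto
  then have L: "1 \<le> L" and two_L: "1 \<le> 2 * L - 1" and n: "1 \<le> n" "n \<le> n" by auto
  have Om: "(r, n) \<in> Omega n X \<longleftrightarrow> box_of n r n \<in> X" if "1 \<le> r" "X \<in> {D, E}" for r X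
    using Omega_box_of[of X n r n] that D E n by auto
  have no0: "(0, c) \<notin> Omega n X" for c X by (simp add: Omega_iff)
  have diff: "\<And>b. b \<noteq> box_of n (2 * L - 1) n \<Longrightarrow> (1 \<le> U \<Longrightarrow> b \<noteq> box_of n (2 * U) n) \<Longrightarrow> b \<in> D \<longleftrightarrow> b \<in> E"
    using sw L strip_box_1[of U n] strip_box_1[of L n] unfolding strip_switch_def by metis
  show ?thesis
  proof
    show "U < L" "L \<le> n" by fact+
    show "(r, c) \<in> Omega n D \<longleftrightarrow> (r, c) \<in> Omega n E"
      if ne: "(r, c) \<noteq> (2 * L - 1, n)" "(r, c) \<noteq> (2 * U, n)" for r c
    proof (cases "1 \<le> r \<and> 1 \<le> c \<and> c \<le> n")
      case True
      then have "box_of n r c \<noteq> box_of n (2 * L - 1) n"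
        using ne(1) box_of_inj[of n r c "2 * L - 1" n] True two_L n by blast
      moreover have "box_of n r c \<noteq> box_of n (2 * U) n" if "1 \<le> U"
        using True ne(2) box_of_inj[of n r c "2 * U" n] n that by auto
      ultimately have "box_of n r c \<in> D \<longleftrightarrow> box_of n r c \<in> E" by (rule diff)
      then show ?thesis using True Omega_box_of[OF D, of r c] Omega_box_of[OF E, of r c] by simp
    next
      case False
      then show ?thesis using Omega_subset_SYt[of n D] Omega_subset_SYt[of n E] unfolding SYt_def by auto
    qed
    show "(2 * p - 1, n) \<in> Omega n D \<and> (2 * p, n) \<in> Omega n D" if "U < p" "p < L" for p
      using sw that Om strip_box_1[of p n] unfolding strip_switch_def by auto
    show "(2 * L, n) \<notin> Omega n D"
      using sw L Om strip_box_1[of L n] unfolding strip_switch_def by auto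
    show "(2 * L - 1, n) \<in> Omega n D \<longleftrightarrow> (2 * L - 1, n) \<notin> Omega n E"
      using sw L Om strip_box_1[of L n] unfolding strip_switch_def by auto
    show "(2 * U - 1, n) \<notin> Omega n D"
    proof (cases "U = 0")
      case False
      then show ?thesis using sw Om strip_box_1[of U n] unfolding strip_switch_def by auto
    qed (simp add: no0)
    show "1 \<le> U \<Longrightarrow> (2 * U, n) \<in> Omega n D \<longleftrightarrow> (2 * U, n) \<notin> Omega n E"
      using sw Om strip_box_1[of U n] unfolding strip_switch_def by auto
  qed
qed

text \<open>Interchanging the tops of columns n + 1 - i and n + 2 - i means exchanging the arguments
  i and i - 1 of \<open>w\<close>; changing the parity of the pipe at the top of column n means
  changing the sign at 1.\<close>

lemma strip_switch_realizes:
  assumes D: "D \<subseteq> SY n" and E: "E \<subseteq> SY n" and i: "i \<in> {1..n}" and sw: "strip_switch n i U L D E"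
    and w: "realizes n D w"
  shows "realizes n E (if U = 0 then w \<circ> simple_refl i else w)"
proof -
  have W: "w \<in> weyl_group n"
    and top: "\<And>k c. k \<in> {1..n} \<Longrightarrow> c \<in> {1..n} \<Longrightarrow>
      reach n D (pipe_start n k) (HEdge 1 (n + 1 - c)) \<longleftrightarrow> \<bar>w (int c)\<bar> = int k"
    and sign: "\<And>c. c \<in> {1..n} \<Longrightarrow> w (int c) > 0 \<longleftrightarrow> odd (card (self_crossings n D (nat \<bar>w (int c)\<bar>)))"
    using w unfolding realizes_def by blast+
  have W': "(if U = 0 then w \<circ> simple_refl i else w) \<in> weyl_group n"
    using W weyl_comp[OF W weyl_simple_refl[OF i]] by simp
  show ?thesis
  proof (cases "i = 1")
    case True
    interpret one_column_switch n U L D E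
      using one_column_switchI[OF D E] sw True by simp
    have abs: "\<bar>(if U = 0 then w \<circ> simple_refl i else w) (int c)\<bar> = \<bar>w (int c)\<bar>" for c
      using True weyl_minus[OF W, of 1] by (auto simp: simple_refl_1[unfolded One_nat_def])
    have n: "1 \<in> {1..n}" using i by auto
    have column: "HEdge 1 n \<in> pipe n D (nat \<bar>w (int c)\<bar>) \<longleftrightarrow> c = 1" if "c \<in> {1..n}" for c
      using top[OF weyl_abs_in(1)[OF W that] n] weyl_abs_inj[OF W, of 1 "int c"]
      unfolding pipe_iff by auto
    show ?thesis
      unfolding realizes_def abs
    proof (intro conjI ballI W')
      show "reach n E (pipe_start n k) (HEdge 1 (n + 1 - c)) \<longleftrightarrow> \<bar>w (int c)\<bar> = int k"
        if "k \<in> {1..n}" "c \<in> {1..n}" for k c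
      proof -
        have "n + 1 - c \<le> n" using that(2) by auto
        from reach_top[OF that(1) this] show ?thesis using top[OF that] by blast
      qed
      show "(if U = 0 then w \<circ> simple_refl i else w) (int c) > 0 \<longleftrightarrow>
          odd (card (self_crossings n E (nat \<bar>w (int c)\<bar>)))" if c: "c \<in> {1..n}" for c
        using parity_self_crossings[OF weyl_abs_in(1)[OF W c]] sign[OF c] column[OF c]
          weyl_abs_in(2)[OF W c] True weyl_minus[OF W, of "int c"]
        by (auto simp: simple_refl_1[unfolded One_nat_def])
    qed
  next
    case False
    then have i2: "i \<in> {2..n}" using i by auto
    define j where "j = n + 1 - i"
    interpret two_column_switch n j U L D E
      using two_column_switchI[OF D E i2 sw] unfolding j_def .
    define t where "t c = (if U = 0 then transpose (i - 1) i c else c)" for c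
    have t_in: "t c \<in> {1..n}" if "c \<in> {1..n}" for c
      using that i2 unfolding t_def by (auto simp: transpose_def)
    have app: "(if U = 0 then w \<circ> simple_refl i else w) (int c) = w (int (t c))" for c
      using i2 unfolding t_def by (auto simp: simple_refl_ge_2 transpose_def sgn_if)
    have swap: "(if U = 0 then transpose j (Suc j) (n + 1 - t c) else n + 1 - t c) = n + 1 - c" if "c \<in> {1..n}" for c
      using that i2 unfolding t_def j_def by (auto simp: transpose_def)
    have i_in: "i \<in> {1..n}" "i - 1 \<in> {1..n}" using i2 by auto
    \<comment> \<open>The tops of the two columns are ends of different pipes, which supplies the
      side condition of \<open>parity_self_crossings\<close> for U = 0.\<close>
    have single: "\<not> meets_both n D j U k" if "U = 0" "k \<in> {1..n}" for k
    proof
      assume "meets_both n D j U k"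
      then have "HEdge 1 (n + 1 - i) \<in> pipe n D k" "HEdge 1 (n + 1 - (i - 1)) \<in> pipe n D k"
        using that i2 unfolding meets_both_def j_def by (auto simp: Suc_diff_le)
      then have "\<bar>w (int i)\<bar> = \<bar>w (int (i - 1))\<bar>"
        using top[OF that(2) i_in(1)] top[OF that(2) i_in(2)] unfolding pipe_iff by simp
      then show False using weyl_abs_inj[OF W] i2 by auto
    qed
    show ?thesis
      unfolding realizes_def app
    proof (intro conjI ballI W')
      show "reach n E (pipe_start n k) (HEdge 1 (n + 1 - c)) \<longleftrightarrow> \<bar>w (int (t c))\<bar> = int k"
        if "k \<in> {1..n}" "c \<in> {1..n}" for k c
        using top[OF that(1) t_in[OF that(2)]] reach_top[OF that(1), of "n + 1 - t c"]
        unfolding swap[OF that(2)] by simp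
      show "w (int (t c)) > 0 \<longleftrightarrow> odd (card (self_crossings n E (nat \<bar>w (int (t c))\<bar>)))" if c: "c \<in> {1..n}" for c
        using parity_self_crossings[OF weyl_abs_in(1)[OF W t_in[OF c]]] sign[OF t_in[OF c]]
          single[OF _ weyl_abs_in(1)[OF W t_in[OF c]]] by (cases "U = 0") auto
    qed
  qed
qed

section \<open>The empty and the full dream\<close>

lemmas [trans] = rtranclp_trans

lemma start_index:
  assumes "k \<in> {1..n}"
  obtains m where "1 \<le> m" "m \<le> n" "k = n + 1 - m" "pipe_start n k = VEdge (2 * m - 1) m"
  using assms that[of "n + 1 - k"] unfolding pipe_start_def by auto

text \<open>Without crossings each pipe zigzags up to the top of the column in which it starts, and
  all signs are negative.\<close>

lemma realizes_empty: "realizes n {} (longest_elt n)"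
proof -
  have Om: "Omega n {} = {}" by (auto simp: Omega_iff split: if_splits)
  \<comment> \<open>The label is the column in which the pipe starts and ends; n + 1 and n + 2
    belong to curves at the right border.\<close>
  define f where "f e = (case e of VEdge i c \<Rightarrow> c
      | HEdge i c \<Rightarrow> if c \<le> n then (if odd i then c else c + 1) else if odd i then n + 2 else n + 1)" for e
  have inv: "f x = f y" if "reach n {} x y" for x y
    using that
  proof (rule reach_invariant)
    fix r c u v assume "(r, c) \<in> SYt_ex n" "(u, v) \<in> strands n {} r c"
    moreover from this(1) have "c \<le> n \<or> c = Suc n" unfolding SYt_ex_def SYt_def by auto
    ultimately show "f u = f v"
      unfolding strands_def Om f_def by (cases "odd r") auto
  qed
  have climb_step: "reach n {} (VEdge (Suc (2 * r)) m) (VEdge (2 * r - 1) m)" if "1 \<le> r" "r < m" "m \<le> n" for r m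
  proof -
    have ex: "(Suc (2 * r), m) \<in> SYt_ex n" "(2 * r, m) \<in> SYt_ex n" "(2 * r, m - 1) \<in> SYt_ex n"
      "(2 * r - 1, m - 1) \<in> SYt_ex n"
      using that unfolding SYt_ex_def SYt_def by auto
    have ar: "odd (2 * r - 1)" "Suc (2 * r - 1) = 2 * r" "Suc (m - 1) = m" "m - 1 \<le> n" "m \<noteq> n + 1" "m - 1 \<noteq> n + 1"
      using that by auto
    have "reach n {} (VEdge (Suc (2 * r)) m) (HEdge (Suc (2 * r)) m)"
      using reach_elbow(1)[OF _ ex(1), of "{}"] that Om by simp
    also have "reach n {} \<dots> (VEdge (2 * r) m)"
      using reach_rev_elbow(1)[OF _ ex(2), of "{}"] that Om ar by - (rule reach_sym, simp)
    also have "reach n {} \<dots> (HEdge (2 * r) (m - 1))"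
      using reach_rev_elbow(2)[OF _ ex(3), of "{}"] Om ar by - (rule reach_sym, simp)
    also have "reach n {} \<dots> (VEdge (2 * r - 1) m)"
      using reach_elbow(2)[OF _ ex(4), of "{}"] Om ar by - (rule reach_sym, simp)
    finally show ?thesis .
  qed
  have climb: "reach n {} (VEdge (2 * m - 1) m) (VEdge (2 * r - 1) m)" if "1 \<le> r" "r \<le> m" "m \<le> n" for r m
    using that(2,1)
  proof (induction rule: inc_induct)
    case (step r)
    have "2 * Suc r - 1 = Suc (2 * r)" by simp
    moreover have "reach n {} (VEdge (2 * m - 1) m) (VEdge (2 * Suc r - 1) m)" using step by simp
    ultimately show ?case
      using rtranclp_trans[OF _ climb_step[of r m]] step that(3) by simp
  qed simp
  have top: "reach n {} (VEdge (2 * m - 1) m) (HEdge 1 m)" if "1 \<le> m" "m \<le> n" for m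
  proof -
    have "(1, m) \<in> SYt_ex n" using that unfolding SYt_ex_def SYt_def by auto
    then have "reach n {} (VEdge 1 m) (HEdge 1 m)"
      using reach_elbow(1)[of 1 m n "{}"] Om that by simp
    moreover have "reach n {} (VEdge (2 * m - 1) m) (VEdge 1 m)" using climb[of 1 m] that by simp
    ultimately show ?thesis by simp
  qed
  show ?thesis
    unfolding realizes_def
  proof (intro conjI ballI weyl_longest)
    fix k c assume k: "k \<in> {1..n}" and c: "c \<in> {1..n}"
    obtain m where m: "1 \<le> m" "m \<le> n" "k = n + 1 - m" "pipe_start n k = VEdge (2 * m - 1) m"
      using start_index[OF k] .
    have "reach n {} (VEdge (2 * m - 1) m) (HEdge 1 (n + 1 - c)) \<longleftrightarrow> m = n + 1 - c"
    proof
      assume "reach n {} (VEdge (2 * m - 1) m) (HEdge 1 (n + 1 - c))"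
      from inv[OF this] show "m = n + 1 - c" using c by (auto simp: f_def)
    qed (use top m in simp)
    moreover have "m = n + 1 - c \<longleftrightarrow> c = k" using m c by auto
    ultimately show "reach n {} (pipe_start n k) (HEdge 1 (n + 1 - c)) \<longleftrightarrow> \<bar>longest_elt n (int c)\<bar> = int k"
      using m(4) by (simp add: longest_elt_def)
  next
    fix c assume "c \<in> {1..n}"
    then have "int c \<in> signed_index n" by (auto simp: mem_signed_index)
    then show "0 < longest_elt n (int c) \<longleftrightarrow> odd (card (self_crossings n {} (nat \<bar>longest_elt n (int c)\<bar>)))"
      by (simp add: longest_elt_def self_crossings_def Om)
  qed
qed

lemma Omega_SY: "Omega n (SY n) = SYt n"
proof -
  have "(r, c) \<in> Omega n (SY n) \<longleftrightarrow> (r, c) \<in> SYt n" for r c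
    unfolding Omega_iff SYt_def SY_def by (cases "odd r") (auto elim!: oddE)
  then show ?thesis by auto
qed

text \<open>The pipe that starts in row 2 * m - 1 runs to the right, turns in column n + 1, comes
  back along row 2 * m to the diagonal tile and climbs column m to the top. It crosses itself once,
  at (2 * m - 1, m), so all signs are positive.\<close>

lemma realizes_SY: "realizes n (SY n) id"
proof -
  note Om = Omega_SY[of n]
  \<comment> \<open>The label is m along the pipe just described; 0 is the default for the other
    edges of the diagram.\<close>
  define f where "f e = (case e of VEdge i c \<Rightarrow> if c \<le> n + 1 \<and> i < 2 * c then (i + 1) div 2 else 0
      | HEdge i c \<Rightarrow> if c \<le> n then (if i \<le> 2 * c then c else 0) else if even i then i div 2 else 0)" for e
  have inv: "f x = f y" if "reach n (SY n) x y" for x y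
    using that
  proof (rule reach_invariant)
    fix r c u v assume ex: "(r, c) \<in> SYt_ex n" and st: "(u, v) \<in> strands n (SY n) r c"
    from ex consider "(r, c) \<in> SYt n" | "r = 2 * c" "1 \<le> c" "c \<le> n" | "c = n + 1" "1 \<le> r" "r \<le> 2 * n"
      unfolding SYt_ex_def by auto
    then show "f u = f v"
    proof cases
      case 1
      then have "1 \<le> c" "c \<le> n" "1 \<le> r" "r \<le> 2 * c - 1" unfolding SYt_def by auto
      then show ?thesis using 1 st unfolding strands_def Om f_def by auto
    next
      case 2
      then have "(r, c) \<notin> SYt n" unfolding SYt_def by auto
      then show ?thesis using 2 st unfolding strands_def Om f_def by auto
    next
      case 3
      then have "(r, c) \<notin> SYt n" unfolding SYt_def by auto
      then show ?thesis using 3 st unfolding strands_def Om f_def by (cases "odd r") auto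
    qed
  qed
  let ?r = "reach n (SY n)"
  note T = rtranclp_trans[of "joined n (SY n)"]
  have path: "?r (VEdge (2 * m - 1) m) (HEdge r m)" if m: "1 \<le> m" "m \<le> n" and r: "1 \<le> r" "r \<le> 2 * m" for m r
  proof -
    have right: "?r (VEdge (2 * m - 1) m) (VEdge (2 * m - 1) c)" if "m \<le> c" "c \<le> n + 1" for c
      using that
    proof (induction rule: dec_induct)
      case (step c)
      then have b: "(2 * m - 1, c) \<in> Omega n (SY n)" using m unfolding Om SYt_def by auto
      show ?case using T[OF _ reach_cross(1)[OF b Omega_in_ex[OF b]]] step by simp
    qed simp
    have left: "?r (VEdge (2 * m) (n + 1)) (VEdge (2 * m) c)" if "c \<le> n + 1" "m + 1 \<le> c" for c
      using that
    proof (induction rule: inc_induct)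
      case (step c)
      then have b: "(2 * m, c) \<in> Omega n (SY n)" using m unfolding Om SYt_def by auto
      show ?case using T[OF _ reach_sym[OF reach_cross(1)[OF b Omega_in_ex[OF b]]]] step by simp
    qed simp
    have up: "?r (HEdge (2 * m) m) (HEdge r m)" if "r \<le> 2 * m" "1 \<le> r" for r
      using that
    proof (induction rule: inc_induct)
      case (step r)
      then have b: "(r, m) \<in> Omega n (SY n)" using m unfolding Om SYt_def by auto
      show ?case using T[OF _ reach_sym[OF reach_cross(2)[OF b Omega_in_ex[OF b]]]] step by simp
    qed simp
    have ex: "(2 * m - 1, n + 1) \<in> SYt_ex n" "(2 * m, n + 1) \<in> SYt_ex n" "(2 * m, m) \<in> SYt_ex n"
      using m unfolding SYt_ex_def by auto
    have no: "(2 * m - 1, n + 1) \<notin> Omega n (SY n)" "(2 * m, n + 1) \<notin> Omega n (SY n)" "(2 * m, m) \<notin> Omega n (SY n)"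
      unfolding Om SYt_def by auto
    have ar: "odd (2 * m - 1)" "Suc (2 * m - 1) = 2 * m" "m \<noteq> n + 1" using m by auto
    have "?r (VEdge (2 * m - 1) m) (VEdge (2 * m - 1) (n + 1))" using right m by simp
    also have "?r \<dots> (HEdge (2 * m) (n + 1))"
      using reach_rev_elbow(1)[OF no(1) ex(1)] ar by simp
    also have "?r \<dots> (VEdge (2 * m) (n + 1))"
      using reach_elbow(1)[OF no(2) ex(2)] by - (rule reach_sym, simp)
    also have "?r \<dots> (VEdge (2 * m) (m + 1))" using left m by simp
    also have "?r \<dots> (HEdge (2 * m) m)"
      using reach_rev_elbow(2)[OF no(3) ex(3)] ar by - (rule reach_sym, simp)
    also have "?r \<dots> (HEdge r m)" using up r by simp
    finally show ?thesis .
  qed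
  show ?thesis
    unfolding realizes_def
  proof (intro conjI ballI weyl_id)
    fix k c assume k: "k \<in> {1..n}" and c: "c \<in> {1..n}"
    obtain m where m: "1 \<le> m" "m \<le> n" "k = n + 1 - m" "pipe_start n k = VEdge (2 * m - 1) m"
      using start_index[OF k] .
    have "?r (VEdge (2 * m - 1) m) (HEdge 1 (n + 1 - c)) \<longleftrightarrow> m = n + 1 - c"
    proof
      assume "?r (VEdge (2 * m - 1) m) (HEdge 1 (n + 1 - c))"
      from inv[OF this] show "m = n + 1 - c" using c m by (auto simp: f_def split: if_splits)
    qed (use path[of m 1] m in simp)
    moreover have "m = n + 1 - c \<longleftrightarrow> c = k" using m c by auto
    ultimately show "?r (pipe_start n k) (HEdge 1 (n + 1 - c)) \<longleftrightarrow> \<bar>id (int c)\<bar> = int k"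
      using m(4) by simp
  next
    fix k assume "k \<in> {1..n}"
    then obtain m where m: "1 \<le> m" "m \<le> n" "k = n + 1 - m" "pipe_start n k = VEdge (2 * m - 1) m"
      using start_index by blast
    have "self_crossings n (SY n) k = {(2 * m - 1, m)}"
    proof (intro set_eqI iffI)
      fix b assume b: "b \<in> self_crossings n (SY n) k"
      obtain r c where rc: "b = (r, c)" by (cases b)
      have b: "1 \<le> c" "c \<le> n" "1 \<le> r" "r \<le> 2 * c - 1" "f (VEdge (2 * m - 1) m) = f (VEdge r c)"
        "f (VEdge (2 * m - 1) m) = f (HEdge r c)"
        using b inv unfolding rc self_crossings_iff Om SYt_def pipe_iff m(4) by auto
      then have "c = m" "(r + 1) div 2 = m" using m by (auto simp: f_def split: if_splits)
      then show "b \<in> {(2 * m - 1, m)}" using b(4) m unfolding rc by auto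
    next
      fix b assume b: "b \<in> {(2 * m - 1, m)}"
      have "HEdge (2 * m - 1) m \<in> pipe n (SY n) k" "VEdge (2 * m - 1) m \<in> pipe n (SY n) k"
        using path[of m "2 * m - 1"] m unfolding pipe_iff by auto
      moreover have "(2 * m - 1, m) \<in> Omega n (SY n)" using m unfolding Om SYt_def by auto
      ultimately show "b \<in> self_crossings n (SY n) k" using b self_crossings_iff by auto
    qed
    then show "0 < id (int k) \<longleftrightarrow> odd (card (self_crossings n (SY n) (nat \<bar>id (int k)\<bar>)))"
      using \<open>k \<in> {1..n}\<close> by simp
  qed
qed

section \<open>Ladder moves and mitosis in terms of strips\<close>

lemma sorted_wrt_box_rows:
  assumes "sorted_wrt (>) rs" "\<And>i. sorted_wrt (>) (f i)"
  shows "sorted_wrt (\<lambda>x y. fst y < fst x \<or> fst x = fst y \<and> snd y < snd x)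
    (concat (map (\<lambda>i::nat. map (\<lambda>j::nat. (i, j)) (f i)) rs))"
  using assms(1)
proof (induction rs)
  case (Cons i rs)
  have "sorted_wrt (\<lambda>x y. fst y < fst x \<or> fst x = fst y \<and> snd y < snd x) (map (\<lambda>j. (i, j)) (f i))"
    using assms(2)[of i] by (simp add: sorted_wrt_map)
  then show ?case using Cons by (auto simp: sorted_wrt_append)
qed simp

lemma sorted_box_list:
  "sorted_wrt (\<lambda>x y. fst y < fst x \<or> fst x = fst y \<and> snd y < snd x) (box_list n)"
  unfolding box_list_def
  by (rule sorted_wrt_box_rows) (simp_all add: sorted_wrt_rev del: upt_Suc)

lemma set_box_list: "set (box_list n) = SY n"
  unfolding box_list_def SY_def by (auto simp: image_iff)

lemma length_box_list: "length (box_list n) = n\<^sup>2"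
proof -
  have odd_sum: "(\<Sum>i<m. 2 * i + 1) = m\<^sup>2" for m :: nat
    by (induction m) (auto simp: power2_eq_square)
  have "length (box_list n) = sum_list (map (\<lambda>i. 2 * n - i + 1 - i) (rev [1..<n + 1]))"
    unfolding box_list_def by (simp add: length_concat comp_def del: upt_Suc)
  also have "\<dots> = sum_list (map (\<lambda>i. 2 * n - i + 1 - i) [1..<n + 1])"
    unfolding rev_map[symmetric] sum_list_rev ..
  also have "\<dots> = (\<Sum>i\<in>{1..<n + 1}. 2 * n - i + 1 - i)"
    by (simp add: interv_sum_list_conv_sum_set_nat del: upt_Suc)
  also have "\<dots> = (\<Sum>i<n. 2 * (n - Suc i) + 1)"
    by (rule sum.reindex_bij_witness[of _ Suc "\<lambda>i. i - 1"]) auto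
  also have "\<dots> = (\<Sum>i<n. 2 * i + 1)"
    using sum.nat_diff_reindex[of "\<lambda>i. 2 * i + 1" n] by simp
  finally show ?thesis using odd_sum by simp
qed

lemma finite_SY: "finite (SY n)"
  by (metis set_box_list finite_set)

lemma card_SY: "card (SY n) = n\<^sup>2"
proof -
  have "distinct (box_list n)"
    using sorted_box_list[of n] unfolding distinct_conv_nth sorted_wrt_iff_nth_less
    by (metis (no_types, lifting) less_irrefl nat_neq_iff)
  then show ?thesis using distinct_card[of "box_list n"] by (simp add: set_box_list length_box_list)
qed

abbreviation nth_box :: "nat \<Rightarrow> nat \<Rightarrow> nat \<times> nat" where
  "nth_box n k \<equiv> (box_row n k, box_col n k)"

lemma nth_box_eq: "nth_box n k = box_list n ! (k - 1)"
  by (simp add: box_row_def box_col_def)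

lemma nth_box_in: "1 \<le> k \<Longrightarrow> k \<le> n\<^sup>2 \<Longrightarrow> nth_box n k \<in> SY n"
  unfolding nth_box_eq set_box_list[symmetric] by (rule nth_mem) (simp add: length_box_list)

lemma nth_box_surj:
  assumes "b \<in> SY n"
  obtains k where "1 \<le> k" "k \<le> n\<^sup>2" "nth_box n k = b"
proof -
  obtain m where "m < length (box_list n)" "box_list n ! m = b"
    using assms unfolding set_box_list[symmetric] in_set_conv_nth by blast
  then show ?thesis using that[of "Suc m"] by (simp add: nth_box_eq[symmetric] length_box_list Suc_le_eq nth_box_eq)
qed

lemma nth_box_less:
  assumes "1 \<le> k" "k < l" "l \<le> n\<^sup>2"
  shows "box_row n l < box_row n k \<or> box_row n k = box_row n l \<and> box_col n l < box_col n k"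
proof -
  have "k - 1 < l - 1" "l - 1 < length (box_list n)" using assms by (auto simp: length_box_list)
  then show ?thesis
    using sorted_box_list[of n] unfolding sorted_wrt_iff_nth_less box_row_def box_col_def by blast
qed

lemma strip_box_in:
  assumes "i \<in> {1..n}" "1 \<le> r" "r \<le> strip_size n i"
  shows "strip_box n i r \<in> SY n" "snd (strip_box n i r) \<in> mitosis_cols n i"
  using assms by (auto simp: strip_box_def strip_size_def SY_def mitosis_cols_def elim!: oddE)

lemma right_strip_box_in:
  assumes "i \<in> {1..n}" "1 \<le> r" "r < strip_size n i"
  shows "right_box (strip_box n i r) \<in> SY n"
  using assms by (auto simp: right_box_def strip_box_def strip_size_def SY_def elim!: oddE)

lemma right_strip_box_last:
  assumes "i \<in> {1..n}"
  shows "right_box (strip_box n i (strip_size n i)) \<notin> SY n"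
  using assms by (auto simp: right_box_def strip_box_def strip_size_def SY_def)

lemma strip_box_surj:
  assumes "i \<in> {1..n}" "(p, q) \<in> SY n" "q \<in> mitosis_cols n i"
  obtains r where "1 \<le> r" "r \<le> strip_size n i" "strip_box n i r = (p, q)"
proof -
  consider "i = 1" "q = n" | "i \<noteq> 1" "q = n - i + 1" | "i \<noteq> 1" "q = n + i - 1"
    using assms(1,3) by (cases "i = 1") (auto simp: mitosis_cols_def)
  then show ?thesis
  proof cases
    case 1
    then show ?thesis using that[of p] assms by (auto simp: strip_box_def strip_size_def SY_def)
  next
    case 2
    then show ?thesis using that[of "2 * p - 1"] assms by (auto simp: strip_box_def strip_size_def SY_def)
  next
    case 3
    then show ?thesis using that[of "2 * p"] assms by (auto simp: strip_box_def strip_size_def SY_def)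
  qed
qed

lemma strip_box_inj: "i \<in> {1..n} \<Longrightarrow> strip_box n i r = strip_box n i s \<longleftrightarrow> r = s"
  by (auto simp: strip_box_def split: if_splits elim!: oddE)

lemma strip_box_neq_right: "i \<in> {1..n} \<Longrightarrow> strip_box n i r \<noteq> right_box (strip_box n i s)"
  by (auto simp: strip_box_def right_box_def split: if_splits)

lemma right_box_inj: "right_box b = right_box b' \<longleftrightarrow> b = b'"
  by (cases b; cases b') (auto simp: right_box_def)

text \<open>\<open>strip_box\<close> counts from the top while \<open>box_list\<close> starts at the
  bottom, hence the reversal.\<close>

lemma strip_box_less:
  assumes i: "i \<in> {1..n}" and "1 \<le> k" "k \<le> n\<^sup>2" "1 \<le> l" "l \<le> n\<^sup>2"
    and kr: "nth_box n k = strip_box n i r" and ls: "nth_box n l = strip_box n i s"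
  shows "k < l \<longleftrightarrow> s < r"
proof -
  have order: "s < r" if "fst (strip_box n i s) < fst (strip_box n i r) \<or>
      fst (strip_box n i r) = fst (strip_box n i s) \<and> snd (strip_box n i s) < snd (strip_box n i r)" for r s
    using i that by (auto simp: strip_box_def split: if_splits elim!: oddE)
  have "k < l \<Longrightarrow> s < r"
    using nth_box_less[of k l n] assms(2-5) kr ls order[of s r] by (metis fst_conv snd_conv)
  moreover have "l < k \<Longrightarrow> r < s"
    using nth_box_less[of l k n] assms(2-5) kr ls order[of r s] by (metis fst_conv snd_conv)
  moreover have "k = l \<Longrightarrow> r = s"
    using kr ls strip_box_inj[OF i] by metis
  ultimately show ?thesis by (metis less_asym nat_neq_iff)
qed

text \<open>The instance of \<open>strip_switch\<close> with U \<ge> 1 in which the lower box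
  disappears and the upper one appears.\<close>

definition strip_ladder :: "nat \<Rightarrow> nat \<Rightarrow> (nat \<times> nat) set \<Rightarrow> (nat \<times> nat) set \<Rightarrow> bool" where
  "strip_ladder n i D D' \<longleftrightarrow> (\<exists>U L. 1 \<le> U \<and> U < L \<and> L \<le> strip_size n i \<and>
     strip_box n i L \<in> D \<and> right_box (strip_box n i L) \<notin> D \<and>
     (\<forall>r. U < r \<and> r < L \<longrightarrow> strip_box n i r \<in> D \<and> right_box (strip_box n i r) \<in> D) \<and>
     strip_box n i U \<notin> D \<and> right_box (strip_box n i U) \<notin> D \<and>
     D' = (D \<union> {right_box (strip_box n i U)}) - {strip_box n i L})"

text \<open>The inclusion in \<open>SY n\<close> gives the moved box an index in the strip; the
  reversal of order then turns the range between k and l into the rows between U and L.\<close>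

lemma ladder_move_iff:
  assumes i: "i \<in> {1..n}"
  shows "D \<subseteq> SY n \<and> (\<exists>p q. q \<in> mitosis_cols n i \<and> ladder_move n p q D D') \<longleftrightarrow> D \<subseteq> SY n \<and> strip_ladder n i D D'"
    (is "?X \<longleftrightarrow> ?Y")
proof
  assume ?X
  then obtain p q k l where D: "D \<subseteq> SY n" and q: "q \<in> mitosis_cols n i"
    and pq: "(p, q) \<in> D" "(p, q + 1) \<notin> D" "nth_box n k = (p, q)"
    and kl: "1 \<le> k" "k + 1 \<le> l" "l \<le> n\<^sup>2"
    and l: "box_col n l \<in> {q, 2 * n - q}" "{(box_row n l, box_col n l), (box_row n l, box_col n l + 1)} \<subseteq> SY n - D"
    and btw: "\<forall>r. k + 1 \<le> r \<and> r \<le> l - 1 \<and> box_col n r \<in> {q, 2 * n - q} \<longrightarrow>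
           {(box_row n r, box_col n r), (box_row n r, box_col n r + 1)} \<subseteq> D"
    and D': "D' = (D \<union> {(box_row n l, box_col n l + 1)}) - {(p, q)}"
    unfolding ladder_move_def by blast
  \<comment> \<open>Whichever of the two columns q is, 2 * n - q is the other one.\<close>
  have cols: "{q, 2 * n - q} = mitosis_cols n i" using q i by (auto simp: mitosis_cols_def)
  obtain L where L: "1 \<le> L" "L \<le> strip_size n i" "strip_box n i L = (p, q)"
    using strip_box_surj[OF i _ q] pq(1) D by blast
  have "1 \<le> l" using kl by simp
  obtain U where U: "1 \<le> U" "U \<le> strip_size n i" "strip_box n i U = nth_box n l"
    using strip_box_surj[OF i nth_box_in[OF \<open>1 \<le> l\<close> kl(3)]] l(1) unfolding cols by blast
  have kl': "k \<le> n\<^sup>2" using kl by simp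
  have "U < L"
    using strip_box_less[OF i kl(1) kl' \<open>1 \<le> l\<close> kl(3) pq(3)[folded L(3)] U(3)[symmetric]] kl(2) by simp
  moreover have "strip_box n i r \<in> D \<and> right_box (strip_box n i r) \<in> D" if "U < r" "r < L" for r
  proof -
    have r: "1 \<le> r" "r \<le> strip_size n i" using that L by auto
    obtain m where m: "1 \<le> m" "m \<le> n\<^sup>2" "nth_box n m = strip_box n i r"
      using nth_box_surj[OF strip_box_in(1)[OF i r]] by blast
    have "k < m" using strip_box_less[OF i kl(1) kl' m(1,2) pq(3)[folded L(3)] m(3)] that by simp
    moreover have "m < l" using strip_box_less[OF i m(1,2) \<open>1 \<le> l\<close> kl(3) m(3) U(3)[symmetric]] that by simp
    moreover have "box_col n m \<in> {q, 2 * n - q}" unfolding cols using strip_box_in(2)[OF i r] m(3) by (metis snd_conv)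
    ultimately have "{(box_row n m, box_col n m), (box_row n m, box_col n m + 1)} \<subseteq> D"
      using btw by auto
    then show ?thesis unfolding m(3)[symmetric] right_box_def by simp
  qed
  moreover have "right_box (strip_box n i L) = (p, q + 1)"
    "right_box (strip_box n i U) = (box_row n l, box_col n l + 1)"
    unfolding L(3) U(3) right_box_def by simp_all
  ultimately show ?Y
    unfolding strip_ladder_def using D L U(1) U(3) pq(1,2) l(2) D'
    by (intro conjI D exI[of _ U] exI[of _ L]; simp)
next
  assume ?Y
  then obtain U L where D: "D \<subseteq> SY n" and UL: "1 \<le> U" "U < L" "L \<le> strip_size n i"
    and L: "strip_box n i L \<in> D" "right_box (strip_box n i L) \<notin> D"
    and btw: "\<And>r. U < r \<Longrightarrow> r < L \<Longrightarrow> strip_box n i r \<in> D \<and> right_box (strip_box n i r) \<in> D"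
    and U: "strip_box n i U \<notin> D" "right_box (strip_box n i U) \<notin> D"
    and D': "D' = (D \<union> {right_box (strip_box n i U)}) - {strip_box n i L}"
    unfolding strip_ladder_def by blast
  have L1: "1 \<le> L" and U_le: "U \<le> strip_size n i" and U_less: "U < strip_size n i" using UL by auto
  obtain k where k: "1 \<le> k" "k \<le> n\<^sup>2" "nth_box n k = strip_box n i L"
    using nth_box_surj[OF strip_box_in(1)[OF i L1 UL(3)]] by blast
  obtain l where l: "1 \<le> l" "l \<le> n\<^sup>2" "nth_box n l = strip_box n i U"
    using nth_box_surj[OF strip_box_in(1)[OF i UL(1) U_le]] by blast
  have kl: "k < l" using strip_box_less[OF i k(1,2) l(1,2) k(3) l(3)] UL(2) by simp
  define p q where "p = box_row n k" and "q = box_col n k"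
  have pq: "strip_box n i L = (p, q)" using k(3) by (simp add: p_def q_def)
  have q: "q \<in> mitosis_cols n i" using strip_box_in(2)[OF i L1 UL(3)] pq by simp
  have cols: "{q, 2 * n - q} = mitosis_cols n i" using q i by (auto simp: mitosis_cols_def)
  have col_l: "box_col n l \<in> {q, 2 * n - q}"
    unfolding cols using strip_box_in(2)[OF i UL(1) U_le] l(3) by (metis snd_conv)
  have r_U: "right_box (strip_box n i U) = (box_row n l, box_col n l + 1)"
    unfolding l(3)[symmetric] right_box_def by simp
  have "{(box_row n l, box_col n l), (box_row n l, box_col n l + 1)} \<subseteq> SY n - D"
    using U right_strip_box_in[OF i UL(1) U_less] strip_box_in(1)[OF i UL(1) U_le] unfolding r_U l(3) by simp
  moreover have "{(box_row n m, box_col n m), (box_row n m, box_col n m + 1)} \<subseteq> D"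
    if m: "k + 1 \<le> m" "m \<le> l - 1" "box_col n m \<in> {q, 2 * n - q}" for m
  proof -
    have mb: "1 \<le> m" "m \<le> n\<^sup>2" using m k(1) l(2) by auto
    obtain r where r: "1 \<le> r" "r \<le> strip_size n i" "strip_box n i r = nth_box n m"
      using strip_box_surj[OF i nth_box_in[OF mb]] m(3) unfolding cols by blast
    have "r < L" using strip_box_less[OF i k(1,2) mb k(3) r(3)[symmetric]] m by simp
    moreover have "m < l" using m(2) l(1) by linarith
    then have "U < r" using strip_box_less[OF i mb l(1,2) r(3)[symmetric] l(3)] by simp
    ultimately show ?thesis using btw[of r] unfolding r(3) right_box_def by simp
  qed
  moreover have "(p, q) \<in> D" "(p, q + 1) \<notin> D" using L unfolding pq right_box_def by simp_all
  moreover have "D' = (D \<union> {(box_row n l, box_col n l + 1)}) - {(p, q)}" using D' unfolding pq r_U .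
  moreover have "k + 1 \<le> l" "box_row n k = p" "box_col n k = q" using kl by (simp_all add: p_def q_def)
  ultimately have "ladder_move n p q D D'"
    unfolding ladder_move_def using k(1) l(2) col_l
    by - (rule conjI, assumption, rule conjI, assumption, rule exI[of _ k], rule exI[of _ l],
        intro conjI; (assumption | blast))
  then show ?X using D q by blast
qed

text \<open>Reversing the order turns the maximal index r_0 into the topmost row L of the strip
  without a second box. Such a row exists since the right neighbour of the last strip box lies
  outside \<open>SY n\<close>.\<close>

lemma mitosis_strip:
  assumes i: "i \<in> {1..n}" and D: "D \<subseteq> SY n"
  obtains L where "1 \<le> L" "L \<le> strip_size n i" "right_box (strip_box n i L) \<notin> D"
    "\<And>r. 1 \<le> r \<Longrightarrow> r < L \<Longrightarrow> right_box (strip_box n i r) \<in> D"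
    "mitosis n i D = (if \<forall>r. 1 \<le> r \<and> r \<le> L \<longrightarrow> strip_box n i r \<in> D
       then {D'. (\<lambda>E E'. \<exists>p q. q \<in> mitosis_cols n i \<and> ladder_move n p q E E')\<^sup>*\<^sup>* (D - {strip_box n i L}) D'}
       else {})"
proof -
  define S where "S = {r \<in> {1..n\<^sup>2}. box_col n r \<in> mitosis_cols n i \<and> (box_row n r, box_col n r + 1) \<notin> D}"
  define r0 where "r0 = Max S"
  have r0: "mitosis_index n i D = r0" unfolding mitosis_index_def r0_def S_def ..
  have size: "1 \<le> strip_size n i" using i unfolding strip_size_def by auto
  obtain m where m: "1 \<le> m" "m \<le> n\<^sup>2" "nth_box n m = strip_box n i (strip_size n i)"
    using nth_box_surj[OF strip_box_in(1)[OF i size order_refl]] by blast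
  have "box_col n m \<in> mitosis_cols n i" using strip_box_in(2)[OF i size order_refl] m(3) by (metis snd_conv)
  moreover have "(box_row n m, box_col n m + 1) = right_box (nth_box n m)" by (simp add: right_box_def)
  then have "(box_row n m, box_col n m + 1) \<notin> D" using right_strip_box_last[OF i] D unfolding m(3) by auto
  ultimately have "m \<in> S" using m unfolding S_def by simp
  moreover have fin: "finite S" unfolding S_def by simp
  ultimately have "r0 \<in> S" unfolding r0_def using Max_in by blast
  then have r0_in: "1 \<le> r0" "r0 \<le> n\<^sup>2" "box_col n r0 \<in> mitosis_cols n i" "(box_row n r0, box_col n r0 + 1) \<notin> D"
    unfolding S_def by auto
  obtain L where L: "1 \<le> L" "L \<le> strip_size n i" "strip_box n i L = nth_box n r0"
    using strip_box_surj[OF i nth_box_in[OF r0_in(1,2)] r0_in(3)] by blast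
  show ?thesis
  proof (rule that[OF L(1,2)])
    show "right_box (strip_box n i L) \<notin> D" using r0_in(4) unfolding L(3) right_box_def by simp
    show "right_box (strip_box n i r) \<in> D" if r: "1 \<le> r" "r < L" for r
    proof -
      have r_le: "r \<le> strip_size n i" using r L by simp
      obtain k where k: "1 \<le> k" "k \<le> n\<^sup>2" "nth_box n k = strip_box n i r"
        using nth_box_surj[OF strip_box_in(1)[OF i r(1) r_le]] by blast
      have "r0 < k" using strip_box_less[OF i r0_in(1,2) k(1,2) L(3)[symmetric] k(3)] r by simp
      then have "k \<notin> S" using Max_ge[OF fin] unfolding r0_def by (meson not_le)
      moreover have "box_col n k \<in> mitosis_cols n i"
        using strip_box_in(2)[OF i r(1) r_le] k(3) by (metis snd_conv)
      ultimately show ?thesis using k unfolding S_def k(3)[symmetric] right_box_def by simp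
    qed
    have "{(box_row n r, box_col n r) | r. box_col n r \<in> mitosis_cols n i \<and> r0 \<le> r \<and> r \<le> n\<^sup>2} \<subseteq> D \<longleftrightarrow>
        (\<forall>r. 1 \<le> r \<and> r \<le> L \<longrightarrow> strip_box n i r \<in> D)" (is "?P \<longleftrightarrow> ?Q")
    proof
      assume P: ?P
      show ?Q
      proof (intro allI impI)
        fix r assume r: "1 \<le> r \<and> r \<le> L"
        then have r': "1 \<le> r" "r \<le> strip_size n i" using L by auto
        obtain k where k: "1 \<le> k" "k \<le> n\<^sup>2" "nth_box n k = strip_box n i r"
          using nth_box_surj[OF strip_box_in(1)[OF i r']] by blast
        have "\<not> k < r0" using strip_box_less[OF i k(1,2) r0_in(1,2) k(3) L(3)[symmetric]] r by simp
        moreover have "box_col n k \<in> mitosis_cols n i"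
          using strip_box_in(2)[OF i r'] k(3) by (metis snd_conv)
        ultimately have "nth_box n k \<in> {(box_row n r, box_col n r) | r.
            box_col n r \<in> mitosis_cols n i \<and> r0 \<le> r \<and> r \<le> n\<^sup>2}"
          using k(2) by (intro CollectI exI[of _ k]) simp
        then have "nth_box n k \<in> D" using P by blast
        then show "strip_box n i r \<in> D" using k by simp
      qed
    next
      assume Q: ?Q
      show ?P
      proof clarify
        fix k assume k: "box_col n k \<in> mitosis_cols n i" "r0 \<le> k" "k \<le> n\<^sup>2"
        then have k1: "1 \<le> k" using r0_in by simp
        obtain r where r: "1 \<le> r" "r \<le> strip_size n i" "strip_box n i r = nth_box n k"
          using strip_box_surj[OF i nth_box_in[OF k1 k(3)] k(1)] by blast
        have "\<not> L < r" using strip_box_less[OF i k1 k(3) r0_in(1,2) r(3)[symmetric] L(3)[symmetric]] k by simp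
        then show "nth_box n k \<in> D" using Q r by (metis not_le)
      qed
    qed
    then show "mitosis n i D = (if \<forall>r. 1 \<le> r \<and> r \<le> L \<longrightarrow> strip_box n i r \<in> D
       then {D'. (\<lambda>E E'. \<exists>p q. q \<in> mitosis_cols n i \<and> ladder_move n p q E E')\<^sup>*\<^sup>* (D - {strip_box n i L}) D'}
       else {})"
      unfolding mitosis_def r0 Let_def L(3) by simp
  qed
qed

section \<open>Descent, and mitosis on reduced dreams\<close>

lemma strip_switch_sym:
  assumes i: "i \<in> {1..n}" and sw: "strip_switch n i U L D E"
  shows "strip_switch n i U L E D"
proof -
  note inj = strip_box_inj[OF i] and neq = strip_box_neq_right[OF i]
  have same: "b \<in> D \<longleftrightarrow> b \<in> E" if "b \<noteq> strip_box n i L" "1 \<le> U \<Longrightarrow> b \<noteq> right_box (strip_box n i U)" for b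
    using sw that unfolding strip_switch_def by blast
  have "U < L" using sw unfolding strip_switch_def by blast
  have A: "strip_box n i r \<in> D \<longleftrightarrow> strip_box n i r \<in> E" if "r \<noteq> L" for r
    using that by (intro same) (auto simp: inj neq)
  have B: "right_box (strip_box n i r) \<in> D \<longleftrightarrow> right_box (strip_box n i r) \<in> E" if "r \<noteq> U" for r
    using that by (intro same) (auto simp: inj neq[symmetric] right_box_inj)
  have "strip_box n i r \<in> E \<and> right_box (strip_box n i r) \<in> E" if "U < r" "r < L" for r
    using sw A[of r] B[of r] that unfolding strip_switch_def by simp
  moreover have "right_box (strip_box n i L) \<notin> E"
    using sw B[of L] \<open>U < L\<close> unfolding strip_switch_def by simp
  moreover have "strip_box n i U \<notin> E" if "1 \<le> U"
    using sw A[of U] \<open>U < L\<close> that unfolding strip_switch_def by simp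
  moreover have "b \<in> E \<longleftrightarrow> b \<in> D" if "b \<noteq> strip_box n i L \<and> (1 \<le> U \<longrightarrow> b \<noteq> right_box (strip_box n i U))" for b
    using same that by blast
  moreover have "L \<le> strip_size n i" "strip_box n i L \<in> E \<longleftrightarrow> strip_box n i L \<notin> D"
    "1 \<le> U \<Longrightarrow> right_box (strip_box n i U) \<in> E \<longleftrightarrow> right_box (strip_box n i U) \<notin> D"
    using sw unfolding strip_switch_def by blast+
  ultimately show ?thesis
    using \<open>U < L\<close> unfolding strip_switch_def by simp
qed

section \<open>A weight that decreases under ladder moves\<close>

definition box_weight :: "nat \<Rightarrow> nat \<times> nat \<Rightarrow> nat" where
  "box_weight n b = fst b * (2 * n + 1) + snd b"

definition weight :: "nat \<Rightarrow> (nat \<times> nat) set \<Rightarrow> nat" where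
  "weight n D = sum (box_weight n) D"

text \<open>The base 2 * n + 1 exceeds every column that occurs, even that of a right neighbour, so
  weights compare rows before columns. The new box of a ladder move is higher up, or further left in
  the same row.\<close>

lemma box_weight_less:
  assumes i: "i \<in> {1..n}" and UL: "1 \<le> U" "U < L" "L \<le> strip_size n i"
  shows "box_weight n (right_box (strip_box n i U)) < box_weight n (strip_box n i L)"
proof -
  obtain p q where b: "right_box (strip_box n i U) = (p, q)" by fastforce
  obtain p' q' where b': "strip_box n i L = (p', q')" by fastforce
  have "q \<le> 2 * n" using b i by (auto simp: right_box_def strip_box_def split: if_splits)
  have "p < p' \<or> p = p' \<and> q < q'"
    using b b' i UL by (auto simp: right_box_def strip_box_def split: if_splits elim!: oddE)
  then show ?thesis
  proof
    assume "p < p'"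
    then have "p * (2 * n + 1) + (2 * n + 1) \<le> p' * (2 * n + 1)"
      by (metis add.commute mult_Suc mult_le_mono1 Suc_leI)
    then show ?thesis using \<open>q \<le> 2 * n\<close> unfolding b b' box_weight_def by simp
  qed (simp add: b b' box_weight_def)
qed

lemma weight_move:
  assumes "finite D" "a \<in> D" "b \<notin> D" "a \<noteq> b"
  shows "weight n (D \<union> {b} - {a}) + box_weight n a = weight n D + box_weight n b"
    and "card (D \<union> {b} - {a}) = card D"
proof -
  have "D \<union> {b} - {a} = insert b (D - {a})" using assms by auto
  then have "weight n (D \<union> {b} - {a}) = box_weight n b + weight n (D - {a})"
    and "card (D \<union> {b} - {a}) = Suc (card (D - {a}))"
    using assms unfolding weight_def by auto
  then show "weight n (D \<union> {b} - {a}) + box_weight n a = weight n D + box_weight n b"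
    "card (D \<union> {b} - {a}) = card D"
    using assms sum.remove[of D a "box_weight n"] card_Suc_Diff1[of D a] unfolding weight_def by auto
qed

lemma weight_less:
  assumes "finite D" "E \<subset> D" "D \<subseteq> SY n"
  shows "weight n E < weight n D"
proof -
  obtain b where b: "b \<in> D - E" using assms by blast
  then have "0 < box_weight n b" using assms(3) unfolding box_weight_def SY_def by auto
  with b show ?thesis
    unfolding weight_def using assms by (intro sum_strict_mono2[of D E b]) auto
qed

text \<open>The topmost row of a strip whose pattern is cross--elbow can be changed together with the
  nearest row above it that does not consist of two crosses.\<close>

lemma descent_exists:
  assumes D: "D \<subseteq> SY n" and ne: "D \<noteq> {}"
  obtains i U L E where "i \<in> {1..n}" "E \<subseteq> SY n" "strip_switch n i U L D E" "weight n E < weight n D"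
    "if U = 0 then Suc (card E) = card D else card E \<le> card D"
proof -
  have fin: "finite D" using D finite_SY finite_subset by blast
  obtain p q0 where "(p, q0) \<in> D" using ne by fastforce
  \<comment> \<open>The rightmost box of a row of D has no right neighbour in D, so the strip
    through its column contains a cross--elbow row.\<close>
  define q where "q = Max {q. (p, q) \<in> D}"
  have "{q. (p, q) \<in> D} = snd ` (D \<inter> {p} \<times> UNIV)" by force
  then have finq: "finite {q. (p, q) \<in> D}" using fin by simp
  then have "q \<in> {q. (p, q) \<in> D}" unfolding q_def using \<open>(p, q0) \<in> D\<close> by (intro Max_in) auto
  then have pq: "(p, q) \<in> D" by simp
  have "(p, Suc q) \<notin> D" using Max_ge[OF finq, of "Suc q"] unfolding q_def by auto
  define i where "i = (if q \<le> n then n + 1 - q else q - n + 1)"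
  have "(p, q) \<in> SY n" using pq D by blast
  then have i: "i \<in> {1..n}" and q: "q \<in> mitosis_cols n i"
    unfolding i_def SY_def mitosis_cols_def by auto
  define P where "P r \<longleftrightarrow> 1 \<le> r \<and> r \<le> strip_size n i \<and> strip_box n i r \<in> D \<and> right_box (strip_box n i r) \<notin> D" for r
  obtain r where "P r"
    using strip_box_surj[OF i \<open>(p, q) \<in> SY n\<close> q] pq \<open>(p, Suc q) \<notin> D\<close> unfolding P_def
    by (metis right_box_def fst_conv snd_conv)
  define L where "L = (LEAST r. P r)"
  have "P L" unfolding L_def by (rule LeastI) (rule \<open>P r\<close>)
  have above: "\<not> P r" if "r < L" for r using that not_less_Least unfolding L_def by blast
  have L: "1 \<le> L" "L \<le> strip_size n i" "strip_box n i L \<in> D" "right_box (strip_box n i L) \<notin> D"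
    using \<open>P L\<close> unfolding P_def by auto
  define full where "full r \<longleftrightarrow> strip_box n i r \<in> D \<and> right_box (strip_box n i r) \<in> D" for r
  \<comment> \<open>The alternative r = 0 guarantees a greatest value; U = 0 means that all rows
    above L are full.\<close>
  define U where "U = (GREATEST r. r = 0 \<or> r < L \<and> \<not> full r)"
  have U: "U = 0 \<or> U < L \<and> \<not> full U"
    unfolding U_def by (rule GreatestI_nat[of _ 0 L]) auto
  have between: "full r" if "U < r" "r < L" for r
    using that Greatest_le_nat[of "\<lambda>r. r = 0 \<or> r < L \<and> \<not> full r" r L] unfolding U_def by fastforce
  have UL: "U < L" using U L by auto
  let ?A = "strip_box n i" and ?B = "\<lambda>r. right_box (strip_box n i r)"
  note neq = strip_box_neq_right[OF i]
  show ?thesis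
  proof (cases "U = 0")
    case True
    define E where "E = D - {?A L}"
    have "strip_switch n i U L D E"
      unfolding strip_switch_def using UL L between True by (auto simp: E_def full_def)
    moreover have "weight n E < weight n D" using weight_less[OF fin _ D, of E] L(3) unfolding E_def by auto
    moreover have "Suc (card E) = card D" unfolding E_def by (rule card_Suc_Diff1[OF fin L(3)])
    ultimately show ?thesis using that[OF i, of E U L] D True unfolding E_def by auto
  next
    case False
    then have U1: "1 \<le> U" by simp
    have U_size: "U < strip_size n i" using UL L by simp
    \<comment> \<open>Row U is not full and, by minimality of L, not cross--elbow, so its first box
      is an elbow.\<close>
    have AU: "?A U \<notin> D"
      using above[OF UL] U False U_size unfolding P_def full_def by auto
    \<comment> \<open>If the second box of row U is present, a double crossing is removed; otherwise
      this is a ladder move.\<close>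
    define E where "E = (if ?B U \<in> D then D - {?A L, ?B U} else D \<union> {?B U} - {?A L})"
    have "strip_switch n i U L D E"
      unfolding strip_switch_def using UL U1 L AU between neq[of L U] by (auto simp: E_def full_def)
    moreover have "E \<subseteq> SY n"
      using D right_strip_box_in[OF i U1 U_size] unfolding E_def by auto
    moreover have "weight n E < weight n D \<and> card E \<le> card D"
    proof (cases "?B U \<in> D")
      case True
      then have "E \<subset> D" using L(3) unfolding E_def by auto
      then show ?thesis using weight_less[OF fin _ D] card_mono[OF fin, of E] by auto
    next
      case B: False
      then show ?thesis
        using weight_move(1)[OF fin L(3) B neq, of n] weight_move(2)[OF fin L(3) B neq] box_weight_less[OF i U1 UL L(2)] unfolding E_def by auto
    qed
    ultimately show ?thesis using that[OF i, of E U L] False by auto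
  qed
qed

lemma strip_switch_realizes_back:
  assumes "D \<subseteq> SY n" "E \<subseteq> SY n" "i \<in> {1..n}" "strip_switch n i U L D E" "realizes n E w"
  shows "realizes n D (if U = 0 then w \<circ> simple_refl i else w)"
  using strip_switch_realizes[OF assms(2,1,3) strip_switch_sym[OF assms(3,4)] assms(5)] .

lemma comp_simple_refl_twice: "i \<in> {1..n} \<Longrightarrow> w \<circ> simple_refl i \<circ> simple_refl i = w"
  by (auto simp: fun_eq_iff simple_refl_involution)

text \<open>Induction on the weight, carrying the element back along a switch. For U = 0 one box is
  lost and the length changes by at most one; otherwise the element is the same and the number of
  boxes does not grow. The bound is therefore inherited from the empty dream.\<close>

lemma realizes_exists:
  assumes "D \<subseteq> SY n"
  shows "\<exists>w. realizes n D w \<and> n\<^sup>2 \<le> weyl_length n w + card D"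
  using assms
proof (induction "weight n D" arbitrary: D rule: less_induct)
  case less
  show ?case
  proof (cases "D = {}")
    case True
    then show ?thesis using realizes_empty weyl_length_longest by fastforce
  next
    case False
    obtain i U L E where i: "i \<in> {1..n}" and E: "E \<subseteq> SY n" and sw: "strip_switch n i U L D E"
      and wt: "weight n E < weight n D" and card: "if U = 0 then Suc (card E) = card D else card E \<le> card D"
      using descent_exists[OF less.prems False] .
    obtain v where v: "realizes n E v" "n\<^sup>2 \<le> weyl_length n v + card E"
      using less.hyps[OF wt E] by blast
    have R: "realizes n D (if U = 0 then v \<circ> simple_refl i else v)"
      by (rule strip_switch_realizes_back[OF less.prems E i sw v(1)])
    have vW: "v \<in> weyl_group n" using v(1) unfolding realizes_def by blast
    have "weyl_length n v \<le> weyl_length n (v \<circ> simple_refl i) + 1"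
      using weyl_length_simple_refl_le[OF weyl_comp[OF vW weyl_simple_refl[OF i]] i]
      unfolding comp_simple_refl_twice[OF i] .
    then show ?thesis using R v(2) card by (cases "U = 0") (auto intro!: exI[of _ "if U = 0 then v \<circ> simple_refl i else v"])
  qed
qed

lemma realizes_iff: "D \<subseteq> SY n \<Longrightarrow> realizes n D w \<longleftrightarrow> pd_elt n D = w"
  using realizes_exists realizes_pd_elt by metis

lemma realizes_bound: "D \<subseteq> SY n \<Longrightarrow> realizes n D w \<Longrightarrow> n\<^sup>2 \<le> weyl_length n w + card D"
  using realizes_exists realizes_pd_elt by metis

section \<open>Reduced dreams under ladder moves and mitosis\<close>

definition reduced_dreams :: "nat \<Rightarrow> (int \<Rightarrow> int) \<Rightarrow> (nat \<times> nat) set set" where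
  "reduced_dreams n w = {D. D \<subseteq> SY n \<and> realizes n D w \<and> card D + weyl_length n w = n\<^sup>2}"

lemma reduced_dreams_eq: "{D \<in> SPD n. reduced_pd n D \<and> pd_elt n D = w} = reduced_dreams n w"
proof -
  have "int a = int b - int c \<longleftrightarrow> a + c = b" for a b c by linarith
  then have "reduced_pd n D \<longleftrightarrow> card D + weyl_length n (pd_elt n D) = n\<^sup>2" for D
    unfolding reduced_pd_def weyl_length_longest by blast
  then show ?thesis
    unfolding reduced_dreams_def SPD_def using realizes_iff by auto
qed

lemma reduced_dreams_id: "reduced_dreams n id = {SY n}"
proof -
  have "D = SY n" if "D \<subseteq> SY n" "card D = n\<^sup>2" for D
    using card_subset_eq[OF finite_SY that(1)] that(2) card_SY by simp
  then show ?thesis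
    unfolding reduced_dreams_def using realizes_SY by (auto simp: weyl_length_id[unfolded id_def] weyl_length_id card_SY)
qed

text \<open>The disjunction allows a move to be followed from either end, as both boxes involved lie
  in \<open>SY n\<close> by their place in the strip.\<close>

lemma strip_ladder_switch:
  assumes i: "i \<in> {1..n}" and D: "D \<subseteq> SY n \<or> D' \<subseteq> SY n" and l: "strip_ladder n i D D'"
  obtains U L where "1 \<le> U" "strip_switch n i U L D D'" "D \<subseteq> SY n" "D' \<subseteq> SY n" "card D' = card D"
    "weight n D' < weight n D"
proof -
  obtain U L where UL: "1 \<le> U" "U < L" "L \<le> strip_size n i"
    and L: "strip_box n i L \<in> D" "right_box (strip_box n i L) \<notin> D"
    and btw: "\<And>r. U < r \<Longrightarrow> r < L \<Longrightarrow> strip_box n i r \<in> D \<and> right_box (strip_box n i r) \<in> D"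
    and U: "strip_box n i U \<notin> D" "right_box (strip_box n i U) \<notin> D"
    and D': "D' = D \<union> {right_box (strip_box n i U)} - {strip_box n i L}"
    using l unfolding strip_ladder_def by blast
  have L1: "1 \<le> L" and U_size: "U < strip_size n i" using UL by auto
  note neq = strip_box_neq_right[OF i]
  have in_SY: "D \<subseteq> SY n" "D' \<subseteq> SY n"
    using D right_strip_box_in[OF i UL(1) U_size] strip_box_in(1)[OF i L1 UL(3)] unfolding D' by auto
  have fin: "finite D" using in_SY(1) finite_SY finite_subset by blast
  have "strip_switch n i U L D D'"
    unfolding strip_switch_def D' using UL L U btw neq[of L U] by auto
  moreover have "card D' = card D" "weight n D' < weight n D"
    using weight_move(1)[OF fin L(1) U(2) neq, of n] weight_move(2)[OF fin L(1) U(2) neq] box_weight_less[OF i UL] unfolding D' by auto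
  ultimately show ?thesis using that UL(1) in_SY by blast
qed

lemma strip_ladder_reduced_dreams:
  assumes i: "i \<in> {1..n}" and l: "strip_ladder n i D D'"
  shows "D \<in> reduced_dreams n w \<longleftrightarrow> D' \<in> reduced_dreams n w"
proof -
  have "?thesis" if sub: "D \<subseteq> SY n \<or> D' \<subseteq> SY n"
  proof -
    obtain U L where "1 \<le> U" and sw: "strip_switch n i U L D D'" and D: "D \<subseteq> SY n" "D' \<subseteq> SY n"
      and card: "card D' = card D"
      using strip_ladder_switch[OF i sub l] by metis
    have "realizes n D w \<longleftrightarrow> realizes n D' w"
      using strip_switch_realizes[OF D i sw, of w] strip_switch_realizes_back[OF D i sw, of w] \<open>1 \<le> U\<close> by auto
    then show ?thesis using D card unfolding reduced_dreams_def by simp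
  qed
  then show ?thesis unfolding reduced_dreams_def by blast
qed

abbreviation column_ladder :: "nat \<Rightarrow> nat \<Rightarrow> (nat \<times> nat) set \<Rightarrow> (nat \<times> nat) set \<Rightarrow> bool" where
  "column_ladder n i E E' \<equiv> \<exists>p q. q \<in> mitosis_cols n i \<and> ladder_move n p q E E'"

lemma ladders_reduced_dreams:
  assumes i: "i \<in> {1..n}" and "(column_ladder n i)\<^sup>*\<^sup>* D D'" and "D \<in> reduced_dreams n w"
  shows "D' \<in> reduced_dreams n w"
  using assms(2)
proof (induction)
  case (step E E')
  then have "E \<subseteq> SY n" unfolding reduced_dreams_def by blast
  then have "strip_ladder n i E E'" using ladder_move_iff[OF i] step.hyps(2) by blast
  then show ?case using strip_ladder_reduced_dreams[OF i] step.IH by blast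
qed (rule assms(3))

lemma remove_first_switch:
  assumes i: "i \<in> {1..n}" and L: "1 \<le> L" "L \<le> strip_size n i" "right_box (strip_box n i L) \<notin> D"
    and above: "\<And>r. 1 \<le> r \<Longrightarrow> r < L \<Longrightarrow> strip_box n i r \<in> D \<and> right_box (strip_box n i r) \<in> D"
    and "strip_box n i L \<in> D"
  shows "strip_switch n i 0 L D (D - {strip_box n i L})"
  using assms unfolding strip_switch_def by auto

lemma mitosis_subset:
  assumes i: "i \<in> {1..n}" and len: "weyl_length n (w \<circ> simple_refl i) = weyl_length n w + 1"
    and D: "D \<in> reduced_dreams n w"
  shows "mitosis n i D \<subseteq> reduced_dreams n (w \<circ> simple_refl i)"
proof
  fix D' assume D': "D' \<in> mitosis n i D"
  have D_SY: "D \<subseteq> SY n" and R: "realizes n D w" and card: "card D + weyl_length n w = n\<^sup>2"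
    using D unfolding reduced_dreams_def by auto
  obtain L where L: "1 \<le> L" "L \<le> strip_size n i" "right_box (strip_box n i L) \<notin> D"
    and B: "\<And>r. 1 \<le> r \<Longrightarrow> r < L \<Longrightarrow> right_box (strip_box n i r) \<in> D"
    and mit: "mitosis n i D = (if \<forall>r. 1 \<le> r \<and> r \<le> L \<longrightarrow> strip_box n i r \<in> D
       then {D'. (column_ladder n i)\<^sup>*\<^sup>* (D - {strip_box n i L}) D'} else {})"
    using mitosis_strip[OF i D_SY] by blast
  have A: "\<And>r. 1 \<le> r \<Longrightarrow> r \<le> L \<Longrightarrow> strip_box n i r \<in> D" and lad: "(column_ladder n i)\<^sup>*\<^sup>* (D - {strip_box n i L}) D'"
    using D' unfolding mit by (auto split: if_splits)
  let ?E = "D - {strip_box n i L}"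
  have E: "?E \<subseteq> SY n" using D_SY by blast
  have "strip_switch n i 0 L D ?E"
    by (rule remove_first_switch[OF i L]) (use A B L in auto)
  from strip_switch_realizes[OF D_SY E i this R] have "realizes n ?E (w \<circ> simple_refl i)" by simp
  moreover have "Suc (card ?E) = card D"
    using A[of L] L D_SY finite_SY finite_subset card_Suc_Diff1 by (metis order_refl)
  ultimately have "?E \<in> reduced_dreams n (w \<circ> simple_refl i)"
    unfolding reduced_dreams_def using E card len by auto
  then show "D' \<in> reduced_dreams n (w \<circ> simple_refl i)" by (rule ladders_reduced_dreams[OF i lad])
qed

lemma ladders_source:
  assumes i: "i \<in> {1..n}" and "(column_ladder n i)\<^sup>*\<^sup>* E D'" "E \<subseteq> SY n" "D' \<in> reduced_dreams n w"
  shows "E \<in> reduced_dreams n w"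
  using assms(2,3)
proof (induction rule: converse_rtranclp_induct)
  case base
  show ?case by (rule assms(4))
next
  case (step E E')
  then have l: "strip_ladder n i E E'" using ladder_move_iff[OF i] by blast
  obtain U L where "E' \<subseteq> SY n"
    using strip_ladder_switch[OF i _ l] step.prems by metis
  then show ?case using step.IH strip_ladder_reduced_dreams[OF i l] by blast
qed

lemma mitosis_superset:
  assumes i: "i \<in> {1..n}" and w: "w \<in> weyl_group n"
    and len: "weyl_length n (w \<circ> simple_refl i) = weyl_length n w + 1"
    and D': "D' \<in> reduced_dreams n (w \<circ> simple_refl i)"
  shows "\<exists>D\<in>reduced_dreams n w. D' \<in> mitosis n i D"
proof -
  let ?A = "strip_box n i" and ?B = "\<lambda>r. right_box (strip_box n i r)"
  let ?v = "w \<circ> simple_refl i"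
  note neq = strip_box_neq_right[OF i]
  \<comment> \<open>Undoing a ladder move raises the weight, so a source of maximal weight in this
    finite set admits no further undoing.\<close>
  define S where "S = {E. E \<subseteq> SY n \<and> (column_ladder n i)\<^sup>*\<^sup>* E D'}"
  have "finite S" unfolding S_def using finite_SY by (simp add: finite_subset[of _ "Pow (SY n)"] Collect_mono_iff Pow_def)
  moreover have "D' \<in> S" using D' unfolding S_def reduced_dreams_def by simp
  ultimately obtain E where E_in: "E \<in> S" and max: "\<And>F. F \<in> S \<Longrightarrow> weight n F \<le> weight n E"
    using Max_in[of "weight n ` S"] Max_ge[of "weight n ` S"] by (metis (no_types, lifting) empty_iff finite_imageI imageE image_eqI image_is_empty)
  have E: "E \<subseteq> SY n" and lad: "(column_ladder n i)\<^sup>*\<^sup>* E D'" using E_in unfolding S_def by auto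
  have fin: "finite E" using E finite_SY finite_subset by blast
  have "E \<in> reduced_dreams n ?v" by (rule ladders_source[OF i lad E D'])
  then have R: "realizes n E ?v" and card: "card E + weyl_length n ?v = n\<^sup>2"
    unfolding reduced_dreams_def by auto
  obtain L where L: "1 \<le> L" "L \<le> strip_size n i" "?B L \<notin> E"
    and B: "\<And>r. 1 \<le> r \<Longrightarrow> r < L \<Longrightarrow> ?B r \<in> E"
    using mitosis_strip[OF i E] by metis
  \<comment> \<open>All second boxes above row L are present. The lowest row U there without a first
    box is followed by full rows down to L, so the first box of row L decides between a removable
    double crossing, against the bound on the number of boxes, and a ladder move that could still be
    undone.\<close>
  have A: "?A r \<in> E" if r: "1 \<le> r" "r < L" for r
  proof (rule ccontr)
    assume "?A r \<notin> E"
    define U where "U = (GREATEST r. r < L \<and> ?A r \<notin> E)"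
    have U: "U < L \<and> ?A U \<notin> E"
      unfolding U_def by (rule GreatestI_nat[of _ r L]) (use r \<open>?A r \<notin> E\<close> in auto)
    have "r \<le> U" unfolding U_def by (rule Greatest_le_nat[of _ r L]) (use r \<open>?A r \<notin> E\<close> in auto)
    then have U1: "1 \<le> U" and U_size: "U < strip_size n i" using r U L by auto
    have btw: "?A s \<in> E \<and> ?B s \<in> E" if "U < s" "s < L" for s
      using that B[of s] Greatest_le_nat[of "\<lambda>r. r < L \<and> ?A r \<notin> E" s L] unfolding U_def by fastforce
    have BU: "?B U \<in> E" using B U1 U by blast
    show False
    proof (cases "?A L \<in> E")
      case True
      let ?F = "E - {?A L, ?B U}"
      have "strip_switch n i U L E ?F"
        unfolding strip_switch_def using U U1 L btw True BU neq[of L U] by auto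
      from strip_switch_realizes[OF E _ i this R] have "realizes n ?F ?v" using U1 E by auto
      then have "n\<^sup>2 \<le> weyl_length n ?v + card ?F" using E by (intro realizes_bound) auto
      moreover have "card ?F < card E" by (rule psubset_card_mono[OF fin]) (use True in auto)
      ultimately show False using card by simp
    next
      case False
      \<comment> \<open>\<open>F\<close> is the dream from which a ladder move from row L to row U
        produces \<open>E\<close>.\<close>
      define F where "F = E \<union> {?A L} - {?B U}"
      have F: "F \<subseteq> SY n" using E strip_box_in(1)[OF i L(1,2)] unfolding F_def by auto
      have "E = F \<union> {?B U} - {?A L}" using False BU unfolding F_def by auto
      moreover have "?A s \<in> F \<and> ?B s \<in> F" if "U < s" "s < L" for s
        using btw[OF that] neq[of s U] that by (simp add: F_def right_box_inj strip_box_inj[OF i])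
      moreover have "?A L \<in> F" using neq[of L U] unfolding F_def by simp
      moreover have "?B L \<notin> F" using L(3) neq[of L L] unfolding F_def by auto
      moreover have "?A U \<notin> F" using U strip_box_inj[OF i, of U L] unfolding F_def by auto
      moreover have "?B U \<notin> F" unfolding F_def by simp
      ultimately have "strip_ladder n i F E"
        unfolding strip_ladder_def using U1 L(2) U
        by blast
      moreover from strip_ladder_switch[OF i disjI1[OF F] this] have "weight n E < weight n F" by metis
      ultimately have "F \<in> S" "weight n E < weight n F"
        using ladder_move_iff[OF i, of F E] F lad unfolding S_def by (auto intro: converse_rtranclp_into_rtranclp)
      then show False using max by fastforce
    qed
  qed
  \<comment> \<open>All rows above L are full, so removing a first box from row L would lead back to
    \<open>w\<close> with two boxes fewer than the bound allows.\<close>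
  have AL: "?A L \<notin> E"
  proof
    assume AL: "?A L \<in> E"
    let ?F = "E - {?A L}"
    have F: "?F \<subseteq> SY n" using E by blast
    have "strip_switch n i 0 L E ?F" by (rule remove_first_switch[OF i L]) (use A B AL in auto)
    from strip_switch_realizes[OF E F i this R] have "realizes n ?F (?v \<circ> simple_refl i)" by simp
    then have "realizes n ?F w" unfolding comp_simple_refl_twice[OF i] .
    then have "n\<^sup>2 \<le> weyl_length n w + card ?F" by (rule realizes_bound[OF F])
    moreover have "card ?F < card E" by (rule psubset_card_mono[OF fin]) (use AL in auto)
    ultimately show False using card len by simp
  qed
  \<comment> \<open>Inserting the missing first box inverts the removal performed by
    \<open>mitosis\<close>.\<close>
  let ?D = "insert (?A L) E"
  have D: "?D \<subseteq> SY n" using E strip_box_in(1)[OF i L(1,2)] by auto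
  have DE: "?D - {?A L} = E" using AL by auto
  have BL: "?B L \<notin> ?D" using L(3) neq[of L L] by auto
  have "strip_switch n i 0 L ?D (?D - {?A L})"
    by (rule remove_first_switch[OF i L(1,2) BL]) (use A B in auto)
  then have "strip_switch n i 0 L ?D E" unfolding DE .
  from strip_switch_realizes_back[OF D E i this R] have "realizes n ?D (?v \<circ> simple_refl i)" by simp
  then have "realizes n ?D w" unfolding comp_simple_refl_twice[OF i] .
  then have "?D \<in> reduced_dreams n w"
    unfolding reduced_dreams_def using D card len AL fin by simp
  moreover have "D' \<in> mitosis n i ?D"
  proof -
    obtain L' where L': "1 \<le> L'" "L' \<le> strip_size n i" "?B L' \<notin> ?D" "\<And>r. 1 \<le> r \<Longrightarrow> r < L' \<Longrightarrow> ?B r \<in> ?D"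
      and mit: "mitosis n i ?D = (if \<forall>r. 1 \<le> r \<and> r \<le> L' \<longrightarrow> ?A r \<in> ?D
       then {D'. (column_ladder n i)\<^sup>*\<^sup>* (?D - {?A L'}) D'} else {})"
      by (rule mitosis_strip[OF i D]) (rule that; assumption)
    \<comment> \<open>The inserted box is a first box, so the topmost row without a second box is
      still L.\<close>
    have "L' = L"
      using L'(1,3) L'(4)[of L] B[of L'] BL L(1) by (metis insertCI nat_neq_iff)
    moreover have "\<forall>r. 1 \<le> r \<and> r \<le> L \<longrightarrow> ?A r \<in> ?D" using A by (metis insertCI le_neq_implies_less insertI1)
    ultimately show ?thesis unfolding mit using DE lad by simp
  qed
  ultimately show ?thesis by blast
qed

lemma mitosis_set_reduced_dreams:
  assumes "i \<in> {1..n}" "w \<in> weyl_group n" "weyl_length n (w \<circ> simple_refl i) = weyl_length n w + 1"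
  shows "mitosis_set n i (reduced_dreams n w) = reduced_dreams n (w \<circ> simple_refl i)"
  unfolding mitosis_set_def using mitosis_subset[OF assms(1,3)] mitosis_superset[OF assms] by blast

section \<open>Induction along a reduced word\<close>

lemma weyl_length_word_prod_le: "set is \<subseteq> {1..n} \<Longrightarrow> weyl_length n (word_prod is) \<le> length is"
  unfolding weyl_length_def by (rule Least_le) blast

text \<open>A letter adds at most one to the length, so prefixes of a reduced word are reduced and
  every letter satisfies the length condition of \<open>mitosis_set_reduced_dreams\<close>.\<close>

lemma fold_mitosis_reduced_word:
  assumes "set is \<subseteq> {1..n}" "weyl_length n (word_prod is) = length is"
  shows "fold (mitosis_set n) is {SY n} = reduced_dreams n (word_prod is)"
  using assms
proof (induction "is" rule: rev_induct)
  case Nil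
  show ?case using reduced_dreams_id by (simp add: word_prod_def id_def)
next
  case (snoc i "is")
  then have i: "i \<in> {1..n}" and "is": "set is \<subseteq> {1..n}" by auto
  have w: "word_prod is \<in> weyl_group n" by (rule weyl_word_prod[OF "is"])
  have "length is + 1 \<le> weyl_length n (word_prod is) + 1"
    using weyl_length_simple_refl_le[OF w i] snoc.prems(2) unfolding word_prod_snoc by simp
  then have len: "weyl_length n (word_prod is) = length is"
    using weyl_length_word_prod_le[OF "is"] by simp
  have "fold (mitosis_set n) (is @ [i]) {SY n} = mitosis_set n i (reduced_dreams n (word_prod is))"
    using snoc.IH[OF "is" len] by simp
  also have "\<dots> = reduced_dreams n (word_prod is \<circ> simple_refl i)"
    by (rule mitosis_set_reduced_dreams[OF i w])
      (use len snoc.prems(2) in \<open>simp add: word_prod_snoc comp_def\<close>)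
  finally show ?case unfolding word_prod_snoc .
qed

theorem theorem1:
  fixes n :: nat and w :: "int \<Rightarrow> int"
  assumes "n \<ge> 2" and "w \<in> weyl_group n"
  shows "iterated_mitosis n w = {D \<in> SPD n. reduced_pd n D \<and> pd_elt n D = w}"
proof -
  have "map (letter_C n) (min_subseq n w) \<in> reduced_words n w"
    by (rule min_subseq_word[OF assms(2)])
  then show ?thesis
    unfolding iterated_mitosis_def reduced_dreams_eq reduced_words_def
    using fold_mitosis_reduced_word by auto
qed

end
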